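(* Let $f$ and $g$ be finite Blaschke products of degree $m$ and $n$ respectively. Suppose there are exactly $r<\infty$ unordered pairs of (distinct) points on the unit circle $\mathbb{T}$, counted with multiplicity, that are not separated by $(f,g)$. Then the codimension of $\mathrm{Alg}(f,g)$ in $O(\mathbb{D})$ is $$\frac{(m-1)(n-1)-r}{2}.$$
   Context: $\mathbb{D}$ is the open unit disk in $\mathbb{C}$ and $O(\mathbb{D})$ is the space of holomorphic functions on $\mathbb{D}$ with the topology of uniform convergence on compact sets. $\mathrm{Alg}(f,g)$ is the closure in $O(\mathbb{D})$ of the set of polynomials in $f$ and $g$. Codimension is as a vector subspace. A pair of distinct points $\lambda,\mu$ is not separated by $(f,g)$ if $f(\lambda)=f(\mu)$ and $g(\lambda)=g(\mu)$. Multiplicity: write, up to unimodular constants, $f=p^\sim/p$ and $g=q^\sim/q$, where $p(z)=\prod_{i=1}^m(1-\overline{\alpha_i}z)$, $p^\sim(z)=\prod_{i=1}^m(z-\alpha_i)$, $q(z)=\prod_{i=1}^n(1-\overline{\beta_i}z)$, $q^\sim(z)=\prod_{i=1}^n(z-\beta_i)$, with $\alpha_i,\beta_i\in\mathbb{D}$. Let $$F(z,w)=\frac{p(z)p^\sim(w)-p(w)p^\sim(z)}{z-w},\qquad G(z,w)=\frac{q(z)q^\sim(w)-q(w)q^\sim(z)}{z-w}.$$ The multiplicity of the pair $\{\lambda,\mu\}$ is the intersection multiplicity of the plane curves $F=0$ and $G=0$ at the point $(\lambda,\mu)$ (the same as at $(\mu,\lambda)$ by symmetry). *)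

theory Defs
  imports "HOL-Complex_Analysis.Complex_Analysis" "HOL-Library.Function_Algebras"
    "HOL-Computational_Algebra.Fraction_Field"
begin

section \<open>Dimension of a quotient space\<close>

text \<open>For a subspace \<open>W\<close> of \<open>V\<close>, this is the dimension of \<open>V / W\<close>: the largest number of elements
  of \<open>V\<close> whose classes modulo \<open>W\<close> are linearly independent, or \<open>\<infinity>\<close> if there is no largest one.\<close>

definition (in vector_space) codim :: "'b set \<Rightarrow> 'b set \<Rightarrow> enat" where
  "codim V W = Sup {enat (card B) | B. finite B \<and> B \<subseteq> V \<and>
     (\<forall>u. (\<Sum>b\<in>B. scale (u b) b) \<in> W \<longrightarrow> (\<forall>b\<in>B. u b = 0))}"

lemma (in vector_space) codim_le_image:
  assumes lin: "\<And>x y. T (x + y) = T x + T y" "\<And>c x. T (scale c x) = scale c (T x)"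
    and inj: "inj T" and V: "T ` V \<subseteq> V'" and W: "\<And>x. T x \<in> W' \<Longrightarrow> x \<in> W"
  shows "codim V W \<le> codim V' W'"
  unfolding codim_def
proof (rule Sup_mono, clarify)
  fix B assume B: "finite B" "B \<subseteq> V"
    and ind: "\<forall>u. (\<Sum>b\<in>B. scale (u b) b) \<in> W \<longrightarrow> (\<forall>b\<in>B. u b = 0)"
  have T0: "T 0 = 0" using lin(1)[of 0 0] by simp
  have injB: "inj_on T B" using inj by (rule inj_on_subset) simp
  have card: "card (T ` B) = card B" using injB by (rule card_image)
  have "\<forall>b\<in>T ` B. u b = 0" if "(\<Sum>b\<in>T ` B. scale (u b) b) \<in> W'" for u
  proof -
    have "(\<Sum>b\<in>T ` B. scale (u b) b) = (\<Sum>b\<in>B. T (scale (u (T b)) b))"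
      using injB by (simp add: sum.reindex lin)
    also have "\<dots> = T (\<Sum>b\<in>B. scale (u (T b)) b)"
      using B(1) by (induction B) (simp_all add: lin T0)
    finally have "(\<Sum>b\<in>B. scale (u (T b)) b) \<in> W" using that W by simp
    then have "\<forall>b\<in>B. u (T b) = 0" using ind[rule_format, of "\<lambda>b. u (T b)"] by blast
    then show ?thesis by blast
  qed
  then show "\<exists>y\<in>{enat (card B) |B. finite B \<and> B \<subseteq> V' \<and>
       (\<forall>u. (\<Sum>b\<in>B. scale (u b) b) \<in> W' \<longrightarrow> (\<forall>b\<in>B. u b = 0))}. enat (card B) \<le> y"
    using B card subset_trans[OF image_mono[OF B(2)] V] by (intro bexI[of _ "enat (card (T ` B))"] CollectI exI[of _ "T ` B"]) (auto dest: subsetD)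
qed


section \<open>Polynomials in two variables\<close>

text \<open>An element of \<open>\<complex>[z,w]\<close> is a polynomial in \<open>w\<close> whose coefficients are polynomials in \<open>z\<close>.
  Thus \<open>[:p:]\<close> is \<open>p(z)\<close>, and \<open>in_w p\<close> is \<open>p(w)\<close>.\<close>

type_synonym bipoly = "complex poly poly"

definition eval2 :: "bipoly \<Rightarrow> complex \<Rightarrow> complex \<Rightarrow> complex" where
  "eval2 H z w = poly (poly H [:w:]) z"

definition in_w :: "complex poly \<Rightarrow> bipoly" where
  "in_w p = map_poly (\<lambda>c. [:c:]) p"

lemma in_w_0 [simp]: "in_w 0 = 0"
  by (simp add: in_w_def)

lemma in_w_pCons [simp]: "in_w (pCons a p) = pCons [:a:] (in_w p)"
  by (simp add: in_w_def map_poly_pCons)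

lemma eval2_simps [simp]:
  "eval2 0 z w = 0" "eval2 1 z w = 1" "eval2 [:p:] z w = poly p z"
  "eval2 (A + B) z w = eval2 A z w + eval2 B z w" "eval2 (A - B) z w = eval2 A z w - eval2 B z w"
  "eval2 (A * B) z w = eval2 A z w * eval2 B z w" "eval2 (- A) z w = - eval2 A z w"
  "eval2 (smult p A) z w = poly p z * eval2 A z w"
  "eval2 (pCons p A) z w = poly p z + w * eval2 A z w"
  by (simp_all add: eval2_def algebra_simps)

lemma eval2_in_w [simp]: "eval2 (in_w p) z w = poly p w"
  by (induction p) simp_all

lemma bipoly_eqI:
  assumes "\<And>z w. eval2 A z w = eval2 B z w"
  shows "A = B"
proof -
  have inf: "infinite (range (\<lambda>w::complex. [:w:]))"
    using finite_imageD[of "\<lambda>w::complex. [:w:]" UNIV] infinite_UNIV_char_0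
    by (auto simp: inj_def)
  have "poly (A - B) [:w:] = 0" for w
    using assms by (simp add: eval2_def fun_eq_iff flip: poly_eq_poly_eq_iff)
  then have "range (\<lambda>w. [:w:]) \<subseteq> {x. poly (A - B) x = 0}" by auto
  then have "A - B = 0" using inf poly_roots_finite finite_subset by blast
  then show ?thesis by simp
qed


section \<open>Intersection multiplicity of plane curves\<close>

text \<open>The local ring \<open>\<O>\<close> of the affine plane at \<open>(s,t)\<close>, as a subring of \<open>\<complex>(z,w)\<close>; the ideal
  generated in it by \<open>F\<close> and \<open>G\<close>; and the intersection multiplicity \<open>dim\<^sub>\<complex> \<O>/(F,G)\<close>.\<close>

definition scale_fract :: "complex \<Rightarrow> bipoly fract \<Rightarrow> bipoly fract" where
  "scale_fract c x = Fract [:[:c:]:] 1 * x"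

definition local_ring :: "complex \<Rightarrow> complex \<Rightarrow> bipoly fract set" where
  "local_ring s t = {Fract a b | a b. eval2 b s t \<noteq> 0}"

definition local_ideal :: "bipoly \<Rightarrow> bipoly \<Rightarrow> complex \<Rightarrow> complex \<Rightarrow> bipoly fract set" where
  "local_ideal F G s t =
     {u * Fract F 1 + v * Fract G 1 | u v. u \<in> local_ring s t \<and> v \<in> local_ring s t}"

interpretation bifract: vector_space scale_fract
proof
  show "scale_fract a (x + y) = scale_fract a x + scale_fract a y" for a x y
    by (simp add: scale_fract_def algebra_simps)
  show "scale_fract (a + b) x = scale_fract a x + scale_fract b x" for a b x
    by (simp add: scale_fract_def flip: distrib_right)
  show "scale_fract a (scale_fract b x) = scale_fract (a * b) x" for a b x
    by (simp add: scale_fract_def flip: mult.assoc)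
  show "scale_fract 1 x = x" for x
    by (simp add: scale_fract_def flip: one_pCons One_fract_def)
qed

definition intersection_multiplicity :: "bipoly \<Rightarrow> bipoly \<Rightarrow> complex \<Rightarrow> complex \<Rightarrow> enat" where
  "intersection_multiplicity F G s t = bifract.codim (local_ring s t) (local_ideal F G s t)"


section \<open>Blaschke products and the associated curves\<close>

definition blaschke_den :: "nat \<Rightarrow> (nat \<Rightarrow> complex) \<Rightarrow> complex poly" where
  "blaschke_den m \<alpha> = (\<Prod>i=1..m. [:1, - cnj (\<alpha> i):])"

definition blaschke_num :: "nat \<Rightarrow> (nat \<Rightarrow> complex) \<Rightarrow> complex poly" where
  "blaschke_num m \<alpha> = (\<Prod>i=1..m. [:- \<alpha> i, 1:])"

definition finite_blaschke :: "complex \<Rightarrow> nat \<Rightarrow> (nat \<Rightarrow> complex) \<Rightarrow> complex \<Rightarrow> complex" where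
  "finite_blaschke c m \<alpha> z = c * (poly (blaschke_num m \<alpha>) z / poly (blaschke_den m \<alpha>) z)"

text \<open>The quotient of \<open>p(z) p\<^sup>~(w) - p(w) p\<^sup>~(z)\<close> by \<open>z - w\<close>; the division is exact by
  \<open>curve_numerator_dvd\<close>.\<close>

definition curve_numerator :: "nat \<Rightarrow> (nat \<Rightarrow> complex) \<Rightarrow> bipoly" where
  "curve_numerator m \<alpha> = [:blaschke_den m \<alpha>:] * in_w (blaschke_num m \<alpha>)
                        - in_w (blaschke_den m \<alpha>) * [:blaschke_num m \<alpha>:]"

definition curve :: "nat \<Rightarrow> (nat \<Rightarrow> complex) \<Rightarrow> bipoly" where
  "curve m \<alpha> = curve_numerator m \<alpha> div ([:[:0, 1:]:] - [:0, 1:])"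

lemma poly_in_w_diag: "poly (in_w p) [:0, 1:] = p"
  by (induction p) simp_all

lemma curve_numerator_dvd: "([:[:0, 1:]:] - [:0, 1:]) dvd curve_numerator m \<alpha>"
proof -
  have "poly (curve_numerator m \<alpha>) [:0, 1:] = 0"
    by (simp add: curve_numerator_def poly_in_w_diag mult.commute)
  then have "[:- [:0, 1:], 1:] dvd curve_numerator m \<alpha>"
    by (simp add: poly_eq_0_iff_dvd)
  then have "- [:- [:0, 1:], 1:] dvd curve_numerator m \<alpha>"
    by (simp only: minus_dvd_iff)
  then show ?thesis by (simp add: one_pCons)
qed

lemma curve_eq: "([:[:0, 1:]:] - [:0, 1:]) * curve m \<alpha> = curve_numerator m \<alpha>"
  unfolding curve_def using curve_numerator_dvd by (rule dvd_mult_div_cancel)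


section \<open>Pairs of points not separated on the circle\<close>

text \<open>An unordered pair of distinct points is a two-element set. By \<open>pair_multiplicity_eq\<close> below,
  the definite description does not depend on the order of the two points.\<close>

definition unseparated_pairs ::
    "(complex \<Rightarrow> complex) \<Rightarrow> (complex \<Rightarrow> complex) \<Rightarrow> complex set set" where
  "unseparated_pairs f g = {{s, t} | s t. s \<in> sphere 0 1 \<and> t \<in> sphere 0 1 \<and> s \<noteq> t \<and>
     f s = f t \<and> g s = g t}"

definition pair_multiplicity ::
    "nat \<Rightarrow> (nat \<Rightarrow> complex) \<Rightarrow> nat \<Rightarrow> (nat \<Rightarrow> complex) \<Rightarrow> complex set \<Rightarrow> enat" where
  "pair_multiplicity m \<alpha> n \<beta> P =
     (THE k. \<exists>s t. P = {s, t} \<and> k = intersection_multiplicity (curve m \<alpha>) (curve n \<beta>) s t)"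

definition swap2 :: "bipoly \<Rightarrow> bipoly" where
  "swap2 H = poly (map_poly in_w H) [:[:0, 1:]:]"

lemma eval2_swap2 [simp]: "eval2 (swap2 H) z w = eval2 H w z"
  unfolding swap2_def by (induction H) (simp_all add: map_poly_pCons)

lemma swap2_simps [simp]:
  "swap2 (A * B) = swap2 A * swap2 B" "swap2 (A + B) = swap2 A + swap2 B"
  "swap2 (A - B) = swap2 A - swap2 B" "swap2 (swap2 A) = A" "swap2 0 = 0" "swap2 1 = 1"
  "swap2 [:[:c:]:] = [:[:c:]:]"
  by (rule bipoly_eqI; simp)+

lemma swap2_eq_0_iff [simp]: "swap2 A = 0 \<longleftrightarrow> A = 0"
  by (metis swap2_simps(4,5))

lemma swap2_curve: "swap2 (curve m \<alpha>) = curve m \<alpha>"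
proof -
  let ?d = "[:[:0, 1:]:] - [:0, 1:] :: bipoly"
  have d: "swap2 ?d = - ?d" by (rule bipoly_eqI) simp
  have N: "swap2 (curve_numerator m \<alpha>) = - curve_numerator m \<alpha>"
    by (rule bipoly_eqI) (simp add: curve_numerator_def)
  have "swap2 (?d * curve m \<alpha>) = - (?d * curve m \<alpha>)"
    by (simp only: curve_eq N)
  then have "?d * swap2 (curve m \<alpha>) = ?d * curve m \<alpha>"
    by (simp only: swap2_simps(1) d minus_mult_left[symmetric] neg_equal_iff_equal)
  moreover have "?d \<noteq> 0" by simp
  ultimately show ?thesis using mult_left_cancel by blast
qed

lift_definition swap_fract :: "bipoly fract \<Rightarrow> bipoly fract" is "\<lambda>(a, b). (swap2 a, swap2 b)"
  by (auto simp: fractrel_iff simp flip: swap2_simps(1))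

lemma swap_fract_Fract: "swap_fract (Fract a b) = Fract (swap2 a) (swap2 b)"
  by transfer auto

lemma swap_fract_simps:
  "swap_fract (x + y) = swap_fract x + swap_fract y"
  "swap_fract (x * y) = swap_fract x * swap_fract y"
  "swap_fract (swap_fract x) = x"
  by (cases x; cases y; simp add: swap_fract_Fract)+

lemma swap_fract_local_ring: "x \<in> local_ring s t \<Longrightarrow> swap_fract x \<in> local_ring t s"
  by (force simp: local_ring_def swap_fract_Fract)

lemma intersection_multiplicity_swap_le:
  assumes "swap2 F = F" "swap2 G = G"
  shows "intersection_multiplicity F G s t \<le> intersection_multiplicity F G t s"
  unfolding intersection_multiplicity_def
proof (rule bifract.codim_le_image[of swap_fract])
  show "inj swap_fract" by (metis injI swap_fract_simps(3))
  show "swap_fract ` local_ring s t \<subseteq> local_ring t s" using swap_fract_local_ring by blast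
  have *: "swap_fract x \<in> local_ideal F G s t" if "x \<in> local_ideal F G t s" for x
    using that assms swap_fract_local_ring
    by (force simp: local_ideal_def swap_fract_simps swap_fract_Fract)
  show "x \<in> local_ideal F G s t" if "swap_fract x \<in> local_ideal F G t s" for x
    using *[OF that] by (simp add: swap_fract_simps)
qed (simp_all add: swap_fract_simps scale_fract_def swap_fract_Fract)

lemma pair_multiplicity_eq:
  "pair_multiplicity m \<alpha> n \<beta> {s, t} = intersection_multiplicity (curve m \<alpha>) (curve n \<beta>) s t"
proof -
  have "intersection_multiplicity (curve m \<alpha>) (curve n \<beta>) s t
      = intersection_multiplicity (curve m \<alpha>) (curve n \<beta>) t s"
    by (intro antisym intersection_multiplicity_swap_le swap2_curve)
  then show ?thesis
    unfolding pair_multiplicity_def by (intro the_equality) (auto simp: doubleton_eq_iff)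
qed


section \<open>The algebra generated by two functions on the disk\<close>

text \<open>Functions on the disk are represented by functions on \<open>\<complex>\<close> vanishing outside the disk, so
  that equality of functions is equality on the disk.\<close>

definition holo_disk :: "(complex \<Rightarrow> complex) set" where
  "holo_disk = {h. h holomorphic_on ball 0 1 \<and> (\<forall>z. z \<notin> ball 0 1 \<longrightarrow> h z = 0)}"

text \<open>The sets \<open>{k. \<forall>z\<in>K. norm (h z - k z) < \<epsilon>}\<close> form a base of neighbourhoods of \<open>h\<close> in the
  topology of uniform convergence on compact sets.\<close>

definition Alg :: "(complex \<Rightarrow> complex) \<Rightarrow> (complex \<Rightarrow> complex) \<Rightarrow> (complex \<Rightarrow> complex) set" where
  "Alg f g = {h \<in> holo_disk. \<forall>K \<epsilon>. compact K \<and> K \<subseteq> ball 0 1 \<and> \<epsilon> > 0 \<longrightarrow>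
     (\<exists>P. \<forall>z\<in>K. norm (h z - eval2 P (f z) (g z)) < \<epsilon>)}"

definition scale_fun :: "complex \<Rightarrow> (complex \<Rightarrow> complex) \<Rightarrow> complex \<Rightarrow> complex" where
  "scale_fun c h = (\<lambda>z. c * h z)"

interpretation holo: vector_space scale_fun
  by unfold_locales (simp_all add: scale_fun_def fun_eq_iff algebra_simps)

end

theory Submission
  imports Defs "Jordan_Normal_Form.Char_Poly"
begin

text \<open>Over the functions of \<open>f\<close>, the space \<open>O(D)\<close> is free with basis \<open>1, z, \<dots>, z\<^sup>m\<^sup>-\<^sup>1\<close>, and the closed algebra is the
  free submodule on \<open>1, g, \<dots>, g\<^sup>m\<^sup>-\<^sup>1\<close>. Hence its codimension is the number of zeros in \<open>D\<close> of the determinant of the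
  inclusion, which at a point \<open>\<zeta>\<close> with fibre \<open>f\<^sup>-\<^sup>1(\<zeta>) = {z\<^sub>1, \<dots>, z\<^sub>m}\<close> is, up to a unit, the product of the
  \<open>G(z\<^sub>i, z\<^sub>j)\<close> over the pairs \<open>i < j\<close>. Cleared of denominators, the determinant is that of a Sylvester matrix with
  \<open>(m - 1)(n - 1)\<close> columns linear in \<open>\<zeta>\<close>, so it is a polynomial of at most that degree. Its zeros are
  symmetric under reflection in the circle, and the product formula identifies its order of vanishing at a point of the circle
  with the sum of the multiplicities of the unseparated pairs in the fibre. So \<open>(m - 1)(n - 1)\<close> is twice the codimension
  plus \<open>r\<close>.\<close>

text \<open>Zeros of the determinant in the disk are turned into codimension one at a time: a kernel
  vector of the matrix at a zero \<zeta> gives a combination of the generators divisible by f -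
  \<zeta>, and exchanging one generator for the quotient enlarges the module by exactly one
  dimension and removes one zero. When none is left, Cramer's rule gives all of O(D). The closure of
  the algebra is the submodule for two reasons. By Cayley-Hamilton g satisfies a monic equation of
  degree m over the functions of f, so every polynomial in f and g lies in the submodule. And the
  submodule contains all multiples of one nonzero polynomial, which makes it closed. Polynomials of
  bounded degree replace functions on the disk because the symmetry argument needs the determinant
  as a global object, with its zeros on and outside the circle. On the circle f' does not vanish.
  Hence the fibres there are simple, the curve F = 0 is smooth at pairs of distinct points of a
  fibre, and an intersection multiplicity is an order of vanishing of G along a branch.\<close>

hide_const (open) Determinants.det Finite_Cartesian_Product.mat Finite_Cartesian_Product.vec
  Finite_Cartesian_Product.row Finite_Cartesian_Product.transpose Module.smult

section \<open>Codimension and the Vandermonde determinant\<close>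

text \<open>The lower bound is E itself. For the upper bound, a family B independent modulo W is
  moved by elements of W into the span of E; the moved vectors stay independent, since a relation
  among them puts a combination of B into W, and the exchange bound for spans applies.\<close>

lemma (in vector_space) codim_eqI:
  assumes W: "subspace W" and V: "subspace V" and WV: "W \<subseteq> V"
    and E: "finite E" "E \<subseteq> V"
    and ind: "\<And>u. (\<Sum>b\<in>E. scale (u b) b) \<in> W \<Longrightarrow> \<forall>b\<in>E. u b = 0"
    and sp: "\<And>v. v \<in> V \<Longrightarrow> \<exists>w\<in>W. \<exists>x\<in>span E. v = w + x"
  shows "codim V W = enat (card E)"
proof (rule antisym)
  have "card B \<le> card E" if B: "finite B" "B \<subseteq> V"
    "\<forall>u. (\<Sum>b\<in>B. scale (u b) b) \<in> W \<longrightarrow> (\<forall>b\<in>B. u b = 0)" for B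
  proof -
    obtain w x where wx: "\<And>b. b \<in> B \<Longrightarrow> w b \<in> W \<and> x b \<in> span E \<and> b = w b + x b"
      using sp B(2) by (metis subsetD)
    have key: "\<forall>b\<in>B. u b = 0" if "(\<Sum>b\<in>B. scale (u b) (x b)) = 0" for u
    proof -
      have "(\<Sum>b\<in>B. scale (u b) b) = (\<Sum>b\<in>B. scale (u b) (w b) + scale (u b) (x b))"
        using wx by (intro sum.cong refl) (metis scale_right_distrib)
      also have "\<dots> = (\<Sum>b\<in>B. scale (u b) (w b))" using that by (simp add: sum.distrib)
      also have "\<dots> \<in> W" using W wx by (intro subspace_sum subspace_scale) auto
      finally show ?thesis using B(3) by blast
    qed
    have inj: "inj_on x B"
    proof (rule inj_onI, rule ccontr)
      fix a b assume ab: "a \<in> B" "b \<in> B" "x a = x b" "a \<noteq> b"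
      let ?u = "\<lambda>c. if c = a then 1 else if c = b then -1 else 0 :: 'a"
      have "(\<Sum>c\<in>B. scale (?u c) (x c)) = (\<Sum>c\<in>{a,b}. scale (?u c) (x c))"
        using B(1) ab by (intro sum.mono_neutral_right) auto
      also have "\<dots> = 0" using ab by (simp add: scale_minus_left)
      finally show False using key[of ?u] ab by auto
    qed
    have "independent (x ` B)"
    proof (subst dependent_finite)
      show "finite (x ` B)" using B(1) by simp
      show "\<not> (\<exists>u. (\<exists>v\<in>x ` B. u v \<noteq> 0) \<and> (\<Sum>v\<in>x ` B. scale (u v) v) = 0)"
      proof
        assume "\<exists>u. (\<exists>v\<in>x ` B. u v \<noteq> 0) \<and> (\<Sum>v\<in>x ` B. scale (u v) v) = 0"
        then obtain u where u: "\<exists>v\<in>x ` B. u v \<noteq> 0" "(\<Sum>v\<in>x ` B. scale (u v) v) = 0" by blast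
        then have "(\<Sum>b\<in>B. scale (u (x b)) (x b)) = 0" using inj by (simp add: sum.reindex)
        then show False using key[of "\<lambda>b. u (x b)"] u(1) by auto
      qed
    qed
    moreover have "x ` B \<subseteq> span E" using wx by auto
    ultimately have "card (x ` B) \<le> card E"
      using independent_span_bound[OF E(1), of "x ` B"] by blast
    with inj show ?thesis by (simp add: card_image)
  qed
  note le = this
  show "codim V W \<le> enat (card E)"
    unfolding codim_def
  proof (rule Sup_least, clarify)
    fix B assume "finite B" "B \<subseteq> V" "\<forall>u. (\<Sum>b\<in>B. scale (u b) b) \<in> W \<longrightarrow> (\<forall>b\<in>B. u b = 0)"
    then show "enat (card B) \<le> enat (card E)" using le by simp
  qed
  show "enat (card E) \<le> codim V W"
    unfolding codim_def by (intro Sup_upper CollectI exI[of _ E]) (use E ind in auto)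
qed

text \<open>The coefficient matrix of the monic Newton polynomials (X - x_0)...(X - x_(j-1)) is
  unitriangular. Multiplying by it turns the Vandermonde matrix into a lower triangular one whose
  diagonal gives the product.\<close>

lemma det_vandermonde:
  fixes x :: "nat \<Rightarrow> 'a :: idom"
  shows "det (mat m m (\<lambda>(i,j). x i ^ j)) = (\<Prod>j<m. \<Prod>i<j. (x j - x i))"
proof -
  define \<phi> where "\<phi> j = (\<Prod>l<j. [:- x l, 1:])" for j
  have deg: "degree (\<phi> j) = j \<and> lead_coeff (\<phi> j) = 1" for j
  proof -
    have "degree (\<phi> j) = (\<Sum>l<j. degree [:- x l, 1:])"
      unfolding \<phi>_def by (rule degree_prod_eq_sum_degree) auto
    moreover have "lead_coeff (\<phi> j) = (\<Prod>l<j. lead_coeff [:- x l, 1:])"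
      unfolding \<phi>_def by (rule lead_coeff_prod)
    ultimately show ?thesis by simp
  qed
  have monic: "coeff (\<phi> j) j = 1" for j using deg[of j] by metis
  have ev: "poly (\<phi> j) y = (\<Prod>l<j. (y - x l))" for j y
    unfolding \<phi>_def poly_prod by simp
  let ?X = "mat m m (\<lambda>(i,j). x i ^ j)" and ?U = "mat m m (\<lambda>(k,j). coeff (\<phi> j) k)"
    and ?T = "mat m m (\<lambda>(i,j). poly (\<phi> j) (x i))"
  have XU: "?X * ?U = ?T"
  proof (rule eq_matI)
    fix i j assume "i < dim_row ?T" "j < dim_col ?T"
    then have ij: "i < m" "j < m" by auto
    have "poly (\<phi> j) (x i) = (\<Sum>k\<le>j. coeff (\<phi> j) k * x i ^ k)"
      using deg[of j] by (simp add: poly_altdef)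
    also have "\<dots> = (\<Sum>k<m. coeff (\<phi> j) k * x i ^ k)"
      using ij deg[of j] by (intro sum.mono_neutral_left) (auto simp: coeff_eq_0)
    finally show "(?X * ?U) $$ (i,j) = ?T $$ (i,j)"
      using ij by (simp add: scalar_prod_def mult.commute atLeast0LessThan)
  qed auto
  have U: "det ?U = 1"
  proof -
    have "upper_triangular ?U" using deg by (auto simp: upper_triangular_def coeff_eq_0)
    then have "det ?U = prod_list (diag_mat ?U)" by (rule det_upper_triangular[of _ m]) auto
    also have "diag_mat ?U = map (\<lambda>_. 1) [0..<m]"
      using monic by (auto simp: diag_mat_def intro!: map_cong)
    finally show ?thesis by (simp add: prod_list_replicate map_replicate_const)
  qed
  have T: "det ?T = (\<Prod>j<m. \<Prod>i<j. (x j - x i))"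
  proof -
    have "det ?T = prod_list (diag_mat ?T)"
    proof (rule det_lower_triangular[of m])
      show "?T $$ (i, j) = 0" if "i < j" "j < m" for i j
        using that by (auto simp: ev intro!: prod_zero)
    qed auto
    also have "diag_mat ?T = map (\<lambda>j. \<Prod>i<j. (x j - x i)) [0..<m]"
      by (auto simp: diag_mat_def ev intro!: map_cong)
    also have "prod_list \<dots> = (\<Prod>j<m. \<Prod>i<j. (x j - x i))"
      by (subst prod.distinct_set_conv_list[symmetric]) (simp_all add: lessThan_atLeast0)
    finally show ?thesis .
  qed
  have "det ?X * det ?U = det ?T"
    unfolding XU[symmetric] by (rule det_mult[symmetric, of _ m]) auto
  then show ?thesis by (simp add: U T)
qed

section \<open>Finite Blaschke products\<close>

lemma blaschke_0 [simp]: "blaschke_den 0 \<alpha> = 1" "blaschke_num 0 \<alpha> = 1"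
  by (simp_all add: blaschke_den_def blaschke_num_def)

lemma blaschke_Suc:
  "blaschke_den (Suc m) \<alpha> = blaschke_den m \<alpha> * [:1, - cnj (\<alpha> (Suc m)):]"
  "blaschke_num (Suc m) \<alpha> = blaschke_num m \<alpha> * [:- \<alpha> (Suc m), 1:]"
  by (simp_all add: blaschke_den_def blaschke_num_def)

text \<open>The denominator is the conjugate reversal of the numerator. The coefficient is taken at
  the formal degree m, as the true degree drops when some \<alpha> i is 0.\<close>

lemma coeff_blaschke_den_top: "coeff (blaschke_den m \<alpha>) m = cnj (poly (blaschke_num m \<alpha>) 0)"
proof -
  have "degree (blaschke_den m \<alpha>) \<le> m \<and> coeff (blaschke_den m \<alpha>) m = cnj (poly (blaschke_num m \<alpha>) 0)"
  proof (induction m)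
    case (Suc k)
    have "degree (blaschke_den (Suc k) \<alpha>) \<le> degree (blaschke_den k \<alpha>) + 1"
      unfolding blaschke_Suc by (rule order_trans[OF degree_mult_le]) simp
    then show ?case using Suc by (simp add: blaschke_Suc coeff_eq_0)
  qed simp
  then show ?thesis ..
qed

text \<open>The sign of the right-hand side decides, factor by factor, which of numerator and
  denominator is larger inside and outside the circle.\<close>

lemma blaschke_factor_norm:
  "(norm (z - a))\<^sup>2 - (norm (1 - cnj a * z))\<^sup>2 = ((norm z)\<^sup>2 - 1) * (1 - (norm a)\<^sup>2)"
proof -
  have "complex_of_real ((norm (z - a))\<^sup>2 - (norm (1 - cnj a * z))\<^sup>2)
      = complex_of_real (((norm z)\<^sup>2 - 1) * (1 - (norm a)\<^sup>2))"
    unfolding of_real_diff of_real_mult complex_norm_square by (simp add: algebra_simps)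
  then show ?thesis by (simp only: of_real_eq_iff)
qed

lemma blaschke_factor_cnj:
  assumes "norm z = 1"
  shows "cnj (1 - cnj a * z) * z = z - a"
proof -
  have "cnj z * z = 1" using assms by (metis complex_norm_square mult.commute of_real_1 one_power2)
  then show ?thesis by (simp add: algebra_simps)
qed

lemma norm_cnj_mult_less: "norm a < 1 \<Longrightarrow> norm z \<le> 1 \<Longrightarrow> norm (cnj a * z) < 1"
  by (metis complex_mod_cnj dual_order.strict_trans2 mult_left_le norm_ge_zero norm_mult)

context
  fixes m :: nat and \<alpha> :: "nat \<Rightarrow> complex"
  assumes \<alpha>: "\<forall>i\<in>{1..m}. norm (\<alpha> i) < 1"
begin

lemma degree_blaschke_num: "degree (blaschke_num m \<alpha>) = m"
  by (simp add: blaschke_num_def degree_prod_eq_sum_degree)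

lemma monic_blaschke_num: "coeff (blaschke_num m \<alpha>) m = 1"
proof -
  have "lead_coeff (blaschke_num m \<alpha>) = 1" by (simp add: blaschke_num_def lead_coeff_prod)
  then show ?thesis by (simp add: degree_blaschke_num)
qed

lemma degree_blaschke_den: "degree (blaschke_den m \<alpha>) \<le> m"
proof -
  have "degree [:1, - cnj (\<alpha> i):] \<le> 1" for i by (simp add: order_trans[OF degree_pCons_le])
  then have "degree (blaschke_den m \<alpha>) \<le> (\<Sum>i=1..m. 1)"
    unfolding blaschke_den_def by (intro order_trans[OF degree_prod_sum_le]) (simp_all only: o_def finite_atLeastAtMost sum_mono)
  then show ?thesis by simp
qed

lemma poly_blaschke:
  "poly (blaschke_den m \<alpha>) z = (\<Prod>i=1..m. 1 - cnj (\<alpha> i) * z)"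
  "poly (blaschke_num m \<alpha>) z = (\<Prod>i=1..m. z - \<alpha> i)"
  by (simp_all add: blaschke_den_def blaschke_num_def poly_prod mult.commute)

lemma blaschke_den_nonzero:
  assumes "norm z \<le> 1"
  shows "poly (blaschke_den m \<alpha>) z \<noteq> 0"
proof -
  have "1 - cnj (\<alpha> i) * z \<noteq> 0" if "i \<in> {1..m}" for i
    using norm_cnj_mult_less[of "\<alpha> i" z] assms \<alpha> that by force
  then show ?thesis by (simp add: poly_blaschke)
qed

lemma blaschke_den_ne_0 [simp]: "blaschke_den m \<alpha> \<noteq> 0"
  using blaschke_den_nonzero[of 0] by auto

lemma norm_blaschke_less:
  assumes "norm z < 1" "0 < m"
  shows "norm (poly (blaschke_num m \<alpha>) z) < norm (poly (blaschke_den m \<alpha>) z)"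
proof -
  have "norm (z - \<alpha> i) < norm (1 - cnj (\<alpha> i) * z) \<and> 0 < norm (1 - cnj (\<alpha> i) * z)" if i: "i \<in> {1..m}" for i
  proof -
  have "(norm z)\<^sup>2 < 1" "(norm (\<alpha> i))\<^sup>2 < 1"
    using assms \<alpha> i by (auto simp: power_less_one_iff)
  then have "((norm z)\<^sup>2 - 1) * (1 - (norm (\<alpha> i))\<^sup>2) < 0" by (simp add: mult_neg_pos)
  then have "(norm (z - \<alpha> i))\<^sup>2 < (norm (1 - cnj (\<alpha> i) * z))\<^sup>2"
    using blaschke_factor_norm[of z "\<alpha> i"] by linarith
  then have "norm (z - \<alpha> i) < norm (1 - cnj (\<alpha> i) * z)" by (rule power_less_imp_less_base) simp
  then show ?thesis by (meson norm_ge_zero order_le_less_trans)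
  qed
  then show ?thesis
    unfolding poly_blaschke prod_norm[symmetric]
    using assms(2) by (intro prod_mono_strict[of 1]) (auto intro: less_imp_le)
qed

lemma norm_blaschke_greater:
  assumes "norm z > 1" "0 < m"
  shows "norm (poly (blaschke_num m \<alpha>) z) > norm (poly (blaschke_den m \<alpha>) z)"
proof -
  have "norm (1 - cnj (\<alpha> i) * z) < norm (z - \<alpha> i) \<and> 0 < norm (z - \<alpha> i)" if i: "i \<in> {1..m}" for i
  proof -
  have "(norm z)\<^sup>2 > 1" "(norm (\<alpha> i))\<^sup>2 < 1"
    using assms \<alpha> i by (auto simp: power_less_one_iff)
  then have "((norm z)\<^sup>2 - 1) * (1 - (norm (\<alpha> i))\<^sup>2) > 0" by simp
  then have "(norm (z - \<alpha> i))\<^sup>2 > (norm (1 - cnj (\<alpha> i) * z))\<^sup>2"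
    using blaschke_factor_norm[of z "\<alpha> i"] by linarith
  then have "norm (1 - cnj (\<alpha> i) * z) < norm (z - \<alpha> i)" by (rule power_less_imp_less_base) simp
  then show ?thesis by (meson norm_ge_zero order_le_less_trans)
  qed
  then show ?thesis
    unfolding poly_blaschke prod_norm[symmetric]
    using assms(2) by (intro prod_mono_strict[of 1]) (auto intro: less_imp_le)
qed

text \<open>On the circle the conjugate of z is 1/z, so conjugation exchanges numerator and
  denominator up to a power of z. This gives |f| = 1 there and later the reflection symmetry of the
  determinant.\<close>

lemma blaschke_cnj:
  assumes "norm z = 1"
  shows "cnj (poly (blaschke_den m \<alpha>) z) * z ^ m = poly (blaschke_num m \<alpha>) z"
proof -
  have "cnj (poly (blaschke_den m \<alpha>) z) * z ^ m = (\<Prod>i=1..m. cnj (1 - cnj (\<alpha> i) * z) * z)"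
    unfolding poly_blaschke cnj_prod by (simp add: prod.distrib)
  also have "\<dots> = (\<Prod>i=1..m. z - \<alpha> i)"
    using blaschke_factor_cnj[OF assms] by simp
  finally show ?thesis by (simp add: poly_blaschke)
qed

lemma norm_blaschke_eq:
  assumes "norm z = 1"
  shows "norm (poly (blaschke_num m \<alpha>) z) = norm (poly (blaschke_den m \<alpha>) z)"
  unfolding blaschke_cnj[OF assms, symmetric] using assms by (simp add: norm_mult norm_power)

text \<open>The comparison at z = 0, where the denominator is 1. It keeps the leading coefficient of
  \<open>P \<zeta>\<close> away from 0 on the closed disk.\<close>

lemma norm_coeff_blaschke_den:
  assumes "0 < m"
  shows "norm (coeff (blaschke_den m \<alpha>) m) < 1"
  using norm_blaschke_less[of 0] assms by (simp add: coeff_blaschke_den_top poly_blaschke(1))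

text \<open>\<open>z f'(z) / f(z) = \<Sum>\<^sub>i (1 - |\<alpha>\<^sub>i|\<^sup>2) / |1 - cnj \<alpha>\<^sub>i z|\<^sup>2 > 0\<close> on the circle.\<close>

lemma blaschke_wronskian_nonzero:
  assumes z: "norm z = 1" and "0 < m"
  shows "poly (pderiv (blaschke_num m \<alpha>) * blaschke_den m \<alpha>
           - blaschke_num m \<alpha> * pderiv (blaschke_den m \<alpha>)) z \<noteq> 0"
proof -
  let ?W = "\<lambda>k. poly (pderiv (blaschke_num k \<alpha>) * blaschke_den k \<alpha>
           - blaschke_num k \<alpha> * pderiv (blaschke_den k \<alpha>)) z"
  \<comment> \<open>Induction over the number of factors, in a form cleared of denominators: c is
    the partial sum of the positive terms, and the factor with parameter a adds e to it.\<close>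
  have "\<exists>c::real. c \<ge> 0 \<and> (k > 0 \<longrightarrow> c > 0)
      \<and> z * ?W k = of_real c * poly (blaschke_num k \<alpha>) z * poly (blaschke_den k \<alpha>) z" if "k \<le> m" for k
    using that
  proof (induction k)
    case 0
    then show ?case by (intro exI[of _ 0]) (simp add: pderiv_1)
  next
    case (Suc k)
    then obtain c :: real where c: "c \<ge> 0"
      "z * ?W k = of_real c * poly (blaschke_num k \<alpha>) z * poly (blaschke_den k \<alpha>) z" by auto
    define a where "a = \<alpha> (Suc k)"
    define x where "x = 1 - cnj a * z"
    have a: "norm a < 1" using \<alpha> Suc.prems by (simp add: a_def)
    have x0: "x \<noteq> 0" using norm_cnj_mult_less[of a z] a z by (auto simp: x_def)
    have xa: "z - a = cnj x * z" using blaschke_factor_cnj[OF z, of a] by (simp add: x_def)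
    define e where "e = (1 - (norm a)\<^sup>2) / (norm x)\<^sup>2"
    have e: "e > 0" using a x0 by (simp add: e_def power_less_one_iff)
    have ex: "of_real e * (x * cnj x) = 1 - a * cnj a"
      using x0 by (simp add: e_def complex_norm_square[symmetric] flip: of_real_power of_real_mult of_real_divide)
    have W: "?W (Suc k) = ?W k * ((z - a) * x)
        + (1 - a * cnj a) * poly (blaschke_num k \<alpha>) z * poly (blaschke_den k \<alpha>) z"
      by (simp add: blaschke_Suc pderiv_mult pderiv_pCons a_def[symmetric] x_def del: mult_pCons_right) (simp add: algebra_simps)
    have "z * ?W (Suc k) = (z * ?W k) * ((z - a) * x)
        + z * (1 - a * cnj a) * poly (blaschke_num k \<alpha>) z * poly (blaschke_den k \<alpha>) z"
      unfolding W by (simp add: algebra_simps)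
    also have "\<dots> = of_real c * poly (blaschke_num k \<alpha>) z * poly (blaschke_den k \<alpha>) z * ((z - a) * x)
        + z * (of_real e * (x * cnj x)) * poly (blaschke_num k \<alpha>) z * poly (blaschke_den k \<alpha>) z"
      unfolding c(2) ex ..
    also have "\<dots> = of_real (c + e) * (poly (blaschke_num k \<alpha>) z * (z - a)) * (poly (blaschke_den k \<alpha>) z * x)"
      unfolding xa by (simp add: algebra_simps)
    also have "\<dots> = of_real (c + e) * poly (blaschke_num (Suc k) \<alpha>) z * poly (blaschke_den (Suc k) \<alpha>) z"
      by (simp add: blaschke_Suc a_def[symmetric] x_def algebra_simps)
    finally show ?case using c(1) e by (intro exI[of _ "c + e"]) auto
  qed
  from this[of m] assms(2) obtain c :: real where c: "c > 0"
    "z * ?W m = of_real c * poly (blaschke_num m \<alpha>) z * poly (blaschke_den m \<alpha>) z" by auto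
  moreover have "poly (blaschke_den m \<alpha>) z \<noteq> 0" using blaschke_den_nonzero z by simp
  moreover have "poly (blaschke_num m \<alpha>) z \<noteq> 0"
    using norm_blaschke_eq[OF z] calculation(3) by auto
  ultimately show ?thesis by auto
qed

end

section \<open>A Sylvester determinant\<close>

locale blaschke_pair =
  fixes m n :: nat and \<alpha> \<beta> :: "nat \<Rightarrow> complex"
  assumes m_pos: "0 < m" and n_pos: "0 < n \<or> m = 1"
    and \<alpha>: "\<forall>i\<in>{1..m}. norm (\<alpha> i) < 1" and \<beta>: "\<forall>i\<in>{1..n}. norm (\<beta> i) < 1"
begin

abbreviation "p \<equiv> blaschke_den m \<alpha>"
abbreviation "pt \<equiv> blaschke_num m \<alpha>"
abbreviation "q \<equiv> blaschke_den n \<beta>"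
abbreviation "qt \<equiv> blaschke_num n \<beta>"

text \<open>Bound for the degrees of the generators qt^j q^(m-1-j), j < m. Polynomials up to this
  degree form a space of dimension m + M, which leaves room for exactly M multiples z^k P.\<close>

definition L :: nat where "L = n * (m - 1)"
definition M :: nat where "M = (m - 1) * (n - 1)"

text \<open>Its roots are the fibre of f over \<zeta>; as a polynomial it avoids the poles of
  f.\<close>

definition P :: "complex \<Rightarrow> complex poly" where "P \<zeta> = pt - smult \<zeta> p"

lemma Suc_L: "Suc L = m + M"
proof -
  obtain k where k: "m = Suc k" using m_pos by (cases m) auto
  show ?thesis unfolding L_def M_def unfolding k using n_pos k by (cases n) (auto simp: algebra_simps)
qed

lemma m_le: "m \<le> Suc L" using Suc_L by simp

lemma poly_P: "poly (P \<zeta>) z = poly pt z - \<zeta> * poly p z"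
  by (simp add: P_def)

lemma degree_P_le: "degree (P \<zeta>) \<le> m"
  unfolding P_def using degree_blaschke_num[of m \<alpha>] degree_blaschke_den[of m \<alpha>] \<alpha>
  by (intro degree_diff_le order_trans[OF degree_smult_le]) auto

lemma coeff_P: "coeff (P \<zeta>) m = 1 - \<zeta> * coeff p m"
  unfolding P_def using monic_blaschke_num[OF \<alpha>] by simp

lemma coeff_P_nonzero:
  assumes "norm \<zeta> \<le> 1" shows "coeff (P \<zeta>) m \<noteq> 0"
proof -
  have "norm (\<zeta> * coeff p m) < 1"
    using assms norm_coeff_blaschke_den[OF \<alpha> m_pos]
    by (metis dual_order.strict_trans2 mult.commute mult_left_le norm_ge_zero norm_mult)
  then show ?thesis by (force simp: coeff_P)
qed

lemma degree_P: "norm \<zeta> \<le> 1 \<Longrightarrow> degree (P \<zeta>) = m"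
  using coeff_P_nonzero degree_P_le by (metis le_antisym le_degree)

text \<open>Column \<open>j < m\<close> lists the coefficients of \<open>w\<^sub>j\<close>, column \<open>m + k\<close> those of \<open>z\<^sup>k P\<^sub>\<zeta>(z)\<close>, as polynomials
  in \<open>\<zeta>\<close>.\<close>

definition syl :: "(nat \<Rightarrow> complex poly) \<Rightarrow> complex poly mat" where
  "syl w = mat (Suc L) (Suc L) (\<lambda>(i, j). if j < m then [:coeff (w j) i:]
     else [:coeff (monom 1 (j - m) * pt) i, - coeff (monom 1 (j - m) * p) i:])"

text \<open>The polynomial whose coefficients are the matrix at \<zeta> applied to x. On the fibre
  over \<zeta> the second summand vanishes, so only the combination of the generators is seen
  there.\<close>

definition comb :: "(nat \<Rightarrow> complex poly) \<Rightarrow> complex \<Rightarrow> (nat \<Rightarrow> complex) \<Rightarrow> complex poly" where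
  "comb w \<zeta> x = (\<Sum>j<m. smult (x j) (w j)) + P \<zeta> * (\<Sum>k<M. monom (x (m + k)) k)"

definition N :: "(nat \<Rightarrow> complex poly) \<Rightarrow> complex poly" where "N w = det (syl w)"

section \<open>Entries, columns and degree of the Sylvester matrix\<close>

lemma syl_carrier [simp]: "syl w \<in> carrier_mat (Suc L) (Suc L)"
  by (simp add: syl_def)

lemma dim_syl [simp]: "dim_row (syl w) = Suc L" "dim_col (syl w) = Suc L"
  by (simp_all add: syl_def)

lemma poly_syl:
  assumes "i < Suc L" "j < Suc L"
  shows "poly (syl w $$ (i, j)) \<zeta>
    = (if j < m then coeff (w j) i else coeff (monom 1 (j - m) * P \<zeta>) i)"
  using assms by (simp add: syl_def P_def algebra_simps)

lemma degree_comb: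
  assumes "\<And>j. j < m \<Longrightarrow> degree (w j) \<le> L"
  shows "degree (comb w \<zeta> x) \<le> L"
proof -
  have "degree (P \<zeta> * monom (x (m + k)) k) \<le> L" if "k < M" for k
    using degree_mult_le[of "P \<zeta>" "monom (x (m + k)) k"] degree_P_le[of \<zeta>]
      degree_monom_le[of "x (m + k)" k] that Suc_L by linarith
  then have "degree (P \<zeta> * (\<Sum>k<M. monom (x (m + k)) k)) \<le> L"
    unfolding sum_distrib_left by (intro degree_sum_le) auto
  moreover have "degree (\<Sum>j<m. smult (x j) (w j)) \<le> L"
    using assms by (intro degree_sum_le order_trans[OF degree_smult_le]) auto
  ultimately show ?thesis unfolding comb_def by (intro degree_add_le)
qed

lemma sum_Suc_L: "(\<Sum>j<Suc L. f j) = (\<Sum>j<m. f j) + (\<Sum>k<M. f (m + k))"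
proof -
  have "(\<Sum>j<m + M. f j) = (\<Sum>j<m. f j) + (\<Sum>j=m..<m + M. f j)"
    by (simp add: lessThan_atLeast0 sum.atLeastLessThan_concat)
  also have "(\<Sum>j=m..<m + M. f j) = (\<Sum>k<M. f (m + k))"
    using sum.shift_bounds_nat_ivl[of f 0 m M] by (simp add: lessThan_atLeast0 add.commute)
  finally show ?thesis by (simp add: Suc_L)
qed

lemma coeff_comb:
  assumes "i < Suc L"
  shows "coeff (comb w \<zeta> x) i = (\<Sum>j<Suc L. poly (syl w $$ (i, j)) \<zeta> * x j)"
proof -
  have "coeff (P \<zeta> * monom (x (m + k)) k) i = coeff (monom 1 k * P \<zeta>) i * x (m + k)" for k
    by (simp add: coeff_monom_mult mult.commute[of "P \<zeta>"])
  then have "coeff (comb w \<zeta> x) i = (\<Sum>j<m. coeff (w j) i * x j)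
      + (\<Sum>k<M. coeff (monom 1 k * P \<zeta>) i * x (m + k))"
    by (simp add: comb_def sum_distrib_left coeff_sum mult.commute)
  also have "\<dots> = (\<Sum>j<Suc L. poly (syl w $$ (i, j)) \<zeta> * x j)"
    unfolding sum_Suc_L using assms Suc_L by (simp add: poly_syl)
  finally show ?thesis .
qed

lemma poly_N: "poly (N w) \<zeta> = det (map_mat (\<lambda>c. poly c \<zeta>) (syl w))"
proof -
  have "comm_ring_hom (\<lambda>c::complex poly. poly c \<zeta>)" by unfold_locales auto
  from comm_ring_hom.hom_det[OF this] show ?thesis by (simp add: N_def)
qed

text \<open>Each term of the Leibniz expansion takes one entry from every column, and only the M
  columns from m on depend on \<zeta>, linearly.\<close>

lemma degree_N: "degree (N w) \<le> M"
proof -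
  have "degree (signof \<sigma> * (\<Prod>i = 0..<Suc L. syl w $$ (i, \<sigma> i))) \<le> M"
    if \<sigma>: "\<sigma> permutes {0..<Suc L}" for \<sigma>
  proof -
    have "degree (\<Prod>i = 0..<Suc L. syl w $$ (i, \<sigma> i)) \<le> (\<Sum>i = 0..<Suc L. degree (syl w $$ (i, \<sigma> i)))"
      using degree_prod_sum_le[of "{0..<Suc L}" "\<lambda>i. syl w $$ (i, \<sigma> i)"] by (simp add: o_def)
    also have "\<dots> \<le> (\<Sum>i = 0..<Suc L. if \<sigma> i < m then 0 else 1)"
    proof (rule sum_mono)
      fix i assume i: "i \<in> {0..<Suc L}"
      then have "\<sigma> i < Suc L" using permutes_in_image[OF \<sigma>, of i] by auto
      then show "degree (syl w $$ (i, \<sigma> i)) \<le> (if \<sigma> i < m then 0 else 1)"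
        using i by (simp add: syl_def)
    qed
    also have "\<dots> = (\<Sum>j = 0..<Suc L. if j < m then 0 else 1)"
      using sum.permute[OF \<sigma>, of "\<lambda>j. if j < m then 0 else 1 :: nat"] by (simp add: o_def)
    also have "\<dots> = M"
      using sum_Suc_L[of "\<lambda>j. if j < m then 0 else 1 :: nat"] by (simp add: lessThan_atLeast0)
    finally show ?thesis by simp
  qed
  then show ?thesis
    unfolding N_def det_def'[OF syl_carrier] by (intro degree_sum_le) (auto simp: finite_permutations)
qed

text \<open>Matrix times adjugate is the determinant: column k of the adjugate expresses N z^k
  through the generators modulo P. So N lies in the conductor of the module of the
  generators.\<close>

lemma N_conductor:
  assumes w: "\<And>j. j < m \<Longrightarrow> degree (w j) \<le> L" and k: "k \<le> L"
  obtains T :: "nat \<Rightarrow> complex poly"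
  where "\<And>\<zeta>. smult (poly (N w) \<zeta>) (monom 1 k) = comb w \<zeta> (\<lambda>j. poly (T j) \<zeta>)"
proof
  let ?T = "\<lambda>j. adj_mat (syl w) $$ (j, k)"
  fix \<zeta>
  show "smult (poly (N w) \<zeta>) (monom 1 k) = comb w \<zeta> (\<lambda>j. poly (?T j) \<zeta>)"
  proof (rule poly_eqI)
    fix i
    show "coeff (smult (poly (N w) \<zeta>) (monom 1 k)) i = coeff (comb w \<zeta> (\<lambda>j. poly (?T j) \<zeta>)) i"
    proof (cases "i < Suc L")
      case True
      have adj: "adj_mat (syl w) \<in> carrier_mat (Suc L) (Suc L)" by (rule adj_mat(1)) simp
      have "(syl w * adj_mat (syl w)) $$ (i, k) = (N w \<cdot>\<^sub>m 1\<^sub>m (Suc L)) $$ (i, k)"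
        unfolding N_def using adj_mat(2)[OF syl_carrier] by simp
      then have "(\<Sum>j<Suc L. syl w $$ (i, j) * ?T j) = (if i = k then N w else 0)"
        using True k adj by (simp add: scalar_prod_def lessThan_atLeast0)
      then have "poly (\<Sum>j<Suc L. syl w $$ (i, j) * ?T j) \<zeta> = (if i = k then poly (N w) \<zeta> else 0)"
        by simp
      then show ?thesis using coeff_comb[OF True, of w \<zeta>] by (simp add: poly_sum)
    next
      case False
      then show ?thesis using degree_comb[of w \<zeta> "\<lambda>j. poly (?T j) \<zeta>"] w k by (simp add: coeff_eq_0)
    qed
  qed
qed

text \<open>A kernel vector must involve a generator: if only the multiples of P occurred, their
  combination would be a product with \<open>P \<zeta>\<close>, which is not the zero
  polynomial.\<close>

lemma N_kernel:
  assumes w: "\<And>j. j < m \<Longrightarrow> degree (w j) \<le> L" and z: "poly (N w) \<zeta> = 0"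
  obtains x j0 where "comb w \<zeta> x = 0" "j0 < m" "x j0 \<noteq> 0"
proof -
  let ?S = "map_mat (\<lambda>c. poly c \<zeta>) (syl w)"
  have "det ?S = 0" using z by (simp add: poly_N)
  then obtain v where v: "v \<in> carrier_vec (Suc L)" "v \<noteq> 0\<^sub>v (Suc L)" "?S *\<^sub>v v = 0\<^sub>v (Suc L)"
    using det_0_iff_vec_prod_zero_field[of ?S "Suc L"] by auto
  define x where "x j = vec_index v j" for j
  have comb: "comb w \<zeta> x = 0"
  proof (rule poly_eqI)
    fix i
    show "coeff (comb w \<zeta> x) i = coeff 0 i"
    proof (cases "i < Suc L")
      case True
      have "vec_index (?S *\<^sub>v v) i = 0" using v(3) True by simp
      then have "(\<Sum>j<Suc L. poly (syl w $$ (i, j)) \<zeta> * x j) = 0"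
        using True v(1) by (simp add: scalar_prod_def x_def lessThan_atLeast0)
      then show ?thesis using coeff_comb[OF True] by simp
    next
      case False
      then show ?thesis using degree_comb[of w \<zeta> x] w by (simp add: coeff_eq_0)
    qed
  qed
  have "\<exists>j<m. x j \<noteq> 0"
  proof (rule ccontr)
    assume "\<not> (\<exists>j<m. x j \<noteq> 0)"
    then have x: "\<And>j. j < m \<Longrightarrow> x j = 0" by auto
    then have "P \<zeta> * (\<Sum>k<M. monom (x (m + k)) k) = 0" using comb by (simp add: comb_def)
    moreover have "P \<zeta> \<noteq> 0"
    proof (cases "norm \<zeta> \<le> 1")
      case True
      then show ?thesis using coeff_P_nonzero by force
    next
      case False
      \<comment> \<open>Outside the closed disk the leading coefficient may vanish. On the circle,
        however, |pt| = |p| is nonzero, so pt = \<zeta> p is impossible there for |\<zeta>| >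
        1.\<close>
      obtain s :: complex where s: "norm s = 1" using norm_one by blast
      have "poly p s \<noteq> 0" using blaschke_den_nonzero[OF \<alpha>, of s] s by simp
      then have "norm (poly pt s) \<noteq> norm (\<zeta> * poly p s)"
        using False norm_blaschke_eq[OF \<alpha> s] by (simp add: norm_mult)
      then have "poly (P \<zeta>) s \<noteq> 0" by (auto simp: poly_P)
      then show ?thesis by auto
    qed
    ultimately have "(\<Sum>k<M. monom (x (m + k)) k) = 0" by simp
    then have "coeff (\<Sum>k<M. monom (x (m + k)) k) l = 0" for l by simp
    then have xk: "x (m + k) = 0" if "k < M" for k
      using that by (simp add: coeff_sum) metis
    have "v = 0\<^sub>v (Suc L)"
    proof (rule eq_vecI)
      fix i assume i: "i < dim_vec (0\<^sub>v (Suc L) :: complex vec)"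
      show "vec_index v i = vec_index (0\<^sub>v (Suc L)) i"
        using x[of i] xk[of "i - m"] i Suc_L by (cases "i < m") (auto simp: x_def)
    qed (use v in auto)
    then show False using v by simp
  qed
  then show ?thesis using that comb by blast
qed

text \<open>If \<open>\<Sum>\<^sub>j x\<^sub>j w\<^sub>j = s P\<^sub>\<zeta>\<close>, then \<open>s p\<close> is \<open>\<Sum>\<^sub>j x\<^sub>j w\<^sub>j / (f - \<zeta>)\<close>, so this replaces a generator by
  a quotient.\<close>

lemma N_replace:
  assumes w: "\<And>j. j < m \<Longrightarrow> degree (w j) \<le> L"
    and x: "comb w \<zeta> x = 0" "j0 < m"
  defines "s \<equiv> - (\<Sum>k<M. monom (x (m + k)) k)"
  shows "(\<Sum>j<m. smult (x j) (w j)) = s * P \<zeta>" "degree (s * p) \<le> L"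
    "smult (x j0) (N w) = [:- \<zeta>, 1:] * N (w(j0 := s * p))"
proof -
  show "(\<Sum>j<m. smult (x j) (w j)) = s * P \<zeta>"
    using x(1) by (simp add: comb_def s_def add_eq_0_iff2 mult.commute)
  show deg: "degree (s * p) \<le> L"
  proof (cases M)
    case 0
    then show ?thesis by (simp add: s_def)
  next
    case (Suc M')
    have "degree s \<le> M'" unfolding s_def degree_minus
      using Suc by (intro degree_sum_le order_trans[OF degree_monom_le]) auto
    then show ?thesis
      using degree_mult_le[of s p] degree_blaschke_den[OF \<alpha>] Suc Suc_L by linarith
  qed
  let ?w = "w(j0 := s * p)" and ?X = "vec (Suc L) (\<lambda>j. [:x j:])"
  have col: "vec_index (syl w *\<^sub>v ?X) i = [:- \<zeta>, 1:] * [:coeff (s * p) i:]" if i: "i < Suc L" for i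
  proof (rule poly_eq_poly_eq_iff[THEN iffD1], rule ext)
    fix \<eta>
    \<comment> \<open>The kernel vector belongs to \<zeta>, but the matrix is needed at every
      \<eta>: as P is linear in its parameter, the image at \<eta> is (\<eta> - \<zeta>) s
      p.\<close>
    have "P \<eta> = P \<zeta> + smult (\<zeta> - \<eta>) p" by (simp add: P_def smult_diff_left)
    then have "comb w \<eta> x = comb w \<zeta> x - smult (\<zeta> - \<eta>) p * s"
      by (simp add: comb_def s_def algebra_simps)
    then have "comb w \<eta> x = smult (\<eta> - \<zeta>) (s * p)" using x by (simp add: smult_diff_left algebra_simps)
    then have "(\<Sum>j<Suc L. poly (syl w $$ (i, j)) \<eta> * x j) = (\<eta> - \<zeta>) * coeff (s * p) i"
      using coeff_comb[OF i, of w \<eta> x] by simp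
    then show "poly (vec_index (syl w *\<^sub>v ?X) i) \<eta> = poly ([:- \<zeta>, 1:] * [:coeff (s * p) i:]) \<eta>"
      using i by (simp add: scalar_prod_def lessThan_atLeast0 poly_sum algebra_simps)
  qed
  have j0: "j0 < Suc L" using x(2) m_le by simp
  \<comment> \<open>By Cramer's rule, putting matrix times x into column j0 multiplies the
    determinant by x j0. That column is \<eta> - \<zeta> times the column of the new generator, a
    factor taken out by a diagonal matrix.\<close>
  let ?D = "multrow_mat (Suc L) j0 [:- \<zeta>, 1:]"
  have "replace_col (syl w) (syl w *\<^sub>v ?X) j0 = syl ?w * ?D"
  proof (rule eq_matI)
    fix i j assume "i < dim_row (syl ?w * ?D)" "j < dim_col (syl ?w * ?D)"
    then have ij: "i < Suc L" "j < Suc L" by auto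
    have "(syl ?w * ?D) $$ (i, j) = (\<Sum>k<Suc L. syl ?w $$ (i, k) * ?D $$ (k, j))"
      using ij by (simp add: scalar_prod_def lessThan_atLeast0)
    also have "\<dots> = (\<Sum>k\<in>{j}. syl ?w $$ (i, k) * ?D $$ (k, j))"
      using ij by (intro sum.mono_neutral_right) (auto simp: multrow_mat_def)
    also have "\<dots> = (if j = j0 then [:- \<zeta>, 1:] * [:coeff (s * p) i:] else syl w $$ (i, j))"
      using ij j0 x(2) by (auto simp: multrow_mat_def syl_def)
    finally show "replace_col (syl w) (syl w *\<^sub>v ?X) j0 $$ (i, j) = (syl ?w * ?D) $$ (i, j)"
      using ij col by (auto simp: replace_col_def)
  qed (auto simp: replace_col_def)
  then have "det (syl ?w * ?D) = [:x j0:] * N w"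
    using cramer_lemma_mat[of "syl w" "Suc L" ?X j0] j0 by (simp add: N_def)
  moreover have "det (syl ?w * ?D) = N ?w * [:- \<zeta>, 1:]"
    unfolding N_def det_mult[OF syl_carrier multrow_mat_carrier] det_multrow_mat[OF j0] ..
  ultimately show "smult (x j0) (N w) = [:- \<zeta>, 1:] * N ?w" by (simp add: mult.commute)
qed

text \<open>Multiplication from the left by a block matrix that evaluates polynomials at the points
  z i: the columns of the multiples of P vanish in the first m rows, and what remains of them below
  is triangular with the coefficient of P at m on the diagonal.\<close>

lemma N_product_formula:
  assumes w: "\<And>j. j < m \<Longrightarrow> degree (w j) \<le> L"
    and z: "\<And>i. i < m \<Longrightarrow> poly (P \<zeta>) (z i) = 0"
  shows "(\<Prod>j<m. \<Prod>i<j. z j - z i) * poly (N w) \<zeta>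
    = coeff (P \<zeta>) m ^ M * det (mat m m (\<lambda>(i, j). poly (w j) (z i)))"
proof -
  let ?S = "map_mat (\<lambda>c. poly c \<zeta>) (syl w)"
  let ?V = "mat m m (\<lambda>(i, j). z i ^ j)" and ?B = "mat m M (\<lambda>(i, k). z i ^ (m + k))"
  let ?E = "four_block_mat ?V ?B (0\<^sub>m M m) (1\<^sub>m M)"
  let ?A = "mat m m (\<lambda>(i, j). poly (w j) (z i))" and ?C = "mat M m (\<lambda>(i, j). coeff (w j) (m + i))"
    and ?D = "mat M M (\<lambda>(i, k). coeff (monom 1 k * P \<zeta>) (m + i))"
  have E: "?E \<in> carrier_mat (Suc L) (Suc L)" unfolding Suc_L by (intro four_block_carrier_mat) auto
  have ER: "?E * ?S = four_block_mat ?A (0\<^sub>m m M) ?C ?D" (is "_ = ?R")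
  proof (rule eq_matI)
    fix i j assume "i < dim_row ?R" "j < dim_col ?R"
    then have ij: "i < m + M" "j < m + M" by auto
    have pe: "(\<Sum>k<Suc L. z i ^ k * coeff h k) = poly h (z i)" if "degree h \<le> L" for h
      using that by (simp add: poly_altdef mult.commute lessThan_Suc_atMost)
         (rule sum.mono_neutral_right, auto simp: coeff_eq_0)
    have "(?E * ?S) $$ (i, j) = (\<Sum>k<Suc L. ?E $$ (i, k) * ?S $$ (k, j))"
      using ij Suc_L by (simp add: scalar_prod_def lessThan_atLeast0)
    also have "\<dots> = (if i < m then \<Sum>k<Suc L. z i ^ k * ?S $$ (k, j) else ?S $$ (i, j))"
    proof (cases "i < m")
      case True
      then show ?thesis using Suc_L by (auto intro!: sum.cong)
    next
      case False
      then have "(\<Sum>k<Suc L. ?E $$ (i, k) * ?S $$ (k, j)) = (\<Sum>k\<in>{i}. ?E $$ (i, k) * ?S $$ (k, j))"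
        using ij Suc_L by (intro sum.mono_neutral_right) auto
      then show ?thesis using False ij by simp
    qed
    also have "\<dots> = ?R $$ (i, j)"
    proof (cases "j < m")
      case True
      then show ?thesis using ij Suc_L w pe[of "w j"] by (auto simp: poly_syl)
    next
      case False
      have "degree (monom 1 (j - m) * P \<zeta>) \<le> L"
        using degree_mult_le[of "monom 1 (j - m)" "P \<zeta>"] degree_P_le[of \<zeta>]
          degree_monom_le[of "1::complex" "j - m"] ij False Suc_L by linarith
      from pe[OF this] show ?thesis using False ij Suc_L z by (auto simp: poly_syl)
    qed
    finally show "(?E * ?S) $$ (i, j) = ?R $$ (i, j)" .
  qed (auto simp: Suc_L)
  have detES: "det (?E * ?S) = det ?E * det ?S" by (rule det_mult[OF E]) simp
  have detE: "det ?E = det ?V" by (subst det_four_block_mat_lower_left_zero[of _ m _ M]) auto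
  have detR: "det ?R = det ?A * det ?D" by (rule det_four_block_mat_upper_right_zero[of _ m _ M]) auto
  have detD: "det ?D = coeff (P \<zeta>) m ^ M"
  proof -
    have "upper_triangular ?D"
      using degree_P_le[of \<zeta>] by (auto simp: upper_triangular_def coeff_monom_mult coeff_eq_0)
    then have "det ?D = prod_list (diag_mat ?D)" by (rule det_upper_triangular[of _ M]) auto
    also have "diag_mat ?D = map (\<lambda>_. coeff (P \<zeta>) m) [0..<M]"
      by (auto simp: diag_mat_def coeff_monom_mult intro!: map_cong)
    finally show ?thesis by (simp add: prod_list_replicate map_replicate_const)
  qed
  have "det ?V * det ?S = det ?A * det ?D"
    unfolding detE[symmetric] detES[symmetric] ER detR ..
  then show ?thesis unfolding detD det_vandermonde poly_N by (simp add: mult.commute)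
qed

end

section \<open>Holomorphic functions on the disk as a module over functions of \<open>f\<close>\<close>

text \<open>The integral over the circle becomes one over [0, 1], where differentiation under the
  integral sign applies.\<close>

lemma contour_integral_param_holomorphic:
  fixes A B \<phi> :: "complex \<Rightarrow> complex"
  assumes cont: "continuous_on (sphere 0 \<rho>) \<phi>" "continuous_on (sphere 0 \<rho>) A" "continuous_on (sphere 0 \<rho>) B"
    and \<rho>: "0 \<le> \<rho>" and U: "convex U"
    and nz: "\<And>x \<zeta>. x \<in> sphere 0 \<rho> \<Longrightarrow> \<zeta> \<in> U \<Longrightarrow> A x - \<zeta> * B x \<noteq> 0"
  shows "(\<lambda>\<zeta>. contour_integral (circlepath 0 \<rho>) (\<lambda>x. \<phi> x / (A x - \<zeta> * B x))) holomorphic_on U"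
proof -
  let ?c = "circlepath 0 \<rho>"
  let ?d = "\<lambda>t::real. 2 * pi * \<i> * \<rho> * exp (2 * of_real pi * \<i> * t)"
  have c: "?c t \<in> sphere 0 \<rho>" for t :: real
    using \<rho> by (simp add: circlepath norm_mult)
  have comp: "continuous_on S (\<lambda>y. F (?c (g y)))"
    if "continuous_on (sphere 0 \<rho>) F" "continuous_on S g" for F :: "complex \<Rightarrow> complex"
      and S :: "'a::topological_space set" and g :: "'a \<Rightarrow> real"
  proof (rule continuous_on_compose2[OF that(1)])
    show "continuous_on S (\<lambda>y. ?c (g y))" unfolding circlepath by (intro continuous_intros that(2))
    show "(\<lambda>y. ?c (g y)) ` S \<subseteq> sphere 0 \<rho>" using c by blast
  qed
  have "(\<lambda>\<zeta>. integral (cbox 0 1) (\<lambda>t. \<phi> (?c t) / (A (?c t) - \<zeta> * B (?c t)) * ?d t)) holomorphic_on U"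
  proof (rule leibniz_rule_holomorphic[OF _ _ _ U])
    fix \<zeta> t assume "\<zeta> \<in> U" "t \<in> cbox 0 (1::real)"
    then have "A (?c t) - \<zeta> * B (?c t) \<noteq> 0" using nz c by blast
    then show "((\<lambda>\<zeta>. \<phi> (?c t) / (A (?c t) - \<zeta> * B (?c t)) * ?d t) has_field_derivative
        \<phi> (?c t) * B (?c t) / (A (?c t) - \<zeta> * B (?c t))\<^sup>2 * ?d t) (at \<zeta> within U)"
      by (auto intro!: derivative_eq_intros simp: power2_eq_square divide_simps)
  next
    fix \<zeta> assume "\<zeta> \<in> U"
    then show "(\<lambda>t. \<phi> (?c t) / (A (?c t) - \<zeta> * B (?c t)) * ?d t) integrable_on cbox 0 1"
      using nz c by (intro integrable_continuous continuous_intros comp cont) blast+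
  next
    show "continuous_on (U \<times> cbox 0 1) (\<lambda>(\<zeta>, t). \<phi> (?c t) * B (?c t) / (A (?c t) - \<zeta> * B (?c t))\<^sup>2 * ?d t)"
      unfolding case_prod_beta using nz c by (intro continuous_intros comp cont) auto
  qed
  then show ?thesis
    unfolding contour_integral_integral vector_derivative_circlepath by simp
qed

text \<open>The set where c is nonzero is open and finite, hence empty. This carries identities from
  generic fibres to all fibres.\<close>

lemma continuous_zero_off_finite:
  fixes c :: "complex \<Rightarrow> complex"
  assumes "continuous_on S c" "open S" "finite Z" "\<And>\<zeta>. \<zeta> \<in> S - Z \<Longrightarrow> c \<zeta> = 0" "\<zeta> \<in> S"
  shows "c \<zeta> = 0"
proof (rule ccontr)
  assume "c \<zeta> \<noteq> 0"
  let ?T = "S \<inter> c -` (- {0})"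
  have "open ?T" using assms(1,2) by (intro continuous_open_preimage) auto
  moreover have "?T \<subseteq> Z" using assms(4) by auto
  ultimately have "?T = {}" using assms(3) finite_imp_not_open finite_subset by blast
  then show False using \<open>c \<zeta> \<noteq> 0\<close> assms(5) by auto
qed

context blaschke_pair
begin

definition fb :: "complex \<Rightarrow> complex" where "fb z = poly pt z / poly p z"

section \<open>The fibres of \<open>fb\<close> over the closed disk\<close>

lemma p_nonzero: "norm z \<le> 1 \<Longrightarrow> poly p z \<noteq> 0" by (rule blaschke_den_nonzero[OF \<alpha>])

lemma q_nonzero: "norm z \<le> 1 \<Longrightarrow> poly q z \<noteq> 0" by (rule blaschke_den_nonzero[OF \<beta>])

lemma fb_eq_iff: "norm z \<le> 1 \<Longrightarrow> fb z = \<zeta> \<longleftrightarrow> poly (P \<zeta>) z = 0"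
  using p_nonzero[of z] by (auto simp: fb_def poly_P field_simps)

lemma norm_fb_less: "norm z < 1 \<Longrightarrow> norm (fb z) < 1"
  using norm_blaschke_less[OF \<alpha>, of z] p_nonzero[of z] m_pos by (simp add: fb_def norm_divide)

lemma norm_fb_eq: "norm z = 1 \<Longrightarrow> norm (fb z) = 1"
  using norm_blaschke_eq[OF \<alpha>, of z] p_nonzero[of z] by (simp add: fb_def norm_divide)

lemma continuous_fb: "continuous_on (cball 0 1) fb"
  unfolding fb_def using p_nonzero by (intro continuous_intros) auto

lemma holomorphic_fb: "fb holomorphic_on ball 0 1"
  unfolding fb_def using p_nonzero by (intro holomorphic_intros) auto

text \<open>Outside the closed disk the numerator exceeds the denominator, so for |\<zeta>| \<le> 1
  no point of the fibre lies there; |f| then tells inside from circle.\<close>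

lemma root_P:
  assumes "poly (P \<zeta>) z = 0" "norm \<zeta> \<le> 1"
  shows "norm z \<le> 1" "norm z < 1 \<longleftrightarrow> norm \<zeta> < 1" "fb z = \<zeta>"
proof -
  have eq: "poly pt z = \<zeta> * poly p z" using assms(1) by (simp add: poly_P)
  have "norm (poly pt z) \<le> norm (poly p z)"
    unfolding eq norm_mult using assms(2) by (intro mult_left_le_one_le) auto
  then show le: "norm z \<le> 1" using norm_blaschke_greater[OF \<alpha>, of z] m_pos by force
  then show fb: "fb z = \<zeta>" using assms(1) by (simp add: fb_eq_iff)
  show "norm z < 1 \<longleftrightarrow> norm \<zeta> < 1"
    using norm_fb_less[of z] norm_fb_eq[of z] fb le by (cases "norm z = 1") auto
qed

text \<open>The sublevel set is compact in the closed disk and misses the circle, where |f| = 1;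
  \<rho> is halfway between its largest modulus and 1 (or 1/2 if the set is empty).\<close>

lemma fb_proper:
  assumes "R < 1"
  obtains \<rho> where "0 < \<rho>" "\<rho> < 1" "\<And>z. norm z \<le> 1 \<Longrightarrow> norm (fb z) \<le> R \<Longrightarrow> norm z < \<rho>"
proof -
  let ?S = "{z \<in> cball 0 1. norm (fb z) \<le> R}"
  have "closed ?S"
    using continuous_closed_preimage[OF continuous_on_norm[OF continuous_fb], of "{..R}"]
    by (simp add: vimage_def Int_def)
  then have S: "compact ?S" by (metis (no_types, lifting) compact_cball compact_Int_closed Int_absorb1 Int_commute mem_Collect_eq subsetI)
  show ?thesis
  proof (cases "?S = {}")
    case True
    then show ?thesis using that[of "1/2"] by auto
  next
    case False
    then obtain z where z: "z \<in> ?S" "\<And>y. y \<in> ?S \<Longrightarrow> norm y \<le> norm z"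
      using continuous_attains_sup[OF S False, of norm] continuous_on_norm_id by blast
    have "norm z < 1" using z(1) norm_fb_eq[of z] assms by fastforce
    show ?thesis
    proof (rule that[of "(norm z + 1) / 2"])
      show "0 < (norm z + 1) / 2" by (simp add: add_nonneg_pos)
      show "(norm z + 1) / 2 < 1" using \<open>norm z < 1\<close> by simp
      fix y assume "norm y \<le> 1" "norm (fb y) \<le> R"
      then have "norm y \<le> norm z" using z(2)[of y] by simp
      also have "\<dots> < (norm z + 1) / 2" using \<open>norm z < 1\<close> by simp
      finally show "norm y < (norm z + 1) / 2" .
    qed
  qed
qed

text \<open>The numerator of the derivative of \<open>fb\<close>; its zeros in the disk are the
  critical points, the only places where a fibre has repeated points.\<close>

definition W :: "complex poly" where "W = pderiv pt * p - pt * pderiv p"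

lemma W_circle: "norm z = 1 \<Longrightarrow> poly W z \<noteq> 0"
  unfolding W_def by (rule blaschke_wronskian_nonzero[OF \<alpha> _ m_pos])

lemma W_ne_0: "W \<noteq> 0" using W_circle[of 1] by auto

text \<open>At a repeated root both pt = \<zeta> p and pt' = \<zeta> p' hold, which makes the
  Wronskian vanish.\<close>

lemma distinct_roots:
  assumes \<zeta>: "norm \<zeta> \<le> 1" and W: "\<And>z. poly (P \<zeta>) z = 0 \<Longrightarrow> poly W z \<noteq> 0"
  obtains z where "bij_betw z {..<m} {x. poly (P \<zeta>) x = 0}"
proof -
  have "rsquarefree (P \<zeta>)"
    unfolding rsquarefree_roots
  proof (intro allI notI, elim conjE)
    fix a assume a: "poly (P \<zeta>) a = 0" "poly (pderiv (P \<zeta>)) a = 0"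
    then have "poly pt a = \<zeta> * poly p a" "poly (pderiv pt) a = \<zeta> * poly (pderiv p) a"
      by (simp_all add: P_def pderiv_diff pderiv_smult)
    then have "poly W a = 0" by (simp add: W_def)
    then show False using W[OF a(1)] by simp
  qed
  then have "smult (lead_coeff (P \<zeta>)) (\<Prod>z | poly (P \<zeta>) z = 0. [:- z, 1:]) = P \<zeta>"
    by (rule complex_poly_decompose_rsquarefree)
  moreover have P0: "P \<zeta> \<noteq> 0" using coeff_P_nonzero[OF \<zeta>] by force
  ultimately have "degree (P \<zeta>) = degree (\<Prod>z | poly (P \<zeta>) z = 0. [:- z, 1:])"
    by (metis degree_smult_eq smult_0_left)
  also have "\<dots> = card {z. poly (P \<zeta>) z = 0}"
    by (simp add: degree_prod_eq_sum_degree)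
  finally have "card {z. poly (P \<zeta>) z = 0} = m" using degree_P[OF \<zeta>] by simp
  then obtain z where "bij_betw z {..<m} {x. poly (P \<zeta>) x = 0}"
    using poly_roots_finite[OF P0] by (metis bij_betw_iff_card card_lessThan finite_lessThan)
  then show ?thesis using that by blast
qed

lemma distinct_roots_generic:
  obtains Z where "finite Z"
    "\<And>\<zeta>. norm \<zeta> < 1 \<Longrightarrow> \<zeta> \<notin> Z \<Longrightarrow> \<exists>z. bij_betw z {..<m} {x. poly (P \<zeta>) x = 0}"
proof
  show "finite (fb ` {z. poly W z = 0})" using poly_roots_finite[OF W_ne_0] by simp
  fix \<zeta> :: complex assume "norm \<zeta> < 1" "\<zeta> \<notin> fb ` {z. poly W z = 0}"
  then show "\<exists>z. bij_betw z {..<m} {x. poly (P \<zeta>) x = 0}"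
    using root_P(3)[of \<zeta>] distinct_roots[of \<zeta>] by (metis (mono_tags, lifting) imageI less_imp_le mem_Collect_eq)
qed

section \<open>Freeness: uniqueness of coefficients that are functions of \<open>fb\<close>\<close>

lemma vandermonde_nonzero:
  assumes "inj_on z {..<m}"
  shows "(\<Prod>j<m. \<Prod>i<j. z j - z i :: complex) \<noteq> 0"
proof -
  have "z j \<noteq> z i" if "i < j" "j < m" for i j
    using inj_onD[OF assms, of j i] that by auto
  then show ?thesis by simp
qed

lemma solve_at_roots:
  assumes w: "\<And>j. j < m \<Longrightarrow> degree (w j) \<le> L" and N: "poly (N w) \<zeta> \<noteq> 0"
    and z: "bij_betw z {..<m} {x. poly (P \<zeta>) x = 0}"
    and c: "\<And>i. i < m \<Longrightarrow> (\<Sum>j<m. c j * poly (w j) (z i)) = 0" and j: "j < m"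
  shows "c j = 0"
proof -
  have zr: "poly (P \<zeta>) (z i) = 0" if "i < m" for i using z that by (auto simp: bij_betw_def)
  let ?A = "mat m m (\<lambda>(i, j). poly (w j) (z i))"
  have "det ?A \<noteq> 0"
    using N_product_formula[of w \<zeta> z] w zr N vandermonde_nonzero[of z] z by (auto simp: bij_betw_def)
  moreover have "?A *\<^sub>v vec m c = 0\<^sub>v m"
    using c by (intro eq_vecI) (auto simp: scalar_prod_def lessThan_atLeast0 mult.commute)
  ultimately have "vec m c = 0\<^sub>v m"
    using det_0_iff_vec_prod_zero_field[of ?A m] by (metis mat_carrier vec_carrier)
  then show ?thesis using j by (metis index_vec index_zero_vec(1))
qed

text \<open>A relation gives, on each simple fibre with N nonzero, a square linear system with only
  the zero solution; continuity covers the finitely many other values. The radius R admits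
  coefficients that are defined on a smaller disk only.\<close>

lemma coeff_unique:
  assumes w: "\<And>j. j < m \<Longrightarrow> degree (w j) \<le> L" and N: "N w \<noteq> 0" and R: "R \<le> 1"
    and c: "\<And>j. j < m \<Longrightarrow> continuous_on (ball 0 R) (c j)"
    and eq: "\<And>z. norm z < 1 \<Longrightarrow> norm (fb z) < R \<Longrightarrow> (\<Sum>j<m. c j (fb z) * poly (w j) z) = 0"
    and j: "j < m" and \<zeta>: "norm \<zeta> < R"
  shows "c j \<zeta> = 0"
proof -
  obtain Z where Z: "finite Z"
    "\<And>\<zeta>. norm \<zeta> < 1 \<Longrightarrow> \<zeta> \<notin> Z \<Longrightarrow> \<exists>z. bij_betw z {..<m} {x. poly (P \<zeta>) x = 0}"
    by (rule distinct_roots_generic) blast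
  have "c j \<eta> = 0" if \<eta>: "\<eta> \<in> ball 0 R - (Z \<union> {\<zeta>. poly (N w) \<zeta> = 0})" for \<eta>
  proof -
    obtain z where z: "bij_betw z {..<m} {x. poly (P \<eta>) x = 0}" using Z(2)[of \<eta>] \<eta> R by auto
    have "(\<Sum>j<m. c j \<eta> * poly (w j) (z i)) = 0" if "i < m" for i
    proof -
      have "poly (P \<eta>) (z i) = 0" using z that by (auto simp: bij_betw_def)
      then show ?thesis using root_P[of \<eta> "z i"] eq[of "z i"] \<eta> R by auto
    qed
    then show ?thesis using solve_at_roots[of w \<eta> z "\<lambda>j. c j \<eta>" j] w z j \<eta> by auto
  qed
  then show ?thesis
    using continuous_zero_off_finite[OF c[OF j] open_ball, of "Z \<union> {\<zeta>. poly (N w) \<zeta> = 0}" \<zeta>] Z(1)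
      poly_roots_finite[OF N] \<zeta> by auto
qed

text \<open>For the generators 1, z, ..., z^(m-1) the product formula has a Vandermonde determinant
  on both sides. It is applied over the point 1, whose fibre is simple since it lies on the
  circle.\<close>

lemma N_monom_ne_0: "N (\<lambda>k. monom 1 k) \<noteq> 0"
proof -
  obtain z where z: "bij_betw z {..<m} {x. poly (P 1) x = 0}"
  proof (rule distinct_roots[of 1])
    fix z assume "poly (P 1) z = 0"
    then show "poly W z \<noteq> 0" using root_P[of 1 z] by (intro W_circle) auto
  qed auto
  have zr: "poly (P 1) (z i) = 0" if "i < m" for i using z that by (auto simp: bij_betw_def)
  have "degree (monom 1 k :: complex poly) \<le> L" if "k < m" for k
    using that m_le degree_monom_le[of "1::complex" k] by linarith
  from N_product_formula[OF this zr] have "(\<Prod>j<m. \<Prod>i<j. z j - z i) * poly (N (\<lambda>k. monom 1 k)) 1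
      = coeff (P 1) m ^ M * det (mat m m (\<lambda>(i, j). z i ^ j))"
    by (simp add: poly_monom)
  then show ?thesis
    using coeff_P_nonzero[of 1] vandermonde_nonzero[of z] z
    by (auto simp: det_vandermonde bij_betw_def)
qed

section \<open>Existence of the expansion in 1, z, ..., z^(m-1)\<close>

lemma degree_monom_L: "k < m \<Longrightarrow> degree (monom 1 k :: complex poly) \<le> L"
  using m_le degree_monom_le[of "1::complex" k] by linarith

text \<open>For z in the fibre over \<zeta>, the value of \<open>P \<zeta>\<close> at x is x - z
  times a polynomial in z of degree below m whose coefficients depend only on x and \<zeta>.
  Dividing by that value turns the Cauchy kernel 1/(x - z) into an expansion in 1, z, ..., z^(m-1),
  and integration gives the coefficients.\<close>

lemma decomposition_local:
  assumes h: "h holomorphic_on ball 0 1" and R: "R < 1"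
  obtains a where "\<And>k. k < m \<Longrightarrow> a k holomorphic_on ball 0 R"
    "\<And>z. norm z < 1 \<Longrightarrow> norm (fb z) < R \<Longrightarrow> h z = (\<Sum>k<m. a k (fb z) * z ^ k)"
proof -
  obtain \<rho> where \<rho>: "0 < \<rho>" "\<rho> < 1" "\<And>z. norm z \<le> 1 \<Longrightarrow> norm (fb z) \<le> R \<Longrightarrow> norm z < \<rho>"
    using fb_proper[OF R] by blast
  have nz: "poly pt x - \<zeta> * poly p x \<noteq> 0" if "x \<in> sphere 0 \<rho>" "\<zeta> \<in> ball 0 R" for x \<zeta>
    using \<rho>(2) \<rho>(3)[of x] that fb_eq_iff[of x \<zeta>] by (force simp: poly_P)
  let ?I = "contour_integral (circlepath 0 \<rho>)"
  \<comment> \<open>The coefficient of z^k in (r(z) - r(x)) / (z - x).\<close>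
  define D where "D r k x = (\<Sum>i = Suc k..m. coeff r i * x ^ (i - k - 1))" for r :: "complex poly" and k and x :: complex
  define J where "J r k \<zeta> = ?I (\<lambda>x. h x * D r k x / (poly pt x - \<zeta> * poly p x))" for r k \<zeta>
  define a where "a k \<zeta> = (J pt k \<zeta> - \<zeta> * J p k \<zeta>) / (2 * of_real pi * \<i>)" for k \<zeta>
  have conth: "continuous_on (sphere 0 \<rho>) h"
    using \<rho> by (intro continuous_on_subset[OF holomorphic_on_imp_continuous_on[OF h]]) auto
  have hD: "continuous_on (sphere 0 \<rho>) (\<lambda>x. h x * D r k x)" for r k
    unfolding D_def by (intro continuous_intros conth)
  have J: "J r k holomorphic_on ball 0 R" for r k
    unfolding J_def using \<rho> nz by (intro contour_integral_param_holomorphic hD continuous_intros) auto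
  show ?thesis
  proof
    show "a k holomorphic_on ball 0 R" for k
      unfolding a_def using J by (intro holomorphic_intros) auto
    fix z assume z: "norm z < 1" "norm (fb z) < R"
    define \<zeta> where "\<zeta> = fb z"
    have z\<rho>: "norm z < \<rho>" using \<rho>(3)[of z] z by simp
    have Pz: "poly (P \<zeta>) z = 0" using z by (simp add: \<zeta>_def flip: fb_eq_iff)
    have \<zeta>R: "\<zeta> \<in> ball 0 R" using z by (simp add: \<zeta>_def)
    have pi: "path_image (circlepath 0 \<rho>) = sphere 0 \<rho>" using \<rho> by simp
    have ci: "(\<lambda>x. h x * D r k x / (poly pt x - \<zeta> * poly p x)) contour_integrable_on circlepath 0 \<rho>" for r k
      unfolding J_def using nz \<zeta>R unfolding pi[symmetric]
      by (intro contour_integrable_continuous_circlepath continuous_intros hD[folded pi]) auto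
    let ?g = "\<lambda>k x. (h x * D pt k x / (poly pt x - \<zeta> * poly p x)
        - \<zeta> * (h x * D p k x / (poly pt x - \<zeta> * poly p x))) * z ^ k"
    have ci': "?g k contour_integrable_on circlepath 0 \<rho>" for k
      by (intro contour_integrable_rmul contour_integrable_diff contour_integrable_lmul ci)
    have "(\<Sum>k<m. a k \<zeta> * z ^ k) = (\<Sum>k<m. ?I (?g k)) / (2 * of_real pi * \<i>)"
      unfolding a_def J_def sum_divide_distrib
      by (intro sum.cong refl)
        (simp add: contour_integral_rmul contour_integral_diff contour_integral_lmul
          contour_integrable_diff contour_integrable_lmul ci del: times_divide_eq_right)
    also have "(\<Sum>k<m. ?I (?g k)) = ?I (\<lambda>x. \<Sum>k<m. ?g k x)"
      by (rule contour_integral_sum[symmetric]) (use ci' in auto)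
    also have "\<dots> = ?I (\<lambda>x. h x / (x - z))"
    proof (rule contour_integral_eq)
      fix x assume "x \<in> path_image (circlepath 0 \<rho>)"
      then have x: "x \<in> sphere 0 \<rho>" unfolding pi .
      have xz: "x \<noteq> z" using x z\<rho> by auto
      have diff: "poly r z - poly r x = (z - x) * (\<Sum>k<m. D r k x * z ^ k)" if "degree r \<le> m" for r
      proof -
        have "poly r y = (\<Sum>i\<le>m. coeff r i * y ^ i)" for y
          unfolding poly_altdef using that by (intro sum.mono_neutral_left) (auto simp: coeff_eq_0)
        then show ?thesis
          using polyfun_diff[of m "coeff r" z x] m_pos by (simp add: D_def)
      qed
      have d: "degree pt \<le> m" "degree p \<le> m"
        using degree_blaschke_num[OF \<alpha>] degree_blaschke_den[OF \<alpha>] by auto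
      have nzx: "poly pt x - \<zeta> * poly p x \<noteq> 0" using nz[OF x \<zeta>R] .
      have "poly pt x - \<zeta> * poly p x = (x - z) * ((\<Sum>k<m. D pt k x * z ^ k) - \<zeta> * (\<Sum>k<m. D p k x * z ^ k))"
        (is "_ = (x - z) * (?A - \<zeta> * ?B)")
      proof -
        have "poly pt x - \<zeta> * poly p x
            = poly (P \<zeta>) z - ((poly pt z - poly pt x) - \<zeta> * (poly p z - poly p x))"
          by (simp add: poly_P algebra_simps)
        also have "\<dots> = (x - z) * (?A - \<zeta> * ?B)"
          unfolding diff[OF d(1)] diff[OF d(2)] Pz by (simp only: algebra_simps) simp
        finally show ?thesis .
      qed
      then have "((\<Sum>k<m. D pt k x * z ^ k) - \<zeta> * (\<Sum>k<m. D p k x * z ^ k)) / (poly pt x - \<zeta> * poly p x) = 1 / (x - z)"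
        using nzx xz by (simp add: field_simps)
      then have "h x * (((\<Sum>k<m. D pt k x * z ^ k) - \<zeta> * (\<Sum>k<m. D p k x * z ^ k)) / (poly pt x - \<zeta> * poly p x)) = h x / (x - z)"
        by simp
      then show "(\<Sum>k<m. ?g k x) = h x / (x - z)"
        by (simp add: sum_distrib_left sum_distrib_right sum_subtractf sum_divide_distrib algebra_simps diff_divide_distrib)
    qed
    also have "\<dots> = 2 * of_real pi * \<i> * h z"
      using \<rho> z\<rho> by (intro contour_integral_unique Cauchy_integral_circlepath_simple
          holomorphic_on_subset[OF h]) auto
    finally show "h z = (\<Sum>k<m. a k (fb z) * z ^ k)" by (simp add: \<zeta>_def)
  qed
qed

text \<open>On an exhaustion by smaller disks the local coefficients agree by uniqueness, so they
  glue.\<close>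

lemma decomposition:
  assumes h: "h holomorphic_on ball 0 1"
  obtains a where "\<And>k. k < m \<Longrightarrow> a k holomorphic_on ball 0 1"
    "\<And>z. norm z < 1 \<Longrightarrow> h z = (\<Sum>k<m. a k (fb z) * z ^ k)"
proof -
  define R where "R i = 1 - 1 / real (i + 2)" for i
  have R: "R i < 1" "i \<le> j \<Longrightarrow> R i \<le> R j" for i j by (auto simp: R_def frac_le)
  have ex: "\<exists>i. norm \<zeta> < R i" if "norm \<zeta> < 1" for \<zeta> :: complex
  proof -
    obtain i where "1 / (1 - norm \<zeta>) < real i" using reals_Archimedean2 by blast
    then have "1 / (1 - norm \<zeta>) < real (i + 2)" by simp
    then have "norm \<zeta> < R i" using that by (simp add: R_def field_simps)
    then show ?thesis ..
  qed
  have "\<forall>i. \<exists>a. (\<forall>k<m. a k holomorphic_on ball 0 (R i)) \<and>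
      (\<forall>z. norm z < 1 \<longrightarrow> norm (fb z) < R i \<longrightarrow> h z = (\<Sum>k<m. a k (fb z) * z ^ k))"
    using decomposition_local[OF h R(1)] by metis
  then obtain a where a: "\<And>i k. k < m \<Longrightarrow> a i k holomorphic_on ball 0 (R i)"
    "\<And>i z. norm z < 1 \<Longrightarrow> norm (fb z) < R i \<Longrightarrow> h z = (\<Sum>k<m. a i k (fb z) * z ^ k)" by metis
  have agree: "a i k \<zeta> = a j k \<zeta>" if ij: "i \<le> j" and k: "k < m" and \<zeta>: "norm \<zeta> < R i" for i j k \<zeta>
  proof -
    have "a i k \<zeta> - a j k \<zeta> = 0"
    proof (rule coeff_unique[of "\<lambda>k. monom 1 k" "R i" "\<lambda>k \<zeta>. a i k \<zeta> - a j k \<zeta>"])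
      show "continuous_on (ball 0 (R i)) (\<lambda>\<zeta>. a i k \<zeta> - a j k \<zeta>)" if "k < m" for k
        using a(1)[OF that, of i] a(1)[OF that, of j] R(2)[OF ij]
        by (intro continuous_intros holomorphic_on_imp_continuous_on) (auto intro: holomorphic_on_subset)
      show "(\<Sum>k<m. (a i k (fb z) - a j k (fb z)) * poly (monom 1 k) z) = 0"
        if "norm z < 1" "norm (fb z) < R i" for z
        using a(2)[of z i] a(2)[of z j] that R(2)[OF ij]
        by (simp add: poly_monom left_diff_distrib sum_subtractf)
    qed (use R(1)[of i] N_monom_ne_0 degree_monom_L k \<zeta> in auto)
    then show ?thesis by simp
  qed
  define b where "b k \<zeta> = a (LEAST i. norm \<zeta> < R i) k \<zeta>" for k \<zeta>
  have b: "b k \<zeta> = a i k \<zeta>" if "k < m" "norm \<zeta> < R i" for i k \<zeta>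
  proof -
    have "(LEAST i. norm \<zeta> < R i) \<le> i" "norm \<zeta> < R (LEAST i. norm \<zeta> < R i)"
      using that by (auto intro: Least_le LeastI)
    then show ?thesis unfolding b_def using agree that by blast
  qed
  show ?thesis
  proof
    fix k assume k: "k < m"
    have "b k analytic_on ball 0 1"
      unfolding analytic_on_def
    proof
      fix \<zeta> :: complex assume "\<zeta> \<in> ball 0 1"
      then obtain i where i: "norm \<zeta> < R i" using ex by auto
      have "b k holomorphic_on ball 0 (R i)"
        using a(1)[OF k, of i] by (rule holomorphic_transform) (use b[OF k, of _ i] in auto)
      moreover have "ball \<zeta> (R i - norm \<zeta>) \<subseteq> ball 0 (R i)"
      proof
        fix x assume "x \<in> ball \<zeta> (R i - norm \<zeta>)"
        then show "x \<in> ball 0 (R i)"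
          using norm_triangle_sub[of x \<zeta>] by (simp add: dist_norm norm_minus_commute)
      qed
      ultimately show "\<exists>e>0. b k holomorphic_on ball \<zeta> e"
        using i by (intro exI[of _ "R i - norm \<zeta>"]) (auto intro: holomorphic_on_subset)
    qed
    then show "b k holomorphic_on ball 0 1" by (rule analytic_imp_holomorphic)
  next
    fix z :: complex assume z: "norm z < 1"
    then obtain i where i: "norm (fb z) < R i" using ex norm_fb_less by blast
    then show "h z = (\<Sum>k<m. b k (fb z) * z ^ k)" using a(2)[OF z i] b[of _ "fb z" i] by simp
  qed
qed

end

section \<open>The codimension of a submodule of full rank\<close>

definition on_disk :: "(complex \<Rightarrow> complex) \<Rightarrow> complex \<Rightarrow> complex" where
  "on_disk h z = (if norm z < 1 then h z else 0)"

lemma on_disk_simps [simp]: "norm z < 1 \<Longrightarrow> on_disk h z = h z" "\<not> norm z < 1 \<Longrightarrow> on_disk h z = 0"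
  by (simp_all add: on_disk_def)

lemma on_disk_in_holo_disk:
  assumes "h holomorphic_on ball 0 1" shows "on_disk h \<in> holo_disk"
proof -
  have "on_disk h holomorphic_on ball 0 1"
    by (rule holomorphic_transform[OF assms]) simp
  then show ?thesis by (simp add: holo_disk_def)
qed

lemma holo_disk_holomorphic: "h \<in> holo_disk \<Longrightarrow> h holomorphic_on ball 0 1"
  by (simp add: holo_disk_def)

lemma holo_disk_outside: "h \<in> holo_disk \<Longrightarrow> \<not> norm z < 1 \<Longrightarrow> h z = 0"
  by (simp add: holo_disk_def)

lemma subspace_holo_disk: "holo.subspace holo_disk"
  by (auto simp: holo.subspace_def holo_disk_def scale_fun_def plus_fun_def zero_fun_def
      intro!: holomorphic_intros)

lemma proots_linear_mult:
  fixes A :: "complex poly"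
  assumes "c \<noteq> 0" "smult c A = [:- a, 1:] * B" "A \<noteq> 0"
  shows "B \<noteq> 0" "proots A = add_mset a (proots B)"
proof -
  show B: "B \<noteq> 0" using assms by auto
  have "proots A = proots (smult c A)" using assms(1) by simp
  also have "\<dots> = proots [:- a, 1:] + proots B" unfolding assms(2) using B by (intro proots_mult) auto
  also have "proots [:- a, 1:] = {#a#}" by simp
  finally show "proots A = add_mset a (proots B)" by simp
qed

definition disk_roots :: "complex poly \<Rightarrow> complex multiset" where
  "disk_roots A = filter_mset (\<lambda>a. norm a < 1) (proots A)"

context blaschke_pair
begin

lemma poly_P_fb: "norm z < 1 \<Longrightarrow> poly (P \<zeta>) z = poly p z * (fb z - \<zeta>)"
  using p_nonzero[of z] by (simp add: poly_P fb_def field_simps)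

text \<open>The unit \<open>q\<^sup>m\<^sup>-\<^sup>1\<close> turns the generators \<open>g\<^sup>j\<close> into polynomials.\<close>

definition fmod :: "(nat \<Rightarrow> complex poly) \<Rightarrow> (complex \<Rightarrow> complex) set" where
  "fmod w = {h \<in> holo_disk. \<exists>b. (\<forall>j<m. b j holomorphic_on ball 0 1) \<and>
     (\<forall>z. norm z < 1 \<longrightarrow> poly q z ^ (m - 1) * h z = (\<Sum>j<m. b j (fb z) * poly (w j) z))}"

lemma fmodI:
  assumes "h \<in> holo_disk" "\<And>j. j < m \<Longrightarrow> b j holomorphic_on ball 0 1"
    "\<And>z. norm z < 1 \<Longrightarrow> poly q z ^ (m - 1) * h z = (\<Sum>j<m. b j (fb z) * poly (w j) z)"
  shows "h \<in> fmod w"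
  using assms unfolding fmod_def by blast

lemma fmodE:
  assumes "h \<in> fmod w"
  obtains b where "h \<in> holo_disk" "\<And>j. j < m \<Longrightarrow> b j holomorphic_on ball 0 1"
    "\<And>z. norm z < 1 \<Longrightarrow> poly q z ^ (m - 1) * h z = (\<Sum>j<m. b j (fb z) * poly (w j) z)"
  using assms unfolding fmod_def by blast

lemma fmod_subset: "fmod w \<subseteq> holo_disk" by (auto simp: fmod_def)

lemma subspace_fmod: "holo.subspace (fmod w)"
  unfolding holo.subspace_def
proof (intro conjI ballI allI)
  show "0 \<in> fmod w"
    using holo.subspace_0[OF subspace_holo_disk] by (intro fmodI[of _ "\<lambda>_ _. 0"]) (auto simp: zero_fun_def)
  fix h assume h: "h \<in> fmod w"
  then obtain b where b: "h \<in> holo_disk" "\<And>j. j < m \<Longrightarrow> b j holomorphic_on ball 0 1"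
    "\<And>z. norm z < 1 \<Longrightarrow> poly q z ^ (m - 1) * h z = (\<Sum>j<m. b j (fb z) * poly (w j) z)" by (rule fmodE) blast
  show "scale_fun c h \<in> fmod w" for c
  proof (rule fmodI[of _ "\<lambda>j z. c * b j z"])
    show "scale_fun c h \<in> holo_disk" using b(1) holo.subspace_scale[OF subspace_holo_disk] by blast
    show "poly q z ^ (m - 1) * scale_fun c h z = (\<Sum>j<m. c * b j (fb z) * poly (w j) z)" if "norm z < 1" for z
      using b(3)[OF that] by (simp add: scale_fun_def sum_distrib_left mult.assoc mult.left_commute[of _ c])
  qed (use b(2) in \<open>auto intro!: holomorphic_intros\<close>)
  fix h' assume h': "h' \<in> fmod w"
  then obtain b' where b': "h' \<in> holo_disk" "\<And>j. j < m \<Longrightarrow> b' j holomorphic_on ball 0 1"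
    "\<And>z. norm z < 1 \<Longrightarrow> poly q z ^ (m - 1) * h' z = (\<Sum>j<m. b' j (fb z) * poly (w j) z)" by (rule fmodE) blast
  show "h + h' \<in> fmod w"
  proof (rule fmodI[of _ "\<lambda>j z. b j z + b' j z"])
    show "h + h' \<in> holo_disk" using b(1) b'(1) holo.subspace_add[OF subspace_holo_disk] by blast
    show "poly q z ^ (m - 1) * (h + h') z = (\<Sum>j<m. (b j (fb z) + b' j (fb z)) * poly (w j) z)" if "norm z < 1" for z
      using b(3)[OF that] b'(3)[OF that] by (simp add: algebra_simps sum.distrib)
  qed (use b(2) b'(2) in \<open>auto intro!: holomorphic_intros\<close>)
qed

lemma holomorphic_comp_fb: "b holomorphic_on ball 0 1 \<Longrightarrow> (\<lambda>z. b (fb z)) holomorphic_on ball 0 1"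
  using holomorphic_on_compose_gen[OF holomorphic_fb, of b "ball 0 1"] norm_fb_less
  by (force simp: o_def)

text \<open>The function q^(m-1) h is expanded in 1, z, ..., z^(m-1), and N(f) z^k is a combination
  of the generators: the multiple of P in it vanishes at z when \<zeta> = f(z).\<close>

lemma fmod_conductor:
  assumes w: "\<And>j. j < m \<Longrightarrow> degree (w j) \<le> L" and h: "h \<in> holo_disk"
  shows "(\<lambda>z. poly (N w) (fb z) * h z) \<in> fmod w"
proof -
  have "(\<lambda>z. poly q z ^ (m - 1) * h z) holomorphic_on ball 0 1"
    using holo_disk_holomorphic[OF h] by (intro holomorphic_intros)
  then obtain a where a: "\<And>k. k < m \<Longrightarrow> a k holomorphic_on ball 0 1"
    "\<And>z. norm z < 1 \<Longrightarrow> poly q z ^ (m - 1) * h z = (\<Sum>k<m. a k (fb z) * z ^ k)"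
    by (rule decomposition) blast
  have "\<exists>T. \<forall>\<zeta>. smult (poly (N w) \<zeta>) (monom 1 k) = comb w \<zeta> (\<lambda>j. poly (T j) \<zeta>)" if "k < m" for k
    using N_conductor[of w k] w that m_le by (metis less_Suc_eq_le order_less_le_trans)
  then obtain T where T: "\<And>k \<zeta>. k < m \<Longrightarrow>
      smult (poly (N w) \<zeta>) (monom 1 k) = comb w \<zeta> (\<lambda>j. poly (T k j) \<zeta>)" by metis
  show ?thesis
  proof (rule fmodI[of _ "\<lambda>j \<zeta>. \<Sum>k<m. a k \<zeta> * poly (T k j) \<zeta>"])
    show "(\<lambda>z. poly (N w) (fb z) * h z) \<in> holo_disk"
      using h holomorphic_fb by (auto simp: holo_disk_def intro!: holomorphic_intros holomorphic_comp_fb)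
    show "(\<lambda>\<zeta>. \<Sum>k<m. a k \<zeta> * poly (T k j) \<zeta>) holomorphic_on ball 0 1" for j
      using a(1) by (intro holomorphic_intros) auto
    fix z :: complex assume z: "norm z < 1"
    have "poly (P (fb z)) z = 0" using z by (simp add: poly_P_fb)
    then have T': "poly (N w) (fb z) * z ^ k = (\<Sum>j<m. poly (T k j) (fb z) * poly (w j) z)" if "k < m" for k
      using arg_cong[OF T[OF that, of "fb z"], of "\<lambda>A. poly A z"] by (simp add: comb_def poly_sum poly_monom)
    have "poly q z ^ (m - 1) * (poly (N w) (fb z) * h z) = (\<Sum>k<m. a k (fb z) * (poly (N w) (fb z) * z ^ k))"
      using a(2)[OF z] by (simp add: mult.left_commute sum_distrib_left)
    also have "\<dots> = (\<Sum>k<m. \<Sum>j<m. a k (fb z) * poly (T k j) (fb z) * poly (w j) z)"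
      by (intro sum.cong refl) (simp add: T' sum_distrib_left mult.assoc)
    also have "\<dots> = (\<Sum>j<m. (\<Sum>k<m. a k (fb z) * poly (T k j) (fb z)) * poly (w j) z)"
      unfolding sum_distrib_right by (rule sum.swap)
    finally show "poly q z ^ (m - 1) * (poly (N w) (fb z) * h z)
      = (\<Sum>j<m. (\<Sum>k<m. a k (fb z) * poly (T k j) (fb z)) * poly (w j) z)" .
  qed
qed

text \<open>Here N(f) is a unit of the disk, so the conductor property can be applied to h /
  N(f).\<close>

lemma fmod_full:
  assumes w: "\<And>j. j < m \<Longrightarrow> degree (w j) \<le> L"
    and N: "\<And>\<zeta>. norm \<zeta> < 1 \<Longrightarrow> poly (N w) \<zeta> \<noteq> 0"
  shows "fmod w = holo_disk"
proof
  show "holo_disk \<subseteq> fmod w"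
  proof
    fix h assume h: "h \<in> holo_disk"
    define k where "k = on_disk (\<lambda>z. h z / poly (N w) (fb z))"
    have "k \<in> holo_disk"
      unfolding k_def using h N norm_fb_less
      by (intro on_disk_in_holo_disk holomorphic_intros holomorphic_comp_fb) (auto simp: holo_disk_def)
    then have "(\<lambda>z. poly (N w) (fb z) * k z) \<in> fmod w" using w by (rule fmod_conductor[rotated])
    moreover have "(\<lambda>z. poly (N w) (fb z) * k z) = h"
      using h N norm_fb_less by (auto simp: fun_eq_iff k_def on_disk_def holo_disk_outside)
    ultimately show "h \<in> fmod w" by simp
  qed
qed (rule fmod_subset)

text \<open>At a zero of N some combination of the generators with constant coefficients x is
  divisible by f - \<zeta>; e is the quotient, freed of the unit q^(m-1). It spans the new module
  over the old one: each coefficient of the new generator is a constant plus a multiple of \<eta> -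
  \<zeta>, and (f - \<zeta>) e is in the old module.\<close>

lemma fmod_step:
  assumes w: "\<And>j. j < m \<Longrightarrow> degree (w j) \<le> L" and N: "N w \<noteq> 0"
    and \<zeta>: "norm \<zeta> < 1" "poly (N w) \<zeta> = 0"
  obtains w' e c where "\<And>j. j < m \<Longrightarrow> degree (w' j) \<le> L" "c \<noteq> 0" "smult c (N w) = [:- \<zeta>, 1:] * N w'"
    "e \<notin> fmod w" "e \<in> fmod w'" "fmod w \<subseteq> fmod w'"
    "\<And>h. h \<in> fmod w' \<Longrightarrow> \<exists>t. h - scale_fun t e \<in> fmod w"
proof -
  obtain x i where x: "comb w \<zeta> x = 0" "i < m" "x i \<noteq> 0" using N_kernel[of w \<zeta>] w \<zeta>(2) by blast
  define s where "s = - (\<Sum>k<M. monom (x (m + k)) k)"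
  note R = N_replace[of w \<zeta> x i, OF w x(1,2), folded s_def]
  let ?w = "w(i := s * p)"
  define e where "e = on_disk (\<lambda>z. poly (s * p) z / poly q z ^ (m - 1))"
  have e: "e \<in> holo_disk"
    unfolding e_def using q_nonzero by (intro on_disk_in_holo_disk holomorphic_intros) auto
  have qe: "poly q z ^ (m - 1) * e z = poly (s * p) z" if "norm z < 1" for z
    using q_nonzero[of z] that by (simp add: e_def)
  have sum: "(\<Sum>j<m. x j * poly (w j) z) = (fb z - \<zeta>) * poly (s * p) z" if "norm z < 1" for z
    using arg_cong[OF R(1), of "\<lambda>A. poly A z"] poly_P_fb[OF that, of \<zeta>] by (simp add: poly_sum)
  have split: "(\<Sum>j<m. F j) = F i + (\<Sum>j\<in>{..<m} - {i}. F j)" for F :: "nat \<Rightarrow> complex"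
    using x(2) by (simp add: sum.remove)
  show ?thesis
  proof (rule that[of ?w "x i" e])
    show "degree (?w j) \<le> L" if "j < m" for j using that w R(2) by simp
    show "smult (x i) (N w) = [:- \<zeta>, 1:] * N ?w" by (rule R(3))
    show "e \<notin> fmod w"
    proof
      assume "e \<in> fmod w"
      then obtain b where b: "\<And>j. j < m \<Longrightarrow> b j holomorphic_on ball 0 1"
        "\<And>z. norm z < 1 \<Longrightarrow> poly q z ^ (m - 1) * e z = (\<Sum>j<m. b j (fb z) * poly (w j) z)" by (rule fmodE) blast
      \<comment> \<open>Comparison with the relation given by x would force x i = (\<eta> - \<zeta>)
        b i for all \<eta>; the factor \<zeta> - \<zeta> is its value at \<eta> = \<zeta>, kept in
        the shape of the uniqueness statement.\<close>
      have "x i - (\<zeta> - \<zeta>) * b i \<zeta> = 0"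
      proof (rule coeff_unique[of w 1 "\<lambda>j \<eta>. x j - (\<eta> - \<zeta>) * b j \<eta>"])
        show "continuous_on (ball 0 1) (\<lambda>\<eta>. x j - (\<eta> - \<zeta>) * b j \<eta>)" if "j < m" for j
          using b(1)[OF that] by (intro continuous_intros holomorphic_on_imp_continuous_on)
        show "(\<Sum>j<m. (x j - (fb z - \<zeta>) * b j (fb z)) * poly (w j) z) = 0" if "norm z < 1" for z
        proof -
          have "(\<Sum>j<m. (x j - (fb z - \<zeta>) * b j (fb z)) * poly (w j) z)
              = (\<Sum>j<m. x j * poly (w j) z) - (fb z - \<zeta>) * (\<Sum>j<m. b j (fb z) * poly (w j) z)"
            by (simp add: left_diff_distrib sum_subtractf sum_distrib_left mult.assoc)
          then show ?thesis using sum[OF that] b(2)[OF that] qe[OF that] by simp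
        qed
      qed (use w N x \<zeta> in auto)
      then show False using x(3) by simp
    qed
    show "e \<in> fmod ?w"
    proof (rule fmodI[of _ "\<lambda>j _. if j = i then 1 else 0"])
      show "poly q z ^ (m - 1) * e z = (\<Sum>j<m. (if j = i then 1 else 0) * poly (?w j) z)" if "norm z < 1" for z
        unfolding split using qe[OF that] by simp
    qed (use e in auto)
    show "fmod w \<subseteq> fmod ?w"
    proof
      fix h assume "h \<in> fmod w"
      then obtain b where b: "h \<in> holo_disk" "\<And>j. j < m \<Longrightarrow> b j holomorphic_on ball 0 1"
        "\<And>z. norm z < 1 \<Longrightarrow> poly q z ^ (m - 1) * h z = (\<Sum>j<m. b j (fb z) * poly (w j) z)" by (rule fmodE) blast
      \<comment> \<open>The generator w i is eliminated by solving the relation that equates (f -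
        \<zeta>) s p with the sum of the x j w j.\<close>
      let ?b = "\<lambda>j \<eta>. if j = i then b i \<eta> * (\<eta> - \<zeta>) / x i else b j \<eta> - b i \<eta> * x j / x i"
      show "h \<in> fmod ?w"
      proof (rule fmodI[of _ ?b])
        show "?b j holomorphic_on ball 0 1" if "j < m" for j
          using b(2)[OF that] b(2)[OF x(2)] x(3) by (cases "j = i") (auto intro!: holomorphic_intros)
        fix z :: complex assume z: "norm z < 1"
        have s: "(fb z - \<zeta>) * poly (s * p) z = x i * poly (w i) z + (\<Sum>j\<in>{..<m} - {i}. x j * poly (w j) z)"
          unfolding sum[OF z, symmetric] by (rule split)
        have "(\<Sum>j<m. ?b j (fb z) * poly (?w j) z)
            = b i (fb z) / x i * ((fb z - \<zeta>) * poly (s * p) z)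
              + (\<Sum>j\<in>{..<m} - {i}. (b j (fb z) - b i (fb z) * x j / x i) * poly (w j) z)"
          unfolding split by (simp add: mult.assoc)
        also have "(\<Sum>j\<in>{..<m} - {i}. (b j (fb z) - b i (fb z) * x j / x i) * poly (w j) z)
            = (\<Sum>j\<in>{..<m} - {i}. b j (fb z) * poly (w j) z)
              - b i (fb z) / x i * (\<Sum>j\<in>{..<m} - {i}. x j * poly (w j) z)"
          by (simp add: left_diff_distrib sum_subtractf sum_distrib_left mult.assoc)
        finally have "(\<Sum>j<m. ?b j (fb z) * poly (?w j) z) = (\<Sum>j<m. b j (fb z) * poly (w j) z)"
          unfolding s split[of "\<lambda>j. b j (fb z) * poly (w j) z"] using x(3) by (simp add: algebra_simps)
        then show "poly q z ^ (m - 1) * h z = (\<Sum>j<m. ?b j (fb z) * poly (?w j) z)"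
          using b(3)[OF z] by simp
      qed (rule b(1))
    qed
    fix h assume "h \<in> fmod ?w"
    then obtain b where b: "h \<in> holo_disk" "\<And>j. j < m \<Longrightarrow> b j holomorphic_on ball 0 1"
      "\<And>z. norm z < 1 \<Longrightarrow> poly q z ^ (m - 1) * h z = (\<Sum>j<m. b j (fb z) * poly (?w j) z)" by (rule fmodE) blast
    define d where "d \<eta> = (if \<eta> = \<zeta> then deriv (b i) \<zeta> else (b i \<eta> - b i \<zeta>) / (\<eta> - \<zeta>))" for \<eta>
    have d: "d holomorphic_on ball 0 1"
      unfolding d_def by (rule pole_lemma_open[OF b(2)[OF x(2)]]) simp
    have bd: "b i \<eta> = b i \<zeta> + (\<eta> - \<zeta>) * d \<eta>" for \<eta> by (simp add: d_def)
    let ?b = "\<lambda>j \<eta>. d \<eta> * x j + (if j = i then 0 else b j \<eta>)"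
    have "h - scale_fun (b i \<zeta>) e \<in> fmod w"
    proof (rule fmodI[of _ ?b])
      show "h - scale_fun (b i \<zeta>) e \<in> holo_disk"
        using b(1) e by (intro holo.subspace_diff holo.subspace_scale subspace_holo_disk)
      show "?b j holomorphic_on ball 0 1" if "j < m" for j
        using b(2)[OF that] d by (cases "j = i") (auto intro!: holomorphic_intros)
      fix z :: complex assume z: "norm z < 1"
      have "poly q z ^ (m - 1) * (h - scale_fun (b i \<zeta>) e) z
          = poly q z ^ (m - 1) * h z - b i \<zeta> * (poly q z ^ (m - 1) * e z)"
        by (simp add: scale_fun_def algebra_simps)
      also have "\<dots> = (\<Sum>j\<in>{..<m} - {i}. b j (fb z) * poly (w j) z) + d (fb z) * ((fb z - \<zeta>) * poly (s * p) z)"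
        unfolding b(3)[OF z] qe[OF z] split bd[of "fb z"] by (simp add: algebra_simps)
      also have "\<dots> = (\<Sum>j<m. ?b j (fb z) * poly (w j) z)"
        unfolding sum[OF z, symmetric] split by (simp add: algebra_simps sum.distrib sum_distrib_left)
      finally show "poly q z ^ (m - 1) * (h - scale_fun (b i \<zeta>) e) z = (\<Sum>j<m. ?b j (fb z) * poly (w j) z)" .
    qed
    then show "\<exists>t. h - scale_fun t e \<in> fmod w" by blast
  qed (rule x(3))
qed

text \<open>Induction on the number of zeros in the disk: every step adds one vector, and with no
  zeros the module is the whole space.\<close>

lemma fmod_complement:
  assumes "\<And>j. j < m \<Longrightarrow> degree (w j) \<le> L" "N w \<noteq> 0"
  shows "\<exists>E. finite E \<and> E \<subseteq> holo_disk \<and> card E = size (disk_roots (N w))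
    \<and> (\<forall>u. (\<Sum>b\<in>E. scale_fun (u b) b) \<in> fmod w \<longrightarrow> (\<forall>b\<in>E. u b = 0))
    \<and> (\<forall>v\<in>holo_disk. \<exists>y\<in>fmod w. \<exists>x\<in>holo.span E. v = y + x)"
  using assms
proof (induction "size (disk_roots (N w))" arbitrary: w)
  case 0
  then have "set_mset (disk_roots (N w)) = {}" by simp
  then have "poly (N w) \<zeta> \<noteq> 0" if "norm \<zeta> < 1" for \<zeta>
    using 0(3) that by (auto simp: disk_roots_def)
  then have "fmod w = holo_disk" using fmod_full 0(2) by blast
  then show ?case using 0(1)[symmetric] by (intro exI[of _ "{}"]) auto
next
  case (Suc K)
  then have "disk_roots (N w) \<noteq> {#}" by auto
  then obtain \<zeta> where "\<zeta> \<in># disk_roots (N w)" by blast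
  then have \<zeta>: "norm \<zeta> < 1" "poly (N w) \<zeta> = 0" using Suc.prems(2) by (auto simp: disk_roots_def)
  obtain w' e c where w': "\<And>j. j < m \<Longrightarrow> degree (w' j) \<le> L" "c \<noteq> 0" "smult c (N w) = [:- \<zeta>, 1:] * N w'"
    "e \<notin> fmod w" "e \<in> fmod w'" "fmod w \<subseteq> fmod w'"
    "\<And>h. h \<in> fmod w' \<Longrightarrow> \<exists>t. h - scale_fun t e \<in> fmod w"
    by (rule fmod_step[OF Suc.prems \<zeta>]) blast+
  note pr = proots_linear_mult[OF w'(2,3) Suc.prems(2)]
  have K: "size (disk_roots (N w)) = Suc (size (disk_roots (N w')))"
    using \<zeta>(1) by (simp add: disk_roots_def pr(2))
  obtain E where E: "finite E" "E \<subseteq> holo_disk" "card E = size (disk_roots (N w'))"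
    "\<And>u. (\<Sum>b\<in>E. scale_fun (u b) b) \<in> fmod w' \<Longrightarrow> \<forall>b\<in>E. u b = 0"
    "\<And>v. v \<in> holo_disk \<Longrightarrow> \<exists>y\<in>fmod w'. \<exists>x\<in>holo.span E. v = y + x"
    using Suc.hyps(1)[of w'] Suc.hyps(2) K w'(1) pr(1) by auto
  have eE: "e \<notin> E"
  proof
    assume "e \<in> E"
    then have "(\<Sum>b\<in>E. scale_fun (if b = e then 1 else 0) b) = e"
      using E(1) by (subst sum.remove[of _ e]) (auto intro!: sum.neutral)
    then show False using E(4)[of "\<lambda>b. if b = e then 1 else 0"] w'(5) \<open>e \<in> E\<close> by auto
  qed
  show ?case
  proof (intro exI[of _ "insert e E"] conjI allI impI ballI)
    show "finite (insert e E)" "card (insert e E) = size (disk_roots (N w))"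
      using E eE K by auto
    show "insert e E \<subseteq> holo_disk" using E(2) w'(5) fmod_subset by auto
  next
    fix u b assume u: "(\<Sum>b\<in>insert e E. scale_fun (u b) b) \<in> fmod w" and b: "b \<in> insert e E"
    have s: "(\<Sum>b\<in>insert e E. scale_fun (u b) b) = scale_fun (u e) e + (\<Sum>b\<in>E. scale_fun (u b) b)"
      using E(1) eE by simp
    have "scale_fun (u e) e + (\<Sum>b\<in>E. scale_fun (u b) b) - scale_fun (u e) e \<in> fmod w'"
      using u w'(5,6) unfolding s by (intro holo.subspace_diff holo.subspace_scale subspace_fmod) auto
    then have E0: "\<forall>b\<in>E. u b = 0" using E(4)[of u] by simp
    then have "(\<Sum>b\<in>E. scale_fun (u b) b) = 0" by (intro sum.neutral) auto
    then have ue: "scale_fun (u e) e \<in> fmod w" using u unfolding s by simp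
    have "u e = 0"
    proof (rule ccontr)
      assume "u e \<noteq> 0"
      then have "scale_fun (inverse (u e)) (scale_fun (u e) e) = e" by simp
      then show False using holo.subspace_scale[OF subspace_fmod ue, of "inverse (u e)"] w'(4) by simp
    qed
    then show "u b = 0" using E0 b by auto
  next
    fix v assume "v \<in> holo_disk"
    then obtain y x where yx: "y \<in> fmod w'" "x \<in> holo.span E" "v = y + x" using E(5) by blast
    obtain t where t: "y - scale_fun t e \<in> fmod w" using w'(7)[OF yx(1)] by blast
    have "scale_fun t e + x \<in> holo.span (insert e E)"
      using subsetD[OF holo.span_mono[of E "insert e E"] yx(2)]
      by (intro holo.span_add holo.span_scale[OF holo.span_base]) auto
    moreover have "v = (y - scale_fun t e) + (scale_fun t e + x)" using yx(3) by simp
    ultimately show "\<exists>y\<in>fmod w. \<exists>x\<in>holo.span (insert e E). v = y + x" using t by blast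
  qed
qed

lemma codim_fmod:
  assumes "\<And>j. j < m \<Longrightarrow> degree (w j) \<le> L" "N w \<noteq> 0"
  shows "holo.codim holo_disk (fmod w) = enat (size (disk_roots (N w)))"
proof -
  obtain E where E: "finite E" "E \<subseteq> holo_disk" "card E = size (disk_roots (N w))"
    "\<And>u. (\<Sum>b\<in>E. scale_fun (u b) b) \<in> fmod w \<Longrightarrow> \<forall>b\<in>E. u b = 0"
    "\<And>v. v \<in> holo_disk \<Longrightarrow> \<exists>y\<in>fmod w. \<exists>x\<in>holo.span E. v = y + x"
    using fmod_complement[OF assms] by auto
  show ?thesis
    unfolding E(3)[symmetric]
    by (rule holo.codim_eqI[OF subspace_fmod subspace_holo_disk fmod_subset E(1,2,4,5)])
qed

end

section \<open>Closedness of subspaces containing a principal ideal\<close>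

lemma bound_by_circle:
  assumes "k holomorphic_on ball 0 1" "0 < \<rho>" "\<rho> < 1" "\<And>z. norm z = \<rho> \<Longrightarrow> norm (k z) \<le> B" "norm z \<le> \<rho>"
  shows "norm (k z) \<le> B"
proof (rule maximum_modulus_frontier[of k "cball 0 \<rho>"])
  show "k holomorphic_on interior (cball 0 \<rho>)"
    using assms(3) by (intro holomorphic_on_subset[OF assms(1)]) auto
  show "continuous_on (closure (cball 0 \<rho>)) k"
    using assms(3) by (intro continuous_on_subset[OF holomorphic_on_imp_continuous_on[OF assms(1)]]) auto
qed (use assms in auto)

text \<open>Division with remainder by the product of the X - a, with one bound for both the
  quotient on |z| \<le> \<rho> and the coefficients of the remainder. Roots with |a| \<ge> 1 are
  included, so that the divisor is a given polynomial up to its leading coefficient.\<close>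

definition bounded_division :: "complex multiset \<Rightarrow> real \<Rightarrow> real \<Rightarrow> (complex \<Rightarrow> complex) \<Rightarrow> bool" where
  "bounded_division A \<rho> B h \<longleftrightarrow> (\<exists>k r. k holomorphic_on ball 0 1 \<and> degree r \<le> size A \<and>
     (\<forall>i. norm (coeff r i) \<le> B) \<and>
     (\<forall>z. norm z < 1 \<longrightarrow> h z = poly (\<Prod>a\<in>#A. [:- a, 1:]) z * k z + poly r z) \<and>
     (\<forall>z. norm z \<le> \<rho> \<longrightarrow> norm (k z) \<le> B))"

text \<open>Induction over the roots. For |a| < 1 the quotient is replaced by its difference
  quotient at a, estimated on |z| = \<rho> and extended inwards by the maximum principle; its value
  at a goes into the remainder. For |a| \<ge> 1 the factor z - a is a unit of the disk and the
  remainder is unchanged.\<close>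

lemma bounded_division_exists:
  fixes A :: "complex multiset"
  assumes \<rho>: "0 < \<rho>" "\<rho> < 1" "\<forall>a\<in>#A. norm a < 1 \<longrightarrow> norm a < \<rho>"
  shows "\<exists>C\<ge>0. \<forall>h B. h holomorphic_on ball 0 1 \<longrightarrow> (\<forall>z. norm z \<le> \<rho> \<longrightarrow> norm (h z) \<le> B) \<longrightarrow>
    bounded_division A \<rho> (C * B) h"
  using \<rho>(3)
proof (induction A)
  case empty
  show ?case
  proof (intro exI[of _ "1::real"] conjI allI impI)
    fix h :: "complex \<Rightarrow> complex" and B
    assume "h holomorphic_on ball 0 1" and B: "\<forall>z. norm z \<le> \<rho> \<longrightarrow> norm (h z) \<le> B"
    moreover have "0 \<le> B" using B[rule_format, of 0] \<rho> by (smt (verit) norm_ge_zero norm_zero)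
    ultimately show "bounded_division {#} \<rho> (1 * B) h"
      unfolding bounded_division_def by (intro exI[of _ h] exI[of _ 0]) auto
  qed simp
next
  case (add a A)
  let ?Q = "\<Prod>a\<in>#A. [:- a, 1:]"
  obtain C where C: "C \<ge> 0" "\<And>h B. h holomorphic_on ball 0 1 \<Longrightarrow> (\<And>z. norm z \<le> \<rho> \<Longrightarrow> norm (h z) \<le> B) \<Longrightarrow>
    bounded_division A \<rho> (C * B) h" using add by fastforce
  have degQ: "degree ?Q \<le> size A"
  proof (induction A)
    case (add x A)
    then show ?case using degree_mult_le[of "[:- x, 1:]" "\<Prod>a\<in>#A. [:- a, 1:]"] by simp
  qed simp
  show ?case
  proof (cases "norm a < 1")
    case True
    then have a: "norm a < \<rho>" using add.prems by auto
    define Cq where "Cq = Max ((\<lambda>i. norm (coeff ?Q i)) ` {..degree ?Q})"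
    have Cq: "norm (coeff ?Q i) \<le> max 0 Cq" for i
      unfolding Cq_def by (cases "i \<le> degree ?Q") (auto simp: coeff_eq_0 le_max_iff_disj intro!: disjI2 Max_ge)
    \<comment> \<open>The first two summands bound the new remainder; the last one bounds the
      difference quotient, whose numerator is at most 2 C B and whose denominator is at least \<rho>
      - |a| on the circle.\<close>
    define C' where "C' = C + C * max 0 Cq + 2 * C / (\<rho> - norm a)"
    have C': "C' \<ge> 0" "C + C * max 0 Cq \<le> C'" "2 * C / (\<rho> - norm a) \<le> C'"
      using C(1) a by (auto simp: C'_def)
    show ?thesis
    proof (intro exI[of _ C'] conjI allI impI C'(1))
      fix h :: "complex \<Rightarrow> complex" and B
      assume h: "h holomorphic_on ball 0 1" "\<forall>z. norm z \<le> \<rho> \<longrightarrow> norm (h z) \<le> B"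
      have B: "0 \<le> B" using h(2)[rule_format, of 0] \<rho> by (smt (verit) norm_ge_zero norm_zero)
      obtain k r where kr: "k holomorphic_on ball 0 1" "degree r \<le> size A" "\<And>i. norm (coeff r i) \<le> C * B"
        "\<And>z. norm z < 1 \<Longrightarrow> h z = poly ?Q z * k z + poly r z"
        "\<And>z. norm z \<le> \<rho> \<Longrightarrow> norm (k z) \<le> C * B" using C(2)[of h B] h unfolding bounded_division_def by blast
      define k' where "k' z = (if z = a then deriv k a else (k z - k a) / (z - a))" for z
      define r' where "r' = r + smult (k a) ?Q"
      have k': "k' holomorphic_on ball 0 1" unfolding k'_def by (rule pole_lemma_open[OF kr(1)]) simp
      have kk': "k z = k a + (z - a) * k' z" for z by (simp add: k'_def)
      have "norm (k' z) \<le> 2 * C / (\<rho> - norm a) * B" if "norm z \<le> \<rho>" for z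
      proof (rule bound_by_circle[OF k' \<rho>(1,2) _ that])
        fix z :: complex assume z: "norm z = \<rho>"
        have "norm (k z - k a) \<le> C * B + C * B"
          using norm_triangle_ineq4[of "k z" "k a"] kr(5)[of z] kr(5)[of a] z a by linarith
        moreover have "norm (z - a) \<ge> \<rho> - norm a" using norm_triangle_ineq2[of z a] z by simp
        ultimately have "norm (k z - k a) / norm (z - a) \<le> (C * B + C * B) / (\<rho> - norm a)"
          using a C(1) B by (intro frac_le) auto
        moreover have "z \<noteq> a" using z a by auto
        ultimately show "norm (k' z) \<le> 2 * C / (\<rho> - norm a) * B"
          by (simp add: k'_def norm_divide algebra_simps)
      qed
      then have k'B: "norm (k' z) \<le> C' * B" if "norm z \<le> \<rho>" for z
        using that C'(3) B mult_right_mono order_trans by blast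
      have "norm (coeff r' i) \<le> C' * B" for i
      proof -
        have "norm (coeff r' i) \<le> C * B + C * B * max 0 Cq"
          unfolding r'_def coeff_add coeff_smult
          using kr(3)[of i] kr(5)[of a] a Cq[of i] C(1) B
          by (intro order_trans[OF norm_triangle_ineq] add_mono) (auto simp: norm_mult intro!: mult_mono)
        also have "\<dots> = (C + C * max 0 Cq) * B" by (simp add: algebra_simps)
        also have "\<dots> \<le> C' * B" using C'(2) B by (rule mult_right_mono)
        finally show ?thesis .
      qed
      moreover have "degree r' \<le> size (add_mset a A)"
        unfolding r'_def using kr(2) degQ by (intro degree_add_le order_trans[OF degree_smult_le]) auto
      moreover have "h z = poly (\<Prod>a\<in>#add_mset a A. [:- a, 1:]) z * k' z + poly r' z" if "norm z < 1" for z
        using kr(4)[OF that] kk'[of z] by (simp add: r'_def algebra_simps)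
      ultimately show "bounded_division (add_mset a A) \<rho> (C' * B) h"
        unfolding bounded_division_def using k' k'B by blast
    qed
  next
    case False
    define C' where "C' = C + C / (1 - \<rho>)"
    have C': "C' \<ge> 0" "C \<le> C'" "C / (1 - \<rho>) \<le> C'" using C(1) \<rho> by (auto simp: C'_def)
    show ?thesis
    proof (intro exI[of _ C'] conjI allI impI C'(1))
      fix h :: "complex \<Rightarrow> complex" and B
      assume h: "h holomorphic_on ball 0 1" "\<forall>z. norm z \<le> \<rho> \<longrightarrow> norm (h z) \<le> B"
      have B: "0 \<le> B" using h(2)[rule_format, of 0] \<rho> by (smt (verit) norm_ge_zero norm_zero)
      obtain k r where kr: "k holomorphic_on ball 0 1" "degree r \<le> size A" "\<And>i. norm (coeff r i) \<le> C * B"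
        "\<And>z. norm z < 1 \<Longrightarrow> h z = poly ?Q z * k z + poly r z"
        "\<And>z. norm z \<le> \<rho> \<Longrightarrow> norm (k z) \<le> C * B" using C(2)[of h B] h unfolding bounded_division_def by blast
      have "(\<lambda>z. k z / (z - a)) holomorphic_on ball 0 1"
        using False by (intro holomorphic_intros kr(1)) auto
      moreover have "norm (k z / (z - a)) \<le> C' * B" if "norm z \<le> \<rho>" for z
      proof -
        have "norm (z - a) \<ge> 1 - \<rho>" using norm_triangle_ineq2[of a z] False that by (simp add: norm_minus_commute)
        then have "norm (k z / (z - a)) \<le> C * B / (1 - \<rho>)"
          unfolding norm_divide using kr(5)[OF that] \<rho> C(1) B by (intro frac_le) auto
        also have "\<dots> = C / (1 - \<rho>) * B" by simp
        also have "\<dots> \<le> C' * B" using C'(3) B by (rule mult_right_mono)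
        finally show ?thesis .
      qed
      moreover have "norm (coeff r i) \<le> C' * B" for i
        using kr(3)[of i] mult_right_mono[OF C'(2) B] by linarith
      moreover have "h z = poly (\<Prod>a\<in>#add_mset a A. [:- a, 1:]) z * (k z / (z - a)) + poly r z" if "norm z < 1" for z
      proof -
        have "z \<noteq> a" using that False by auto
        then have kz: "(z - a) * (k z / (z - a)) = k z" by simp
        have "poly (\<Prod>a\<in>#add_mset a A. [:- a, 1:]) z * (k z / (z - a))
            = poly ?Q z * ((z - a) * (k z / (z - a)))"
          by (simp only: image_mset_add_mset prod_mset.add_mset poly_mult) (simp add: mult_ac)
        then show ?thesis unfolding kz using kr(4)[OF that] by simp
      qed
      moreover have "degree r \<le> size (add_mset a A)" using kr(2) by simp
      ultimately show "bounded_division (add_mset a A) \<rho> (C' * B) h"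
        unfolding bounded_division_def by blast
    qed
  qed
qed

interpretation holo_functional: vector_space_pair scale_fun "(*) :: complex \<Rightarrow> complex \<Rightarrow> complex"
  by (intro vector_space_pair.intro holo.vector_space_axioms) (unfold_locales, auto simp: algebra_simps)

text \<open>A linear functional that annihilates \<open>S\<close> factors through the remainder of the division by \<open>Q\<close>, so it is
  continuous.\<close>

lemma subspace_closed_if_multiples:
  assumes S: "holo.subspace S" "S \<subseteq> holo_disk" and Q: "Q \<noteq> 0"
    and mult: "\<And>k. k \<in> holo_disk \<Longrightarrow> (\<lambda>z. poly Q z * k z) \<in> S"
    and h: "h \<in> holo_disk"
    and lim: "\<And>K \<epsilon>. compact K \<Longrightarrow> K \<subseteq> ball 0 1 \<Longrightarrow> \<epsilon> > 0 \<Longrightarrow> \<exists>g\<in>S. \<forall>z\<in>K. norm (h z - g z) < \<epsilon>"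
  shows "h \<in> S"
proof (rule ccontr)
  assume "h \<notin> S"
  obtain X where X: "X \<subseteq> S" "holo.independent X" "S \<subseteq> holo.span X"
    using holo.maximal_independent_subset by blast
  have spX: "holo.span X = S" using X(1,3) S(1) holo.span_minimal by blast
  then have "holo.independent (insert h X)" using X(2) \<open>h \<notin> S\<close> holo.independent_insert by auto
  \<comment> \<open>A purely algebraic functional, 0 on S and 1 at h, obtained by extending a basis
    of S.\<close>
  then obtain l where l: "Vector_Spaces.linear scale_fun (*) l"
    "\<And>x. x \<in> insert h X \<Longrightarrow> l x = (if x = h then 1 else 0 :: complex)"
    using holo_functional.linear_independent_extend[of "insert h X" "\<lambda>x. if x = h then 1 else 0"] by metis
  have hX: "h \<notin> X" using \<open>h \<notin> S\<close> X(1) by auto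
  have lS: "l g = 0" if "g \<in> S" for g
  proof (rule holo_functional.linear_eq_0_on_span[OF l(1), of X g])
    show "l x = 0" if "x \<in> X" for x using l(2)[of x] that hX by auto
  qed (use that spX in auto)
  have lh: "l h = 1" using l(2) by simp
  let ?A = "proots Q"
  define \<rho> where "\<rho> = Max (insert (1/2) ((\<lambda>a. (norm a + 1) / 2) ` {a \<in> set_mset ?A. norm a < 1}))"
  have fin: "finite ((\<lambda>a. (norm a + 1) / 2) ` {a \<in> set_mset ?A. norm a < 1})" by simp
  have \<rho>: "0 < \<rho>" "\<rho> < 1" "\<forall>a\<in>#?A. norm a < 1 \<longrightarrow> norm a < \<rho>"
  proof -
    show "0 < \<rho>" using Max_ge[of "insert (1/2) ((\<lambda>a. (norm a + 1) / 2) ` {a \<in> set_mset ?A. norm a < 1})" "1/2"] fin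
      by (simp add: \<rho>_def)
    show "\<rho> < 1" using fin by (auto simp: \<rho>_def)
    show "\<forall>a\<in>#?A. norm a < 1 \<longrightarrow> norm a < \<rho>"
    proof (intro ballI impI)
      fix a assume a: "a \<in># ?A" "norm a < 1"
      have "norm a < (norm a + 1) / 2" using a(2) by simp
      also have "\<dots> \<le> \<rho>" unfolding \<rho>_def using fin a by (intro Max_ge) auto
      finally show "norm a < \<rho>" .
    qed
  qed
  obtain C where C: "C \<ge> 0" "\<And>h B. h holomorphic_on ball 0 1 \<Longrightarrow> (\<And>z. norm z \<le> \<rho> \<Longrightarrow> norm (h z) \<le> B) \<Longrightarrow>
    bounded_division ?A \<rho> (C * B) h" using bounded_division_exists[OF \<rho>] by fastforce
  let ?e = "\<lambda>i. on_disk (\<lambda>z. z ^ i)"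
  define V where "V = (\<Sum>i\<le>size ?A. norm (l (?e i)))"
  \<comment> \<open>Small enough that l maps the remainder of h - g to a number of modulus at most
    1/2, although l (h - g) = 1 and the multiple of Q contributes 0.\<close>
  define \<epsilon> where "\<epsilon> = 1 / (2 * (C + 1) * (V + 1))"
  have V: "V \<ge> 0" by (simp add: V_def sum_nonneg)
  have \<epsilon>: "\<epsilon> > 0" using C(1) V by (simp add: \<epsilon>_def)
  have "cball 0 \<rho> \<subseteq> ball (0::complex) 1" using \<rho>(2) by auto
  then have "\<exists>g\<in>S. \<forall>z\<in>cball 0 \<rho>. norm (h z - g z) < \<epsilon>" using \<epsilon> by (intro lim) auto
  then obtain g where g: "g \<in> S" "\<And>z. norm z \<le> \<rho> \<Longrightarrow> norm (h z - g z) < \<epsilon>" by auto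
  have hg: "h - g \<in> holo_disk" using h g(1) S(2) by (intro holo.subspace_diff subspace_holo_disk) auto
  obtain k r where kr: "k holomorphic_on ball 0 1" "degree r \<le> size ?A" "\<And>i. norm (coeff r i) \<le> C * \<epsilon>"
    "\<And>z. norm z < 1 \<Longrightarrow> (h - g) z = poly (\<Prod>a\<in>#?A. [:- a, 1:]) z * k z + poly r z"
    using C(2)[of "h - g" \<epsilon>] holo_disk_holomorphic[OF hg] g(2) unfolding bounded_division_def
    by (force intro: less_imp_le)
  define k' where "k' = on_disk (\<lambda>z. k z / lead_coeff Q)"
  have "k' \<in> holo_disk" unfolding k'_def using kr(1) Q
    by (intro on_disk_in_holo_disk holomorphic_intros) auto
  then have Qk: "(\<lambda>z. poly Q z * k' z) \<in> S" by (rule mult)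
  have "poly Q z = lead_coeff Q * poly (\<Prod>a\<in>#?A. [:- a, 1:]) z" for z
    using arg_cong[OF complex_poly_decompose_multiset[of Q], of "\<lambda>A. poly A z"] by simp
  then have "h - g = (\<lambda>z. poly Q z * k' z) + on_disk (poly r)"
    using kr(4) holo_disk_outside[OF hg] Q by (auto simp: fun_eq_iff on_disk_def k'_def)
  also have "on_disk (poly r) = (\<Sum>i\<le>size ?A. scale_fun (coeff r i) (?e i))"
  proof
    fix z
    have "poly r z = (\<Sum>i\<le>size ?A. coeff r i * z ^ i)"
      unfolding poly_altdef using kr(2) by (intro sum.mono_neutral_left) (auto simp: coeff_eq_0)
    moreover have "(\<Sum>i\<in>I. scale_fun (coeff r i) (?e i)) z = (\<Sum>i\<in>I. coeff r i * ?e i z)" if "finite I" for I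
      using that by (induction I) (auto simp: scale_fun_def)
    ultimately show "on_disk (poly r) z = (\<Sum>i\<le>size ?A. scale_fun (coeff r i) (?e i)) z"
      by (cases "norm z < 1") simp_all
  qed
  finally have "l (h - g) = l (\<lambda>z. poly Q z * k' z) + (\<Sum>i\<le>size ?A. coeff r i * l (?e i))"
    by (simp only: holo_functional.linear_add[OF l(1)] holo_functional.linear_sum[OF l(1)]
        holo_functional.linear_scale[OF l(1)])
  then have e1: "(\<Sum>i\<le>size ?A. coeff r i * l (?e i)) = 1"
    using lS[OF g(1)] lS[OF Qk] lh by (simp only: holo_functional.linear_diff[OF l(1)]) simp
  have "1 \<le> (\<Sum>i\<le>size ?A. norm (coeff r i * l (?e i)))"
    using norm_sum[of "\<lambda>i. coeff r i * l (?e i)" "{..size ?A}"] unfolding e1 by simp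
  also have "\<dots> \<le> (\<Sum>i\<le>size ?A. C * \<epsilon> * norm (l (?e i)))"
    unfolding norm_mult using kr(3) by (intro sum_mono mult_right_mono) auto
  also have "\<dots> = C * \<epsilon> * V" by (simp add: V_def sum_distrib_left)
  also have "\<dots> \<le> (C + 1) * \<epsilon> * (V + 1)" using C(1) V \<epsilon> by (intro mult_mono) auto
  also have "\<dots> = 1 / 2" using C(1) V by (simp add: \<epsilon>_def)
  finally show False by simp
qed

section \<open>The closed algebra as a submodule\<close>

lemma holomorphic_coeff_mult:
  assumes "\<And>i. (\<lambda>\<zeta>. coeff (F \<zeta>) i) holomorphic_on S" "\<And>i. (\<lambda>\<zeta>. coeff (G \<zeta>) i) holomorphic_on S"
  shows "(\<lambda>\<zeta>. coeff (F \<zeta> * G \<zeta>) i) holomorphic_on S"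
  unfolding coeff_mult by (intro holomorphic_intros assms)

lemma holomorphic_coeff_prod:
  assumes "finite I" "\<And>x i. x \<in> I \<Longrightarrow> (\<lambda>\<zeta>. coeff (F x \<zeta>) i) holomorphic_on S"
  shows "(\<lambda>\<zeta>. coeff (\<Prod>x\<in>I. F x \<zeta>) i) holomorphic_on S"
  using assms
proof (induction I arbitrary: i rule: finite_induct)
  case (insert x I)
  have "(\<lambda>\<zeta>. coeff (F x \<zeta> * (\<Prod>x\<in>I. F x \<zeta>)) i) holomorphic_on S"
    using insert by (intro holomorphic_coeff_mult) auto
  then show ?case using insert by simp
qed simp

text \<open>By the Leibniz expansion the coefficients are polynomials in the entries.\<close>

lemma holomorphic_coeff_char_poly:
  assumes "\<And>k l. k < m \<Longrightarrow> l < m \<Longrightarrow> A k l holomorphic_on S"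
  shows "(\<lambda>\<zeta>. coeff (char_poly (mat m m (\<lambda>(k, l). A k l \<zeta>))) i) holomorphic_on S"
proof -
  let ?C = "\<lambda>\<zeta>. char_poly_matrix (mat m m (\<lambda>(k, l). A k l \<zeta>))"
  have entry: "(\<lambda>\<zeta>. coeff (?C \<zeta> $$ (k, l)) i) holomorphic_on S" if "k < m" "l < m" for k l i
  proof -
    have "coeff (?C \<zeta> $$ (k, l)) i = coeff (if k = l then [:0, 1:] else 0) i - (if i = 0 then A k l \<zeta> else 0)" for \<zeta>
      using that by (simp add: char_poly_matrix_def coeff_pCons split: nat.split)
    then show ?thesis using assms[OF that] by (cases "i = 0") (auto intro!: holomorphic_intros)
  qed
  have C: "?C \<zeta> \<in> carrier_mat m m" for \<zeta> by simp
  have "(\<lambda>\<zeta>. coeff (signof \<sigma> * (\<Prod>k = 0..<m. ?C \<zeta> $$ (k, \<sigma> k))) i) holomorphic_on S"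
    if "\<sigma> permutes {0..<m}" for \<sigma>
    using permutes_in_image[OF that] by (intro holomorphic_coeff_mult holomorphic_coeff_prod entry) auto
  then show ?thesis
    unfolding char_poly_def det_def'[OF C] coeff_sum by (intro holomorphic_intros) auto
qed

text \<open>Taylor polynomials at 0 converge uniformly on a closed disk of radius less than 1 that
  contains K.\<close>

lemma polynomial_approximation:
  assumes b: "b holomorphic_on ball 0 1" and K: "compact K" "K \<subseteq> ball 0 1" and "\<epsilon> > 0"
  shows "\<exists>A :: complex poly. \<forall>x\<in>K. norm (b x - poly A x) < \<epsilon>"
proof -
  obtain r where r: "r < 1" "K \<subseteq> cball 0 r"
  proof (cases "K = {}")
    case False
    then obtain z where "z \<in> K" "\<And>y. y \<in> K \<Longrightarrow> norm y \<le> norm z"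
      using continuous_attains_sup[OF K(1) False, of norm] continuous_on_norm_id by blast
    then show ?thesis using K(2) by (intro that[of "norm z"]) auto
  qed (use that[of 0] in auto)
  define a where "a n = (deriv ^^ n) b 0 / fact n" for n
  have s: "(\<lambda>n. a n * w ^ n) sums b w" if "norm w < 1" for w
    using holomorphic_power_series[OF b, of w] that by (simp add: a_def)
  have "conv_radius a \<ge> 1"
  proof (rule conv_radius_geI_ex')
    fix r :: real assume "0 < r" "ereal r < 1"
    then have "norm (of_real r :: complex) < 1" by simp
    from sums_summable[OF s[OF this]] show "summable (\<lambda>n. a n * of_real r ^ n)" .
  qed
  then have "ereal r < conv_radius a" using r(1) by (metis ereal_less(3) order_less_le_trans one_ereal_def)
  from powser_uniform_limit[OF this, of 0]
  have "\<forall>\<^sub>F n in sequentially. \<forall>x\<in>cball 0 r. dist (\<Sum>i<n. a i * x ^ i) (suminf (\<lambda>i. a i * x ^ i)) < \<epsilon>"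
    using \<open>\<epsilon> > 0\<close> by (simp add: uniform_limit_iff)
  then obtain n where n: "\<forall>x\<in>cball 0 r. dist (\<Sum>i<n. a i * x ^ i) (suminf (\<lambda>i. a i * x ^ i)) < \<epsilon>"
    unfolding eventually_sequentially by blast
  have "norm (b x - poly (\<Sum>i<n. monom (a i) i) x) < \<epsilon>" if "x \<in> K" for x
  proof -
    have "suminf (\<lambda>i. a i * x ^ i) = b x" using s[of x] that r by (intro sums_unique[symmetric]) auto
    then show ?thesis using bspec[OF n, of x] that r by (simp add: poly_sum poly_monom dist_norm norm_minus_commute subset_iff)
  qed
  then show ?thesis by blast
qed

lemma eval2_power [simp]: "eval2 (A ^ k) z w = eval2 A z w ^ k"
  by (induction k) simp_all

lemma eval2_sum [simp]: "eval2 (\<Sum>x\<in>I. F x) z w = (\<Sum>x\<in>I. eval2 (F x) z w)"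
  by (induction I rule: infinite_finite_induct) simp_all

context blaschke_pair
begin

definition gb :: "complex \<Rightarrow> complex" where "gb z = poly qt z / poly q z"

definition u :: "nat \<Rightarrow> complex poly" where "u j = qt ^ j * q ^ (m - 1 - j)"

lemma degree_u: "j < m \<Longrightarrow> degree (u j) \<le> L"
proof -
  assume j: "j < m"
  have "degree (u j) \<le> n * j + n * (m - 1 - j)"
    unfolding u_def using degree_blaschke_num[OF \<beta>] degree_blaschke_den[OF \<beta>]
    by (intro order_trans[OF degree_mult_le] add_mono order_trans[OF degree_power_le] mult_right_mono) auto
  also have "\<dots> = L" using j by (simp add: L_def flip: distrib_left)
  finally show ?thesis .
qed

lemma poly_u: "norm z \<le> 1 \<Longrightarrow> j < m \<Longrightarrow> poly (u j) z = poly q z ^ (m - 1) * gb z ^ j"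
  using q_nonzero[of z] by (simp add: u_def gb_def power_divide power_diff field_simps flip: power_add)

lemma holomorphic_gb: "gb holomorphic_on ball 0 1"
  unfolding gb_def using q_nonzero by (intro holomorphic_intros) auto

lemma norm_gb_le: "norm z < 1 \<Longrightarrow> norm (gb z) \<le> 1"
proof (cases "n = 0")
  case False
  assume "norm z < 1"
  then show ?thesis
    using norm_blaschke_less[OF \<beta>, of z] q_nonzero[of z] False by (simp add: gb_def norm_divide)
next
  case True
  then show ?thesis unfolding gb_def by simp
qed

text \<open>The vector \<open>(1, z, \<dots>, z\<^sup>m\<^sup>-\<^sup>1)\<close> is an eigenvector, with eigenvalue \<open>g(z)\<close>, of the matrix of multiplication
  by \<open>g\<close> at \<open>f(z)\<close>.\<close>

lemma gb_integral:
  obtains c where "\<And>j. c j holomorphic_on ball 0 1"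
    "\<And>z. norm z < 1 \<Longrightarrow> gb z ^ m = (\<Sum>j<m. c j (fb z) * gb z ^ j)"
proof -
  have "\<exists>a. (\<forall>l<m. a l holomorphic_on ball 0 1) \<and> (\<forall>z. norm z < 1 \<longrightarrow> gb z * z ^ k = (\<Sum>l<m. a l (fb z) * z ^ l))" for k
  proof -
    have "(\<lambda>z. gb z * z ^ k) holomorphic_on ball 0 1" by (intro holomorphic_intros holomorphic_gb)
    then show ?thesis by (rule decomposition) blast
  qed
  then obtain A where A: "\<And>k l. l < m \<Longrightarrow> A k l holomorphic_on ball 0 1"
    "\<And>k z. norm z < 1 \<Longrightarrow> gb z * z ^ k = (\<Sum>l<m. A k l (fb z) * z ^ l)" by metis
  let ?G = "\<lambda>\<zeta>. mat m m (\<lambda>(k, l). A k l \<zeta>)"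
  show ?thesis
  proof (rule that[of "\<lambda>j \<zeta>. - coeff (char_poly (?G \<zeta>)) j"])
    show "(\<lambda>\<zeta>. - coeff (char_poly (?G \<zeta>)) j) holomorphic_on ball 0 1" for j
      using A(1) by (intro holomorphic_intros holomorphic_coeff_char_poly)
    fix z :: complex assume z: "norm z < 1"
    have cm: "?G (fb z) \<in> carrier_mat m m" by simp
    have "eigenvector (?G (fb z)) (vec m (\<lambda>l. z ^ l)) (gb z)"
      unfolding eigenvector_def
    proof (intro conjI)
      have "vec_index (vec m (\<lambda>l. z ^ l)) 0 \<noteq> vec_index (0\<^sub>v (dim_row (?G (fb z)))) 0"
        using m_pos by simp
      then show "vec m (\<lambda>l. z ^ l) \<noteq> 0\<^sub>v (dim_row (?G (fb z)))" by metis
      show "?G (fb z) *\<^sub>v vec m (\<lambda>l. z ^ l) = gb z \<cdot>\<^sub>v vec m (\<lambda>l. z ^ l)"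
        using A(2)[OF z] by (intro eq_vecI) (auto simp: scalar_prod_def lessThan_atLeast0)
    qed simp
    then have "eigenvalue (?G (fb z)) (gb z)" by (auto simp: eigenvalue_def)
    then have "poly (char_poly (?G (fb z))) (gb z) = 0" using eigenvalue_root_char_poly[OF cm] by simp
    then have "(\<Sum>j<Suc m. coeff (char_poly (?G (fb z))) j * gb z ^ j) = 0"
      using degree_monic_char_poly[OF cm] by (simp add: poly_altdef lessThan_Suc_atMost)
    then show "gb z ^ m = (\<Sum>j<m. - coeff (char_poly (?G (fb z))) j * gb z ^ j)"
      using degree_monic_char_poly[OF cm] by (simp add: sum_negf add_eq_0_iff)
  qed
qed

text \<open>Membership in the module of the generators g^j, stated without the factor q^(m-1) and
  without the extension by 0.\<close>

definition gcomb :: "(complex \<Rightarrow> complex) \<Rightarrow> bool" where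
  "gcomb h \<longleftrightarrow> (\<exists>b. (\<forall>j<m. b j holomorphic_on ball 0 1) \<and>
     (\<forall>z. norm z < 1 \<longrightarrow> h z = (\<Sum>j<m. b j (fb z) * gb z ^ j)))"

lemma gcomb_iff: "on_disk h \<in> fmod u \<longleftrightarrow> gcomb h"
proof -
  have eq: "poly q z ^ (m - 1) * on_disk h z = (\<Sum>j<m. b j (fb z) * poly (u j) z)
      \<longleftrightarrow> h z = (\<Sum>j<m. b j (fb z) * gb z ^ j)" if "norm z < 1" for z b
  proof -
    have "(\<Sum>j<m. b j (fb z) * poly (u j) z) = poly q z ^ (m - 1) * (\<Sum>j<m. b j (fb z) * gb z ^ j)"
      using that by (simp add: poly_u sum_distrib_left mult.left_commute)
    then show ?thesis using that q_nonzero[of z] by simp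
  qed
  have "on_disk h \<in> holo_disk" if g: "gcomb h"
  proof -
    obtain b where b: "\<And>j. j < m \<Longrightarrow> b j holomorphic_on ball 0 1"
      "\<And>z. norm z < 1 \<Longrightarrow> h z = (\<Sum>j<m. b j (fb z) * gb z ^ j)" using g unfolding gcomb_def by blast
    have "(\<lambda>z. \<Sum>j<m. b j (fb z) * gb z ^ j) holomorphic_on ball 0 1"
      using b(1) by (intro holomorphic_intros holomorphic_comp_fb holomorphic_gb) auto
    then have "h holomorphic_on ball 0 1" by (rule holomorphic_transform) (simp add: b(2))
    then show ?thesis by (rule on_disk_in_holo_disk)
  qed
  then show ?thesis using eq unfolding fmod_def gcomb_def by auto
qed

lemma gcomb_add:
  assumes "gcomb h" "gcomb h'" shows "gcomb (\<lambda>z. h z + h' z)"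
proof -
  obtain b b' where "\<And>j. j < m \<Longrightarrow> b j holomorphic_on ball 0 1"
    "\<And>z. norm z < 1 \<Longrightarrow> h z = (\<Sum>j<m. b j (fb z) * gb z ^ j)"
    "\<And>j. j < m \<Longrightarrow> b' j holomorphic_on ball 0 1"
    "\<And>z. norm z < 1 \<Longrightarrow> h' z = (\<Sum>j<m. b' j (fb z) * gb z ^ j)" using assms unfolding gcomb_def by blast
  then show ?thesis unfolding gcomb_def
    by (intro exI[of _ "\<lambda>j \<zeta>. b j \<zeta> + b' j \<zeta>"]) (auto simp: algebra_simps sum.distrib intro!: holomorphic_intros)
qed

lemma gcomb_fb:
  assumes "\<phi> holomorphic_on ball 0 1" shows "gcomb (\<lambda>z. \<phi> (fb z))"
  unfolding gcomb_def
proof (intro exI[of _ "\<lambda>j. if j = 0 then \<phi> else (\<lambda>_. 0)"] conjI allI impI)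
  fix z
  have "(\<Sum>j<m. (if j = 0 then \<phi> else (\<lambda>_. 0)) (fb z) * gb z ^ j)
      = (\<Sum>j\<in>{0}. (if j = 0 then \<phi> else (\<lambda>_. 0)) (fb z) * gb z ^ j)"
    using m_pos by (intro sum.mono_neutral_right) auto
  then show "\<phi> (fb z) = (\<Sum>j<m. (if j = 0 then \<phi> else (\<lambda>_. 0)) (fb z) * gb z ^ j)" by simp
qed (use assms in auto)

lemma gcomb_mult_gb:
  assumes "gcomb h" shows "gcomb (\<lambda>z. d * gb z * h z)"
proof -
  obtain b where b: "\<And>j. j < m \<Longrightarrow> b j holomorphic_on ball 0 1"
    "\<And>z. norm z < 1 \<Longrightarrow> h z = (\<Sum>j<m. b j (fb z) * gb z ^ j)" using assms unfolding gcomb_def by blast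
  obtain c where c: "\<And>j. c j holomorphic_on ball 0 1"
    "\<And>z. norm z < 1 \<Longrightarrow> gb z ^ m = (\<Sum>j<m. c j (fb z) * gb z ^ j)" using gb_integral by blast
  obtain k where k: "m = Suc k" using m_pos by (cases m) auto
  \<comment> \<open>Multiplication by g shifts the coefficients by one; the top one, now at g^m, is
    distributed by the integral equation.\<close>
  let ?b = "\<lambda>j \<zeta>. d * ((if j = 0 then 0 else b (j - 1) \<zeta>) + b k \<zeta> * c j \<zeta>)"
  show ?thesis unfolding gcomb_def
  proof (intro exI[of _ ?b] conjI allI impI)
    show "?b j holomorphic_on ball 0 1" if "j < m" for j
      using b(1)[of "j - 1"] b(1)[of k] c(1) that k by (cases "j = 0") (auto intro!: holomorphic_intros)
    fix z :: complex assume z: "norm z < 1"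
    have "gb z * h z = (\<Sum>j<k. b j (fb z) * gb z ^ Suc j) + b k (fb z) * gb z ^ m"
      unfolding b(2)[OF z] unfolding k by (simp add: sum_distrib_left algebra_simps)
    also have "(\<Sum>j<k. b j (fb z) * gb z ^ Suc j) = (\<Sum>j<m. (if j = 0 then 0 else b (j - 1) (fb z)) * gb z ^ j)"
      unfolding k sum.lessThan_Suc_shift by simp
    finally have "gb z * h z = (\<Sum>j<m. ((if j = 0 then 0 else b (j - 1) (fb z)) + b k (fb z) * c j (fb z)) * gb z ^ j)"
      unfolding c(2)[OF z] by (simp add: sum_distrib_left sum.distrib distrib_right mult.assoc)
    then have "d * (gb z * h z) = d * (\<Sum>j<m. ((if j = 0 then 0 else b (j - 1) (fb z)) + b k (fb z) * c j (fb z)) * gb z ^ j)"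
      by simp
    then show "d * gb z * h z = (\<Sum>j<m. ?b j (fb z) * gb z ^ j)"
      by (simp only: sum_distrib_left mult.assoc)
  qed
qed

lemma gcomb_eval2: "gcomb (\<lambda>z. eval2 A (c * fb z) (d * gb z))"
proof (induction A)
  case 0
  then show ?case using gcomb_fb[of "\<lambda>_. 0"] by simp
next
  case (pCons a A)
  have "gcomb (\<lambda>z. poly a (c * fb z))"
    by (rule gcomb_fb[of "\<lambda>\<zeta>. poly a (c * \<zeta>)"]) (intro holomorphic_intros)
  then show ?case using gcomb_add[OF _ gcomb_mult_gb[OF pCons(2), of d]] by (simp add: mult.assoc)
qed

section \<open>The closure of the algebra is the submodule\<close>

lemma root_exists:
  assumes "norm \<zeta> < 1" obtains z where "norm z < 1" "fb z = \<zeta>"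
proof -
  have "degree (P \<zeta>) \<noteq> 0" using degree_P[of \<zeta>] m_pos assms by simp
  then obtain z where "poly (P \<zeta>) z = 0"
    using fundamental_theorem_of_algebra_alt[of "P \<zeta>"] by (metis constant_degree fundamental_theorem_of_algebra)
  then show ?thesis using root_P[of \<zeta> z] assms that by simp
qed

text \<open>Q is N homogenised in the numerator and denominator of f, that is p^d N(f) with d the
  degree of N. This turns the conductor N(f) into a polynomial in z, for which the bounded division
  is available.\<close>

lemma holo_disk_multiples_in_fmod:
  assumes w: "\<And>j. j < m \<Longrightarrow> degree (w j) \<le> L" and N: "N w \<noteq> 0"
  obtains Q where "Q \<noteq> 0" "\<And>k. k \<in> holo_disk \<Longrightarrow> (\<lambda>z. poly Q z * k z) \<in> fmod w"
proof
  let ?d = "degree (N w)"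
  let ?Q = "\<Sum>i\<le>?d. smult (coeff (N w) i) (pt ^ i * p ^ (?d - i))"
  have Q: "poly ?Q z = poly (N w) (fb z) * poly p z ^ ?d" if "norm z < 1" for z
  proof -
    have "poly pt z ^ i * poly p z ^ (?d - i) = fb z ^ i * poly p z ^ ?d" if "i \<le> ?d" for i
      using p_nonzero[of z] that \<open>norm z < 1\<close> by (simp add: fb_def power_divide power_diff)
    then show ?thesis
      by (simp add: poly_sum poly_altdef[of "N w"] sum_distrib_right mult.assoc)
  qed
  show "?Q \<noteq> 0"
  proof
    assume Q0: "?Q = 0"
    \<comment> \<open>As f maps the disk onto itself, Q = 0 would make N vanish on the whole
      disk.\<close>
    have "poly (N w) \<zeta> = 0" if \<zeta>: "norm \<zeta> < 1" for \<zeta>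
    proof -
      obtain z where z: "norm z < 1" "fb z = \<zeta>" using root_exists[OF \<zeta>] .
      then show ?thesis using Q[OF z(1)] p_nonzero[of z] unfolding Q0 by simp
    qed
    then have "ball 0 1 \<subseteq> {\<zeta>. poly (N w) \<zeta> = 0}" by auto
    then have "finite (ball (0::complex) 1)" using poly_roots_finite[OF N] finite_subset by blast
    then show False using finite_imp_not_open[of "ball (0::complex) 1"] by simp
  qed
  fix k assume k: "k \<in> holo_disk"
  have "on_disk (\<lambda>z. poly p z ^ ?d * k z) \<in> holo_disk"
    using holo_disk_holomorphic[OF k] by (intro on_disk_in_holo_disk holomorphic_intros)
  from fmod_conductor[OF w this]
  have "(\<lambda>z. poly (N w) (fb z) * on_disk (\<lambda>z. poly p z ^ ?d * k z) z) \<in> fmod w" by simp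
  moreover have "(\<lambda>z. poly (N w) (fb z) * on_disk (\<lambda>z. poly p z ^ ?d * k z) z) = (\<lambda>z. poly ?Q z * k z)"
    using Q holo_disk_outside[OF k] by (auto simp: fun_eq_iff on_disk_def)
  ultimately show "(\<lambda>z. poly ?Q z * k z) \<in> fmod w" by simp
qed

text \<open>Polynomials in f and g lie in the module, which is closed. Conversely the m coefficient
  functions are approximated by polynomials on the compact set f(K), each within \<epsilon>/m, and
  |g| \<le> 1 keeps the total error below \<epsilon>.\<close>

lemma Alg_eq_fmod:
  assumes N: "N u \<noteq> 0" and c: "c \<noteq> 0" and d: "d \<noteq> 0"
  shows "Alg (\<lambda>z. c * fb z) (\<lambda>z. d * gb z) = fmod u"
proof
  obtain Q where Q: "Q \<noteq> 0" "\<And>k. k \<in> holo_disk \<Longrightarrow> (\<lambda>z. poly Q z * k z) \<in> fmod u"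
    using holo_disk_multiples_in_fmod[of u] degree_u N by blast
  show "Alg (\<lambda>z. c * fb z) (\<lambda>z. d * gb z) \<subseteq> fmod u"
  proof
    fix h assume h: "h \<in> Alg (\<lambda>z. c * fb z) (\<lambda>z. d * gb z)"
    show "h \<in> fmod u"
    proof (rule subspace_closed_if_multiples[OF subspace_fmod fmod_subset Q])
      show "h \<in> holo_disk" using h by (simp add: Alg_def)
      fix K :: "complex set" and \<epsilon> :: real assume K: "compact K" "K \<subseteq> ball 0 1" "\<epsilon> > 0"
      then have "\<exists>A. \<forall>z\<in>K. norm (h z - eval2 A (c * fb z) (d * gb z)) < \<epsilon>"
        using h by (simp add: Alg_def)
      then obtain A where A: "\<And>z. z \<in> K \<Longrightarrow> norm (h z - eval2 A (c * fb z) (d * gb z)) < \<epsilon>" by auto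
      have "on_disk (\<lambda>z. eval2 A (c * fb z) (d * gb z)) \<in> fmod u" using gcomb_iff gcomb_eval2 by blast
      moreover have "norm (h z - on_disk (\<lambda>z. eval2 A (c * fb z) (d * gb z)) z) < \<epsilon>" if "z \<in> K" for z
      proof -
        have "norm z < 1" using K that by auto
        then show ?thesis using A[OF that] by simp
      qed
      ultimately show "\<exists>g\<in>fmod u. \<forall>z\<in>K. norm (h z - g z) < \<epsilon>" by blast
    qed auto
  qed
  show "fmod u \<subseteq> Alg (\<lambda>z. c * fb z) (\<lambda>z. d * gb z)"
  proof
    fix h assume h: "h \<in> fmod u"
    then have hd: "h \<in> holo_disk" using fmod_subset by blast
    then have "on_disk h = h" by (auto simp: fun_eq_iff on_disk_def holo_disk_outside)
    then have "gcomb h" using h gcomb_iff[of h] by simp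
    then obtain b where b: "\<And>j. j < m \<Longrightarrow> b j holomorphic_on ball 0 1"
      "\<And>z. norm z < 1 \<Longrightarrow> h z = (\<Sum>j<m. b j (fb z) * gb z ^ j)" unfolding gcomb_def by blast
    have "\<exists>A. \<forall>z\<in>K. norm (h z - eval2 A (c * fb z) (d * gb z)) < \<epsilon>"
      if K: "compact K" "K \<subseteq> ball 0 1" and \<epsilon>: "\<epsilon> > 0" for K \<epsilon>
    proof -
      have "compact (fb ` K)"
        using K by (intro compact_continuous_image continuous_on_subset[OF continuous_fb]) auto
      moreover have "fb ` K \<subseteq> ball 0 1" using K norm_fb_less by auto
      ultimately have "\<exists>A. \<forall>x\<in>fb ` K. norm (b j x - poly A x) < \<epsilon> / m" if "j < m" for j
        using \<epsilon> m_pos by (intro polynomial_approximation[OF b(1)[OF that]]) auto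
      then have "\<forall>j. \<exists>A. j < m \<longrightarrow> (\<forall>z\<in>K. norm (b j (fb z) - poly A (fb z)) < \<epsilon> / m)" by blast
      then obtain A where A: "\<And>j z. j < m \<Longrightarrow> z \<in> K \<Longrightarrow> norm (b j (fb z) - poly (A j) (fb z)) < \<epsilon> / m" by metis
      \<comment> \<open>The arguments are rescaled by 1/c and 1/d, as the polynomial is evaluated at
        c f and d g.\<close>
      let ?A = "\<Sum>j<m. [:pcompose (A j) [:0, 1 / c:]:] * [:0, [:1 / d:]:] ^ j"
      have "norm (h z - eval2 ?A (c * fb z) (d * gb z)) < \<epsilon>" if z: "z \<in> K" for z
      proof -
        have z1: "norm z < 1" using K z by auto
        have "eval2 ?A (c * fb z) (d * gb z) = (\<Sum>j<m. poly (A j) (fb z) * gb z ^ j)"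
          using c d by (simp add: poly_pcompose)
        then have "norm (h z - eval2 ?A (c * fb z) (d * gb z))
            = norm (\<Sum>j<m. (b j (fb z) - poly (A j) (fb z)) * gb z ^ j)"
          using b(2)[OF z1] by (simp add: left_diff_distrib sum_subtractf)
        also have "\<dots> < (\<Sum>j<m. \<epsilon> / m)"
        proof (rule le_less_trans[OF norm_sum sum_strict_mono])
          fix j assume j: "j \<in> {..<m}"
          have "norm ((b j (fb z) - poly (A j) (fb z)) * gb z ^ j) \<le> norm (b j (fb z) - poly (A j) (fb z)) * 1"
            unfolding norm_mult norm_power using norm_gb_le[OF z1] by (intro mult_left_mono power_le_one) auto
          then show "norm ((b j (fb z) - poly (A j) (fb z)) * gb z ^ j) < \<epsilon> / m" using A[of j z] j z by simp
        qed (use m_pos in auto)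
        also have "\<dots> = \<epsilon>" using m_pos by simp
        finally show ?thesis .
      qed
      then show ?thesis by blast
    qed
    then show "h \<in> Alg (\<lambda>z. c * fb z) (\<lambda>z. d * gb z)" using hd by (simp add: Alg_def)
  qed
qed

end

section \<open>Intersection multiplicity along a smooth branch\<close>

text \<open>Division by w - t, then division by z - s of the remainder, which depends on z
  only.\<close>

lemma eval2_taylor:
  obtains A B where "H = [:[:eval2 H s t:]:] + [:[:- s, 1:]:] * A + [:[:- t:], 1:] * B"
proof -
  have "poly (H - [:poly H [:t:]:]) [:t:] = 0" by simp
  then have "[:- [:t:], 1:] dvd H - [:poly H [:t:]:]" by (simp only: poly_eq_0_iff_dvd)
  then obtain B where B: "H - [:poly H [:t:]:] = [:[:- t:], 1:] * B" by (auto elim: dvdE)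
  have "poly (poly H [:t:] - [:eval2 H s t:]) s = 0" by (simp add: eval2_def)
  then have "[:- s, 1:] dvd poly H [:t:] - [:eval2 H s t:]" by (simp only: poly_eq_0_iff_dvd)
  then obtain A where A: "poly H [:t:] - [:eval2 H s t:] = [:- s, 1:] * A" by (auto elim: dvdE)
  have "H = [:poly H [:t:]:] + [:[:- t:], 1:] * B" using B by (metis add.commute diff_add_cancel)
  also have "poly H [:t:] = [:eval2 H s t:] + [:- s, 1:] * A" using A by (metis add.commute diff_add_cancel)
  also have "[:[:eval2 H s t:] + [:- s, 1:] * A:] = [:[:eval2 H s t:]:] + [:[:- s, 1:]:] * [:A:]" by simp
  finally show ?thesis by (rule that)
qed

lemma tendsto_eval2:
  assumes "(\<phi> \<longlongrightarrow> s) F" "(\<psi> \<longlongrightarrow> t) F"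
  shows "((\<lambda>x. eval2 H (\<phi> x) (\<psi> x)) \<longlongrightarrow> eval2 H s t) F"
proof (induction H)
  case (pCons a H)
  have "((\<lambda>x. poly a (\<phi> x)) \<longlongrightarrow> poly a s) F"
    using assms(1) by (rule isCont_tendsto_compose[rotated]) (rule poly_isCont)
  then show ?case using pCons assms(2) by (simp add: tendsto_intros)
qed simp

section \<open>Closure properties of the local ring and its ideal\<close>

lemma local_ring_Fract: "eval2 b s t \<noteq> 0 \<Longrightarrow> Fract a b \<in> local_ring s t"
  by (auto simp: local_ring_def)

lemma local_ring_add: "x \<in> local_ring s t \<Longrightarrow> y \<in> local_ring s t \<Longrightarrow> x + y \<in> local_ring s t"
proof -
  assume "x \<in> local_ring s t" "y \<in> local_ring s t"
  then obtain a b a' b' where "x = Fract a b" "eval2 b s t \<noteq> 0" "y = Fract a' b'" "eval2 b' s t \<noteq> 0"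
    by (auto simp: local_ring_def)
  moreover from this have "b \<noteq> 0" "b' \<noteq> 0" by auto
  ultimately show ?thesis by (auto intro!: local_ring_Fract)
qed

lemma local_ring_mult: "x \<in> local_ring s t \<Longrightarrow> y \<in> local_ring s t \<Longrightarrow> x * y \<in> local_ring s t"
proof -
  assume "x \<in> local_ring s t" "y \<in> local_ring s t"
  then obtain a b a' b' where "x = Fract a b" "eval2 b s t \<noteq> 0" "y = Fract a' b'" "eval2 b' s t \<noteq> 0"
    by (auto simp: local_ring_def)
  then show ?thesis by (auto intro!: local_ring_Fract)
qed

lemma local_ring_poly: "Fract a 1 \<in> local_ring s t"
  by (rule local_ring_Fract) simp

lemma local_ideal_add: "x \<in> local_ideal F G s t \<Longrightarrow> y \<in> local_ideal F G s t \<Longrightarrow> x + y \<in> local_ideal F G s t"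
proof -
  assume "x \<in> local_ideal F G s t" "y \<in> local_ideal F G s t"
  then obtain u v u' v' where *: "x = u * Fract F 1 + v * Fract G 1" "y = u' * Fract F 1 + v' * Fract G 1"
    "u \<in> local_ring s t" "v \<in> local_ring s t" "u' \<in> local_ring s t" "v' \<in> local_ring s t"
    by (auto simp: local_ideal_def)
  then have "x + y = (u + u') * Fract F 1 + (v + v') * Fract G 1" by (simp only: distrib_right add_ac)
  then show ?thesis using * local_ring_add unfolding local_ideal_def by blast
qed

lemma local_ideal_mult: "c \<in> local_ring s t \<Longrightarrow> x \<in> local_ideal F G s t \<Longrightarrow> c * x \<in> local_ideal F G s t"
proof -
  assume c: "c \<in> local_ring s t" and "x \<in> local_ideal F G s t"
  then obtain u v where *: "x = u * Fract F 1 + v * Fract G 1"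
    "u \<in> local_ring s t" "v \<in> local_ring s t" by (auto simp: local_ideal_def)
  then have "c * x = (c * u) * Fract F 1 + (c * v) * Fract G 1" by (simp only: distrib_left mult.assoc)
  then show ?thesis using * c local_ring_mult unfolding local_ideal_def by blast
qed

lemma local_ideal_F: "u \<in> local_ring s t \<Longrightarrow> u * Fract F 1 \<in> local_ideal F G s t"
  using local_ring_poly[of 0 s t] unfolding local_ideal_def
  by (force simp: Zero_fract_def[symmetric])

lemma local_ideal_G: "u \<in> local_ring s t \<Longrightarrow> u * Fract G 1 \<in> local_ideal F G s t"
  using local_ring_poly[of 0 s t] unfolding local_ideal_def
  by (force simp: Zero_fract_def[symmetric])

lemma subspace_local_ring: "bifract.subspace (local_ring s t)"
  using local_ring_poly[of 0 s t] local_ring_add local_ring_mult[OF local_ring_poly]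
  by (auto simp: bifract.subspace_def scale_fract_def Zero_fract_def)

lemma subspace_local_ideal: "bifract.subspace (local_ideal F G s t)"
  using local_ideal_F[OF local_ring_poly[of 0 s t], of F G] local_ideal_add local_ideal_mult[OF local_ring_poly]
  by (auto simp: bifract.subspace_def scale_fract_def Zero_fract_def)

lemma local_ideal_subset: "local_ideal F G s t \<subseteq> local_ring s t"
  unfolding local_ideal_def using local_ring_add local_ring_mult local_ring_poly by blast

text \<open>If l > k, the limit e would carry a positive power of x - a and be 0.\<close>

lemma tendsto_nonzero_power_unique:
  fixes f :: "complex \<Rightarrow> complex"
  assumes "((\<lambda>x. f x / (x - a) ^ k) \<longlongrightarrow> e) (at a)" "((\<lambda>x. f x / (x - a) ^ l) \<longlongrightarrow> e') (at a)" "e \<noteq> 0"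
  shows "l \<le> k"
proof (rule ccontr)
  assume "\<not> l \<le> k"
  then have lk: "l - k > 0" by simp
  have "((\<lambda>x. (x - a) ^ (l - k) * (f x / (x - a) ^ l)) \<longlongrightarrow> (a - a) ^ (l - k) * e') (at a)"
    by (intro tendsto_intros assms)
  moreover have "\<forall>\<^sub>F x in at a. (x - a) ^ (l - k) * (f x / (x - a) ^ l) = f x / (x - a) ^ k"
    unfolding eventually_at_filter using \<open>\<not> l \<le> k\<close> by (auto simp: power_diff)
  ultimately have "((\<lambda>x. f x / (x - a) ^ k) \<longlongrightarrow> (a - a) ^ (l - k) * e') (at a)"
    by (rule Lim_transform_eventually)
  then have "e = (a - a) ^ (l - k) * e'" by (rule LIM_unique[OF assms(1)])
  then show False using assms(3) lk by simp
qed

text \<open>Near a point of \<open>F = 0\<close> where \<open>F\<^sub>w \<noteq> 0\<close>, the curve is parametrised by \<open>(\<phi>, \<psi>)\<close>, and the intersection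
  multiplicity is the order of vanishing of \<open>G\<close> along it. In the local ring, \<open>w - t\<close> is a multiple of \<open>z - s\<close>
  modulo \<open>F\<close>, so \<open>G\<close> is a unit times \<open>(z - s)\<^sup>k\<close> modulo \<open>F\<close>.\<close>

lemma intersection_multiplicity_branch:
  fixes F G A B :: bipoly and \<phi> \<psi> :: "complex \<Rightarrow> complex"
  assumes F: "F = [:[:- s, 1:]:] * A + [:[:- t:], 1:] * B" and B: "eval2 B s t \<noteq> 0"
    and \<phi>: "(\<phi> \<longlongrightarrow> s) (at a)" and \<psi>: "(\<psi> \<longlongrightarrow> t) (at a)"
    and F0: "\<forall>\<^sub>F x in at a. eval2 F (\<phi> x) (\<psi> x) = 0"
    and \<phi>': "((\<lambda>x. (\<phi> x - s) / (x - a)) \<longlongrightarrow> \<kappa>) (at a)" "\<kappa> \<noteq> 0"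
    and G: "((\<lambda>x. eval2 G (\<phi> x) (\<psi> x) / (x - a) ^ k) \<longlongrightarrow> e) (at a)" "e \<noteq> 0"
  shows "intersection_multiplicity F G s t = enat k"
proof -
  let ?z = "[:[:- s, 1:]:] :: bipoly" and ?O = "local_ring s t" and ?I = "local_ideal F G s t"
  let ?ev = "\<lambda>H x. eval2 H (\<phi> x) (\<psi> x)"
  have z: "eval2 ?z x y = x - s" for x y by simp
  have lim: "((\<lambda>x. ?ev H x) \<longlongrightarrow> eval2 H s t) (at a)" for H by (rule tendsto_eval2[OF \<phi> \<psi>])
  \<comment> \<open>Multiplying by the unit B allows B (w - t) to be replaced by F - (z - s)
    A.\<close>
  have reduce: "\<exists>H1 V. B * H = ?z * H1 + V * F" if H0: "eval2 H s t = 0" for H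
  proof -
    obtain A' B' where H: "H = [:[:eval2 H s t:]:] + ?z * A' + [:[:- t:], 1:] * B'" by (rule eval2_taylor)
    have "H = ?z * A' + [:[:- t:], 1:] * B'" using H unfolding H0 by simp
    then have "B * H = ?z * (B * A' - B' * A) + B' * F" unfolding F by (simp only: algebra_simps)
    then show ?thesis by blast
  qed
  \<comment> \<open>The limit is carried along in the induction: as long as i < k, G vanishes along
    the branch to an order above i, so H1 vanishes at (s, t) and another factor z - s can be taken
    out.\<close>
  have zpow: "\<exists>H1 V. B ^ i * G = ?z ^ i * H1 + V * F
      \<and> ((\<lambda>x. ?ev G x * ?ev B x ^ i / (x - a) ^ i) \<longlongrightarrow> \<kappa> ^ i * eval2 H1 s t) (at a)" if "i \<le> k" for i
    using that
  proof (induction i)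
    case 0
    then show ?case using lim[of G] by (intro exI[of _ G] exI[of _ 0]) simp
  next
    case (Suc i)
    then obtain H1 V where HV: "B ^ i * G = ?z ^ i * H1 + V * F"
      "((\<lambda>x. ?ev G x * ?ev B x ^ i / (x - a) ^ i) \<longlongrightarrow> \<kappa> ^ i * eval2 H1 s t) (at a)" by auto
    have "eval2 H1 s t = 0"
    proof (rule ccontr)
      assume nz: "eval2 H1 s t \<noteq> 0"
      have "((\<lambda>x. ?ev G x / (x - a) ^ k * ?ev B x ^ i) \<longlongrightarrow> e * eval2 B s t ^ i) (at a)"
        by (intro tendsto_intros G(1) lim)
      then have "((\<lambda>x. ?ev G x * ?ev B x ^ i / (x - a) ^ k) \<longlongrightarrow> e * eval2 B s t ^ i) (at a)" by simp
      then have "k \<le> i"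
        using tendsto_nonzero_power_unique[OF HV(2)] nz \<phi>'(2) by simp
      then show False using Suc.prems by simp
    qed
    then obtain H2 V2 where H2: "B * H1 = ?z * H2 + V2 * F" using reduce by blast
    have eq: "B ^ Suc i * G = ?z ^ Suc i * H2 + (?z ^ i * V2 + B * V) * F"
    proof -
      have "B ^ Suc i * G = B * (B ^ i * G)" by (simp only: power_Suc mult.assoc)
      also have "\<dots> = ?z ^ i * (B * H1) + B * V * F" unfolding HV(1) by (simp only: algebra_simps)
      also have "\<dots> = ?z ^ Suc i * H2 + (?z ^ i * V2 + B * V) * F" unfolding H2 by (simp only: algebra_simps power_Suc)
      finally show ?thesis .
    qed
    have "((\<lambda>x. ((\<phi> x - s) / (x - a)) ^ Suc i * ?ev H2 x) \<longlongrightarrow> \<kappa> ^ Suc i * eval2 H2 s t) (at a)"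
      by (intro tendsto_intros \<phi>' lim)
    moreover have "\<forall>\<^sub>F x in at a. ((\<phi> x - s) / (x - a)) ^ Suc i * ?ev H2 x = ?ev G x * ?ev B x ^ Suc i / (x - a) ^ Suc i"
      using F0
    proof (rule eventually_mono)
      fix x assume "?ev F x = 0"
      then have "?ev (B ^ Suc i * G) x = (\<phi> x - s) ^ Suc i * ?ev H2 x"
        unfolding eq by (simp del: power_Suc)
      then show "((\<phi> x - s) / (x - a)) ^ Suc i * ?ev H2 x = ?ev G x * ?ev B x ^ Suc i / (x - a) ^ Suc i"
        by (simp add: power_divide mult.commute del: power_Suc)
    qed
    ultimately have "((\<lambda>x. ?ev G x * ?ev B x ^ Suc i / (x - a) ^ Suc i) \<longlongrightarrow> \<kappa> ^ Suc i * eval2 H2 s t) (at a)"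
      by (rule Lim_transform_eventually)
    then show ?case using eq by blast
  qed
  obtain G1 V where GV: "B ^ k * G = ?z ^ k * G1 + V * F"
    "((\<lambda>x. ?ev G x * ?ev B x ^ k / (x - a) ^ k) \<longlongrightarrow> \<kappa> ^ k * eval2 G1 s t) (at a)" using zpow by blast
  have "((\<lambda>x. ?ev G x / (x - a) ^ k * ?ev B x ^ k) \<longlongrightarrow> e * eval2 B s t ^ k) (at a)"
    by (intro tendsto_intros G(1) lim)
  then have "((\<lambda>x. ?ev G x * ?ev B x ^ k / (x - a) ^ k) \<longlongrightarrow> e * eval2 B s t ^ k) (at a)" by simp
  then have "\<kappa> ^ k * eval2 G1 s t = e * eval2 B s t ^ k" by (rule LIM_unique[OF GV(2)])
  then have G1: "eval2 G1 s t \<noteq> 0" using G(2) B by auto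
  have B0: "B \<noteq> 0" "G1 \<noteq> 0" using B G1 by auto
  \<comment> \<open>At i = k the cofactor G1 does not vanish at the point, so it is invertible in
    the local ring.\<close>
  have zk: "Fract (?z ^ k) 1 \<in> ?I"
  proof -
    have "?z ^ k * G1 = B ^ k * G - V * F" using GV(1) by simp
    then have "Fract (?z ^ k) 1 = Fract (B ^ k * G - V * F) G1"
      using B0 by (simp add: eq_fract)
    also have "\<dots> = Fract (B ^ k) G1 * Fract G 1 + Fract (- V) G1 * Fract F 1"
      using B0 by (simp add: eq_fract algebra_simps)
    finally show ?thesis
      using local_ideal_add[OF local_ideal_G local_ideal_F, of "Fract (B ^ k) G1" s t "Fract (- V) G1" G F]
        local_ring_Fract G1 by metis
  qed
  let ?e = "\<lambda>i. Fract (?z ^ i) 1"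
  have comb: "(\<Sum>i<l. scale_fract (c i) (?e i)) = Fract (\<Sum>i<l. [:[:c i:]:] * ?z ^ i) 1" for c l
    by (induction l) (simp_all add: scale_fract_def Zero_fract_def)
  \<comment> \<open>Expansion in powers of z - s: the constant d is the value of y at the point, and
    what is left is (z - s) y' modulo F.\<close>
  have step: "\<exists>c y. y \<in> ?O \<and> x - (\<Sum>i<l. scale_fract (c i) (?e i)) - ?e l * y \<in> ?I" if x: "x \<in> ?O" for x l
  proof (induction l)
    case 0
    have "0 \<in> ?I" using bifract.subspace_0[OF subspace_local_ideal] .
    then show ?case using x by (intro exI[of _ "\<lambda>_. 0"] exI[of _ x]) (simp flip: One_fract_def)
  next
    case (Suc l)
    then obtain c y where cy: "y \<in> ?O" "x - (\<Sum>i<l. scale_fract (c i) (?e i)) - ?e l * y \<in> ?I" by blast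
    obtain g h where gh: "y = Fract g h" "eval2 h s t \<noteq> 0" using cy(1) by (auto simp: local_ring_def)
    define d where "d = eval2 g s t / eval2 h s t"
    have "eval2 (g - [:[:d:]:] * h) s t = 0" using gh(2) by (simp add: d_def)
    then obtain H1 V where HV: "B * (g - [:[:d:]:] * h) = ?z * H1 + V * F" using reduce by blast
    define y' where "y' = Fract H1 (B * h)"
    have h0: "h \<noteq> 0" using gh(2) by auto
    have "y = scale_fract d 1 + Fract (?z) 1 * y' + Fract V (B * h) * Fract F 1"
    proof -
      have "Fract g h = Fract (B * g) (B * h)" using B0 h0 by (simp add: eq_fract)
      also have "B * g = [:[:d:]:] * (B * h) + ?z * H1 + V * F" using HV by (simp add: algebra_simps)
      also have "Fract \<dots> (B * h) = scale_fract d 1 + Fract (?z) 1 * y' + Fract V (B * h) * Fract F 1"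
        using B0 h0 by (simp add: scale_fract_def y'_def One_fract_def eq_fract algebra_simps)
      finally show ?thesis using gh(1) by simp
    qed
    then have "?e l * y = ?e l * (scale_fract d 1 + Fract (?z) 1 * y' + Fract V (B * h) * Fract F 1)" by (simp only:)
    also have "\<dots> = scale_fract d (?e l) + (?e l * Fract (?z) 1) * y' + ?e l * (Fract V (B * h) * Fract F 1)"
      unfolding scale_fract_def by (simp only: distrib_left mult_1_right mult_1_left mult_ac)
    also have "?e l * Fract (?z) 1 = ?e (Suc l)" by (simp only: power_Suc2 mult_fract mult_1_right)
    finally have "?e l * y = scale_fract d (?e l) + ?e (Suc l) * y' + ?e l * (Fract V (B * h) * Fract F 1)" .
    moreover have "?e l * (Fract V (B * h) * Fract F 1) \<in> ?I"
      using B gh(2) by (intro local_ideal_mult local_ring_poly local_ideal_F local_ring_Fract) simp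
    ultimately have "x - (\<Sum>i<Suc l. scale_fract ((c(l := d)) i) (?e i)) - ?e (Suc l) * y'
        = (x - (\<Sum>i<l. scale_fract (c i) (?e i)) - ?e l * y) + ?e l * (Fract V (B * h) * Fract F 1)"
      by (simp add: algebra_simps)
    also have "\<dots> \<in> ?I"
      using cy(2) \<open>?e l * (Fract V (B * h) * Fract F 1) \<in> ?I\<close> by (rule local_ideal_add)
    finally have "x - (\<Sum>i<Suc l. scale_fract ((c(l := d)) i) (?e i)) - ?e (Suc l) * y' \<in> ?I" .
    moreover have "y' \<in> ?O" unfolding y'_def using B gh(2) by (intro local_ring_Fract) simp
    ultimately show ?case by blast
  qed
  \<comment> \<open>Along the branch an element of the ideal vanishes to order at least k, but the
    combination has order l < k, where c l is its first nonzero coefficient.\<close>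
  have ind: "c i = 0" if mem: "(\<Sum>i<k. scale_fract (c i) (?e i)) \<in> ?I" and i: "i < k" for c i
  proof (rule ccontr)
    assume "c i \<noteq> 0"
    define l where "l = (LEAST i. c i \<noteq> 0)"
    have l: "c l \<noteq> 0" unfolding l_def by (rule LeastI[of "\<lambda>i. c i \<noteq> 0"]) fact
    have li: "l \<le> i" unfolding l_def by (rule Least_le) fact
    have lj: "c j = 0" if "j < l" for j using not_less_Least[of j "\<lambda>i. c i \<noteq> 0"] that unfolding l_def by blast
    obtain a1 b1 a2 b2 where ab: "(\<Sum>i<k. scale_fract (c i) (?e i)) = Fract a1 b1 * Fract F 1 + Fract a2 b2 * Fract G 1"
      "eval2 b1 s t \<noteq> 0" "eval2 b2 s t \<noteq> 0"
      using mem unfolding local_ideal_def local_ring_def by blast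
    have b0: "b1 \<noteq> 0" "b2 \<noteq> 0" using ab by auto
    let ?S = "\<Sum>i<k. [:[:c i:]:] * ?z ^ i"
    have "b1 * b2 * ?S = a1 * b2 * F + a2 * b1 * G"
      using ab(1) b0 unfolding comb by (simp add: eq_fract algebra_simps)
    then have "?ev (b1 * b2 * ?S) x = ?ev (a1 * b2 * F + a2 * b1 * G) x" for x by simp
    then have evS: "?ev (b1 * b2) x * (\<Sum>i<k. c i * (\<phi> x - s) ^ i)
        = ?ev (a1 * b2) x * ?ev F x + ?ev (a2 * b1) x * ?ev G x" for x by simp
    have "((\<lambda>x. ?ev (a2 * b1) x * (?ev G x / (x - a) ^ k)) \<longlongrightarrow> eval2 (a2 * b1) s t * e) (at a)"
      by (intro tendsto_intros lim G)
    then have up: "((\<lambda>x. ?ev (a2 * b1) x * ?ev G x / (x - a) ^ k) \<longlongrightarrow> eval2 (a2 * b1) s t * e) (at a)" by simp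
    let ?r = "\<lambda>x. \<Sum>i\<in>{l..<k}. c i * ((\<phi> x - s) / (x - a)) ^ l * (\<phi> x - s) ^ (i - l)"
    have "((\<lambda>x. ?ev (b1 * b2) x * ?r x) \<longlongrightarrow> eval2 (b1 * b2) s t * (\<Sum>i\<in>{l..<k}. c i * \<kappa> ^ l * (s - s) ^ (i - l))) (at a)"
      by (intro tendsto_intros lim \<phi> \<phi>')
    also have "(\<Sum>i\<in>{l..<k}. c i * \<kappa> ^ l * (s - s) ^ (i - l)) = (\<Sum>i\<in>{l}. c i * \<kappa> ^ l * (s - s) ^ (i - l))"
      using li i by (intro sum.mono_neutral_right) auto
    finally have "((\<lambda>x. ?ev (b1 * b2) x * ?r x) \<longlongrightarrow> eval2 (b1 * b2) s t * (c l * \<kappa> ^ l)) (at a)" by simp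
    moreover have "\<forall>\<^sub>F x in at a. ?ev (b1 * b2) x * ?r x = ?ev (a2 * b1) x * ?ev G x / (x - a) ^ l"
      using F0
    proof (rule eventually_mono)
      fix x assume F: "?ev F x = 0"
      have "(\<Sum>i<k. c i * (\<phi> x - s) ^ i) = (\<Sum>i\<in>{l..<k}. c i * (\<phi> x - s) ^ i)"
        using lj li i by (intro sum.mono_neutral_right) auto
      also have "\<dots> = (\<Sum>i\<in>{l..<k}. c i * (\<phi> x - s) ^ l * (\<phi> x - s) ^ (i - l))"
        by (intro sum.cong refl) (simp add: mult.assoc flip: power_add)
      finally have "?r x = (\<Sum>i<k. c i * (\<phi> x - s) ^ i) / (x - a) ^ l"
        by (simp add: sum_divide_distrib power_divide)
      then show "?ev (b1 * b2) x * ?r x = ?ev (a2 * b1) x * ?ev G x / (x - a) ^ l"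
        using evS[of x] F by simp
    qed
    ultimately have "((\<lambda>x. ?ev (a2 * b1) x * ?ev G x / (x - a) ^ l) \<longlongrightarrow> eval2 (b1 * b2) s t * (c l * \<kappa> ^ l)) (at a)"
      by (rule Lim_transform_eventually)
    from tendsto_nonzero_power_unique[OF this up] have "k \<le> l" using l \<phi>'(2) ab by simp
    then show False using li i by simp
  qed
  have inj: "inj_on ?e {..<k}"
  proof (rule inj_onI)
    fix i j assume "i \<in> {..<k}" "j \<in> {..<k}" and eq: "?e i = ?e j"
    then have "?z ^ i = ?z ^ j" by (simp add: eq_fract)
    \<comment> \<open>At z = s + 2 the powers of z - s become powers of 2, which are
      distinct.\<close>
    then have "eval2 (?z ^ i) (s + 2) 0 = eval2 (?z ^ j) (s + 2) 0" by simp
    then have "(2::complex) ^ i = 2 ^ j" by simp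
    then have "norm ((2::complex) ^ i) = norm ((2::complex) ^ j)" by simp
    then show "i = j" by (simp add: norm_power)
  qed
  have "bifract.codim ?O ?I = enat (card (?e ` {..<k}))"
  proof (rule bifract.codim_eqI[OF subspace_local_ideal subspace_local_ring local_ideal_subset])
    show "finite (?e ` {..<k})" by simp
    show "?e ` {..<k} \<subseteq> ?O" using local_ring_poly by blast
  next
    fix u assume "(\<Sum>b\<in>?e ` {..<k}. scale_fract (u b) b) \<in> ?I"
    then have "(\<Sum>i<k. scale_fract (u (?e i)) (?e i)) \<in> ?I" using inj by (simp add: sum.reindex)
    from ind[OF this] show "\<forall>b\<in>?e ` {..<k}. u b = 0" by auto
  next
    fix v assume "v \<in> ?O"
    then obtain c y where cy: "y \<in> ?O" "v - (\<Sum>i<k. scale_fract (c i) (?e i)) - ?e k * y \<in> ?I" using step by blast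
    have "y * ?e k \<in> ?I" using cy(1) zk by (rule local_ideal_mult)
    from local_ideal_add[OF cy(2) this] have "v - (\<Sum>i<k. scale_fract (c i) (?e i)) \<in> ?I" by (simp add: mult.commute)
    moreover have "(\<Sum>i<k. scale_fract (c i) (?e i)) \<in> bifract.span (?e ` {..<k})"
      by (intro bifract.span_sum bifract.span_scale bifract.span_base) auto
    moreover have "v = (v - (\<Sum>i<k. scale_fract (c i) (?e i))) + (\<Sum>i<k. scale_fract (c i) (?e i))" by simp
    ultimately show "\<exists>w\<in>?I. \<exists>x\<in>bifract.span (?e ` {..<k}). v = w + x" by blast
  qed
  then show ?thesis using inj by (simp add: intersection_multiplicity_def card_image)
qed

section \<open>Symmetry of the determinant under reflection in the circle\<close>

text \<open>Every index occurs in m - 1 of the pairs.\<close>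

lemma prod_pairs_mult:
  fixes x :: "nat \<Rightarrow> 'a :: comm_monoid_mult"
  shows "(\<Prod>j<m. \<Prod>i<j. x i * x j) = (\<Prod>i<m. x i) ^ (m - 1)"
proof (induction m)
  case (Suc m)
  have "(\<Prod>j<Suc m. \<Prod>i<j. x i * x j) = (\<Prod>i<m. x i) ^ (m - 1) * ((\<Prod>i<m. x i) * x m ^ m)"
    unfolding prod.lessThan_Suc Suc by (simp add: prod.distrib)
  also have "\<dots> = (\<Prod>i<m. x i) ^ m * x m ^ m"
    by (cases m) (simp_all add: mult_ac)
  finally show ?case by (simp add: power_mult_distrib)
qed simp

text \<open>The reciprocal polynomial with respect to a formal degree d, which may exceed the degree
  of A.\<close>

definition refl_poly :: "nat \<Rightarrow> complex poly \<Rightarrow> complex poly" where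
  "refl_poly d A = (\<Sum>k\<le>d. monom (cnj (coeff A (d - k))) k)"

lemma coeff_refl_poly: "coeff (refl_poly d A) k = (if k \<le> d then cnj (coeff A (d - k)) else 0)"
  by (simp add: refl_poly_def coeff_sum)

lemma poly_refl_poly:
  assumes "degree A \<le> d" "z \<noteq> 0"
  shows "poly (refl_poly d A) z = z ^ d * cnj (poly A (1 / cnj z))"
proof -
  have "poly A (1 / cnj z) = (\<Sum>k\<le>d. coeff A k * (1 / cnj z) ^ k)"
    unfolding poly_altdef using assms(1) by (intro sum.mono_neutral_left) (auto simp: coeff_eq_0)
  then have "z ^ d * cnj (poly A (1 / cnj z)) = (\<Sum>k\<le>d. cnj (coeff A k) * z ^ (d - k))"
    using assms(2) by (simp add: sum_distrib_left power_diff field_simps)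
  also have "\<dots> = (\<Sum>k\<le>d. cnj (coeff A (d - k)) * z ^ k)"
    by (rule sum.reindex_bij_witness[of _ "\<lambda>k. d - k" "\<lambda>k. d - k"]) auto
  finally show ?thesis by (simp add: refl_poly_def poly_sum poly_monom)
qed

lemma poly_eqI_infinite:
  fixes A B :: "complex poly"
  assumes "infinite S" "\<And>z. z \<in> S \<Longrightarrow> poly A z = poly B z"
  shows "A = B"
proof (rule ccontr)
  assume "A \<noteq> B"
  then have "finite {z. poly (A - B) z = 0}" by (intro poly_roots_finite) simp
  moreover have "S \<subseteq> {z. poly (A - B) z = 0}" using assms(2) by auto
  ultimately show False using assms(1) finite_subset by blast
qed

lemma infinite_unit_circle: "infinite (sphere (0::complex) 1)"
proof
  assume "finite (sphere (0::complex) 1)"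
  moreover have "connected (sphere (0::complex) 1)" by (rule connected_sphere) simp
  ultimately have "sphere (0::complex) 1 = {} \<or> (\<exists>a. sphere (0::complex) 1 = {a})"
    using connected_finite_iff_sing by blast
  moreover have "1 \<in> sphere (0::complex) 1" "- 1 \<in> sphere (0::complex) 1" by auto
  moreover have "(1::complex) \<noteq> - 1" by simp
  ultimately show False by (metis empty_iff singletonD)
qed

text \<open>Reflecting z - a gives 1 - conj(a) z: a root a becomes the mirror root 1 / conj a with
  the same multiplicity, or lowers the degree if a = 0.\<close>

lemma refl_poly_linear_power:
  assumes "degree R \<le> d"
  shows "refl_poly (k + d) ([:- a, 1:] ^ k * R) = [:1, - cnj a:] ^ k * refl_poly d R"
proof (rule poly_eqI_infinite[of "- {0}"])
  show "infinite (- {0::complex})" by (simp add: infinite_UNIV_char_0)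
  fix z :: complex assume "z \<in> - {0}"
  then have z: "z \<noteq> 0" by simp
  have "degree ([:- a, 1:] ^ k * R) \<le> k + d"
    using degree_mult_le[of "[:- a, 1:] ^ k" R] degree_power_le[of "[:- a, 1:]" k] assms by simp
  then have "poly (refl_poly (k + d) ([:- a, 1:] ^ k * R)) z
      = (z * cnj (1 / cnj z - a)) ^ k * (z ^ d * cnj (poly R (1 / cnj z)))"
    using z by (simp add: poly_refl_poly power_add power_mult_distrib)
  also have "z * cnj (1 / cnj z - a) = 1 - cnj a * z" using z by (simp add: field_simps)
  also have "z ^ d * cnj (poly R (1 / cnj z)) = poly (refl_poly d R) z"
    using assms z by (simp add: poly_refl_poly)
  finally show "poly (refl_poly (k + d) ([:- a, 1:] ^ k * R)) z = poly ([:1, - cnj a:] ^ k * refl_poly d R) z"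
    by (simp add: mult.commute)
qed

text \<open>The roots of a self-reciprocal polynomial are symmetric with respect to the circle; a deficient degree
  counts as a root at \<open>\<infinity>\<close>, the mirror image of \<open>0\<close>.\<close>

lemma self_reciprocal_root_count:
  assumes A: "A \<noteq> 0" "degree A \<le> d" and sym: "A = smult \<kappa> (refl_poly d A)"
  shows "2 * size (disk_roots A) + size (filter_mset (\<lambda>a. norm a = 1) (proots A)) = d"
proof -
  have \<kappa>: "\<kappa> \<noteq> 0" using sym A by auto
  have split: "\<exists>R. A = [:- a, 1:] ^ order a A * R \<and> degree R = degree A - order a A \<and> order a A \<le> degree A \<and> poly R a \<noteq> 0" for a
  proof -
    obtain R where R: "A = [:- a, 1:] ^ order a A * R" "\<not> [:- a, 1:] dvd R" using order_decomp[OF A(1)] by blast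
    have "R \<noteq> 0" using R by auto
    then have "degree A = order a A + degree R"
      by (subst R(1)) (simp add: degree_mult_eq degree_power_eq)
    then show ?thesis using R by (auto simp: poly_eq_0_iff_dvd)
  qed
  have reflA: "A = smult \<kappa> ([:1, - cnj a:] ^ k * refl_poly (d - k) R)"
    if "A = [:- a, 1:] ^ k * R" "degree R = degree A - k" "k \<le> degree A" for a k R
  proof -
    have "degree R \<le> d - k" using that A(2) by simp
    from refl_poly_linear_power[OF this, of k a]
    have "refl_poly d A = [:1, - cnj a:] ^ k * refl_poly (d - k) R"
      unfolding that(1)[symmetric] using that(3) A(2) by simp
    then show ?thesis using sym by metis
  qed
  \<comment> \<open>Reflecting the factorisation shows that the mirror image of a root has at least
    the same multiplicity; applying this twice gives equality.\<close>
  have ord: "order a A \<le> order (1 / cnj a) A" if a: "a \<noteq> 0" for a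
  proof -
    obtain R where R: "A = [:- a, 1:] ^ order a A * R" "degree R = degree A - order a A" "order a A \<le> degree A"
      using split by blast
    have "[:1, - cnj a:] = smult (- cnj a) [:- (1 / cnj a), 1:]" using a by simp
    then have "[:1, - cnj a:] ^ order a A = smult ((- cnj a) ^ order a A) ([:- (1 / cnj a), 1:] ^ order a A)"
      by (simp only: smult_power)
    then have "A = [:- (1 / cnj a), 1:] ^ order a A * smult (\<kappa> * (- cnj a) ^ order a A) (refl_poly (d - order a A) R)"
      using reflA[OF R] by (simp add: mult.commute)
    then have "[:- (1 / cnj a), 1:] ^ order a A dvd A" by (rule dvdI)
    then show ?thesis using A(1) order_divides by blast
  qed
  have ord_eq: "order (1 / cnj a) A = order a A" if "a \<noteq> 0" for a
    using ord[OF that] ord[of "1 / cnj a"] that by simp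
  \<comment> \<open>A root at 0 of order k makes the degree of the reflection drop to d - k, and A
    is its own reflection up to a constant.\<close>
  have ord0: "order 0 A + degree A = d"
  proof -
    obtain R where R: "A = [:- 0, 1:] ^ order 0 A * R" "degree R = degree A - order 0 A" "order 0 A \<le> degree A" "poly R 0 \<noteq> 0"
      using split by blast
    have eq: "A = smult \<kappa> (refl_poly (d - order 0 A) R)" using reflA[OF R(1-3)] by (simp flip: one_pCons)
    have "coeff A (d - order 0 A) \<noteq> 0"
      by (subst eq) (use R(4) \<kappa> in \<open>simp add: coeff_refl_poly poly_0_coeff_0\<close>)
    then have "d - order 0 A \<le> degree A" by (rule le_degree)
    moreover have "degree A \<le> d - order 0 A"
    proof (rule degree_le, intro allI impI)
      fix i assume "d - order 0 A < i"
      then show "coeff A i = 0" by (subst eq) (simp add: coeff_refl_poly)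
    qed
    ultimately show ?thesis using R(3) A(2) by simp
  qed
  let ?p = "proots A"
  let ?D = "filter_mset (\<lambda>a. norm a < 1) ?p" and ?T = "filter_mset (\<lambda>a. norm a = 1) ?p"
    and ?E = "filter_mset (\<lambda>a. norm a > 1) ?p" and ?C = "filter_mset (\<lambda>a. norm a < 1 \<and> a \<noteq> 0) ?p"
  have "?p = ?D + ?T + ?E"
  proof (rule multiset_eqI)
    fix b :: complex
    consider "norm b < 1" "norm b \<noteq> 1" "\<not> norm b > 1" | "\<not> norm b < 1" "norm b = 1" "\<not> norm b > 1"
      | "\<not> norm b < 1" "norm b \<noteq> 1" "norm b > 1" by linarith
    then show "count ?p b = count (?D + ?T + ?E) b"
      unfolding count_union count_filter_mset by cases simp_all
  qed
  then have "size ?p = size ?D + size ?T + size ?E" by (metis size_union)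
  then have size: "degree A = size ?D + size ?T + size ?E" by (simp add: size_proots_complex)
  have "filter_mset (\<lambda>a. a \<noteq> 0) ?D = ?C" by (simp add: filter_filter_mset conj_commute)
  moreover have "size (filter_mset (\<lambda>a. a = 0) ?D) = order 0 A"
    using A(1) by (simp add: filter_eq_replicate_mset)
  ultimately have D: "size ?D = size ?C + order 0 A"
    using multiset_partition[of ?D "\<lambda>a. a \<noteq> 0"] by (metis (mono_tags, lifting) filter_mset_cong not_not size_union)
  \<comment> \<open>Inversion in the circle matches the roots outside with the nonzero roots
    inside.\<close>
  have "image_mset (\<lambda>a. 1 / cnj a) ?E = ?C"
  proof (rule multiset_eqI)
    fix b
    show "count (image_mset (\<lambda>a. 1 / cnj a) ?E) b = count ?C b"
    proof (cases "b = 0")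
      case True
      have "0 \<notin># image_mset (\<lambda>a. 1 / cnj a) ?E" by auto
      then show ?thesis using True by (simp add: count_eq_zero_iff)
    next
      case False
      have "(\<lambda>a. 1 / cnj a) -` {b} = {1 / cnj b}"
        using False by (auto simp: field_simps)
      then have "count (image_mset (\<lambda>a. 1 / cnj a) ?E) b = (\<Sum>y\<in>{1 / cnj b} \<inter> set_mset ?E. count ?E y)"
        unfolding count_image_mset by simp
      also have "\<dots> = count ?E (1 / cnj b)"
        by (cases "1 / cnj b \<in># ?E") (simp_all only: Int_insert_left_if1 Int_insert_left_if0 Int_empty_left, auto simp: not_in_iff)
      finally have "count (image_mset (\<lambda>a. 1 / cnj a) ?E) b = count ?E (1 / cnj b)" .
      moreover have "norm (1 / cnj b) > 1 \<longleftrightarrow> norm b < 1" using False by (simp add: norm_divide field_simps)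
      ultimately show ?thesis using False A(1) ord_eq[OF False] by simp
    qed
  qed
  then have "size ?E = size ?C" by (metis size_image_mset)
  then show ?thesis using size D ord0 by (simp add: disk_roots_def)
qed

context blaschke_pair
begin

abbreviation "G z w \<equiv> eval2 (curve n \<beta>) z w"

section \<open>The product formula for \<open>N u\<close> and its behaviour on the circle\<close>

lemma G_eq: "(z - w) * G z w = poly q z * poly qt w - poly q w * poly qt z"
proof -
  have "eval2 (([:[:0, 1:]:] - [:0, 1:]) * curve n \<beta>) z w = eval2 (curve_numerator n \<beta>) z w"
    unfolding curve_eq ..
  then show ?thesis by (simp add: curve_numerator_def algebra_simps)
qed

lemma F_eq: "(z - w) * eval2 (curve m \<alpha>) z w = poly p z * poly pt w - poly p w * poly pt z"
proof -
  have "eval2 (([:[:0, 1:]:] - [:0, 1:]) * curve m \<alpha>) z w = eval2 (curve_numerator m \<alpha>) z w"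
    unfolding curve_eq ..
  then show ?thesis by (simp add: curve_numerator_def algebra_simps)
qed

text \<open>The matrix of values factors into the diagonal matrix of q^(m-1) and the Vandermonde
  matrix of g. Every q(z i) occurs in m - 1 pairs, so the determinant is a product over pairs, where
  q(z) q(w) (g(w) - g(z)) = (w - z) (- G z w); the Vandermonde factor of the points cancels.\<close>

lemma N_u_formula:
  assumes z: "\<And>i. i < m \<Longrightarrow> poly (P \<zeta>) (z i) = 0" "inj_on z {..<m}"
    and q: "\<And>i. i < m \<Longrightarrow> poly q (z i) \<noteq> 0"
  shows "poly (N u) \<zeta> = coeff (P \<zeta>) m ^ M * (\<Prod>j<m. \<Prod>i<j. - G (z i) (z j))"
proof -
  let ?V = "\<Prod>j<m. \<Prod>i<j. z j - z i"
  let ?Q = "mat m m (\<lambda>(i, j). if i = j then poly q (z i) ^ (m - 1) else 0)"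
  let ?X = "mat m m (\<lambda>(i, j). gb (z i) ^ j)"
  have U: "mat m m (\<lambda>(i, j). poly (u j) (z i)) = ?Q * ?X"
  proof (rule eq_matI)
    fix i j assume "i < dim_row (?Q * ?X)" "j < dim_col (?Q * ?X)"
    then have ij: "i < m" "j < m" by auto
    have "(?Q * ?X) $$ (i, j) = (\<Sum>k<m. (if i = k then poly q (z i) ^ (m - 1) else 0) * gb (z k) ^ j)"
      using ij by (simp add: scalar_prod_def lessThan_atLeast0)
    also have "\<dots> = (\<Sum>k\<in>{i}. (if i = k then poly q (z i) ^ (m - 1) else 0) * gb (z k) ^ j)"
      using ij by (intro sum.mono_neutral_right) auto
    also have "\<dots> = poly (u j) (z i)"
      using q[OF ij(1)] ij by (simp add: u_def gb_def power_divide power_diff field_simps flip: power_add)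
    finally show "mat m m (\<lambda>(i, j). poly (u j) (z i)) $$ (i, j) = (?Q * ?X) $$ (i, j)" using ij by simp
  qed auto
  have detQ: "det ?Q = (\<Prod>i<m. poly q (z i)) ^ (m - 1)"
  proof -
    have "det ?Q = prod_list (diag_mat ?Q)" by (rule det_upper_triangular[of _ m]) (auto simp: upper_triangular_def)
    also have "diag_mat ?Q = map (\<lambda>i. poly q (z i) ^ (m - 1)) [0..<m]" by (auto simp: diag_mat_def)
    also have "prod_list \<dots> = (\<Prod>i<m. poly q (z i) ^ (m - 1))"
      by (subst prod.distinct_set_conv_list[symmetric]) (simp_all add: lessThan_atLeast0)
    finally show ?thesis by (simp add: prod_power_distrib)
  qed
  have "det (?Q * ?X) = det ?Q * det ?X" by (rule det_mult[of _ m]) auto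
  also have "\<dots> = (\<Prod>j<m. \<Prod>i<j. poly q (z i) * poly q (z j)) * (\<Prod>j<m. \<Prod>i<j. gb (z j) - gb (z i))"
    unfolding detQ det_vandermonde prod_pairs_mult ..
  also have "\<dots> = (\<Prod>j<m. \<Prod>i<j. (z j - z i) * - G (z i) (z j))"
    unfolding prod.distrib[symmetric]
  proof (intro prod.cong refl)
    fix j i assume "j \<in> {..<m}" "i \<in> {..<j}"
    then have ij: "poly q (z i) \<noteq> 0" "poly q (z j) \<noteq> 0" using q by auto
    have "poly q (z i) * poly q (z j) * (gb (z j) - gb (z i)) = poly q (z i) * poly qt (z j) - poly q (z j) * poly qt (z i)"
      using ij by (simp add: gb_def field_simps)
    also have "\<dots> = (z j - z i) * - G (z i) (z j)" unfolding G_eq[symmetric] by (simp add: algebra_simps)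
    finally show "poly q (z i) * poly q (z j) * (gb (z j) - gb (z i)) = (z j - z i) * - G (z i) (z j)" .
  qed
  also have "\<dots> = ?V * (\<Prod>j<m. \<Prod>i<j. - G (z i) (z j))" by (simp only: prod.distrib)
  finally have "?V * poly (N u) \<zeta> = coeff (P \<zeta>) m ^ M * (?V * (\<Prod>j<m. \<Prod>i<j. - G (z i) (z j)))"
    using N_product_formula[of u \<zeta> z, OF degree_u z(1)] U by simp
  then have "?V * poly (N u) \<zeta> = ?V * (coeff (P \<zeta>) m ^ M * (\<Prod>j<m. \<Prod>i<j. - G (z i) (z j)))"
    by (simp only: mult.left_commute)
  then show ?thesis using vandermonde_nonzero[OF z(2)] by (simp only: mult_cancel_left) auto
qed

lemma roots_on_circle:
  assumes "norm \<zeta> = 1"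
  obtains z where "bij_betw z {..<m} {x. poly (P \<zeta>) x = 0}" "\<And>i. i < m \<Longrightarrow> norm (z i) = 1"
    "\<And>i. i < m \<Longrightarrow> poly (P \<zeta>) (z i) = 0"
proof -
  have on: "norm x = 1" if "poly (P \<zeta>) x = 0" for x using root_P[OF that] assms by auto
  obtain z where z: "bij_betw z {..<m} {x. poly (P \<zeta>) x = 0}"
  proof (rule distinct_roots[of \<zeta>])
    fix x assume "poly (P \<zeta>) x = 0"
    then show "poly W x \<noteq> 0" using on by (intro W_circle)
  qed (use assms in auto)
  have "poly (P \<zeta>) (z i) = 0" if "i < m" for i using z that by (auto simp: bij_betw_def)
  then show ?thesis using that[OF z] on by blast
qed

text \<open>Conjugation on the circle interchanges q and qt. Of the n-th power of z w that this
  costs, one factor is used up by the conjugate of z - w, leaving the exponent n - 1.\<close>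

lemma cnj_G:
  assumes z: "norm z = 1" and w: "norm w = 1" and "z \<noteq> w" "0 < n"
  shows "(z * w) ^ (n - 1) * cnj (G z w) = G z w"
proof -
  have zz: "cnj z * z = 1" if "norm z = 1" for z :: complex
    using that by (metis complex_norm_square mult.commute of_real_1 one_power2)
  have qt: "cnj (poly qt x) * x ^ n = poly q x" if "norm x = 1" for x
  proof -
    have "cnj (poly qt x) * x ^ n = poly q x * (cnj x * x) ^ n"
      unfolding blaschke_cnj[OF \<beta> that, symmetric] by (simp add: power_mult_distrib)
    then show ?thesis using zz[OF that] by simp
  qed
  have q: "cnj (poly q x) * x ^ n = poly qt x" if "norm x = 1" for x by (rule blaschke_cnj[OF \<beta> that])
  obtain k where k: "n = Suc k" using \<open>0 < n\<close> by (cases n) auto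
  have "cnj (z - w) * (z * w) = w - z" using zz[OF z] zz[OF w] by (simp add: algebra_simps)
  then have "(w - z) * ((z * w) ^ (n - 1) * cnj (G z w)) = (z * w) ^ n * cnj ((z - w) * G z w)"
    unfolding k by (simp add: mult_ac) 
  also have "\<dots> = (cnj (poly q z) * z ^ n) * (cnj (poly qt w) * w ^ n) - (cnj (poly q w) * w ^ n) * (cnj (poly qt z) * z ^ n)"
    unfolding G_eq by (simp add: power_mult_distrib algebra_simps)
  also have "\<dots> = - ((z - w) * G z w)" unfolding q[OF z] q[OF w] qt[OF z] qt[OF w] G_eq by simp
  also have "\<dots> = (w - z) * G z w" by (simp add: algebra_simps)
  finally show ?thesis using \<open>z \<noteq> w\<close> by simp
qed

text \<open>The identity is checked on the circle, an infinite set. Conjugating the product over the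
  pairs costs the product of all z i to the power (m - 1)(n - 1) = M, which is absorbed by the M-th
  power of the leading coefficient of P.\<close>

lemma N_u_reflection:
  "N u = smult (((- 1) ^ Suc m) ^ M) (refl_poly M (N u))"
proof (rule poly_eqI_infinite[OF infinite_unit_circle])
  fix \<zeta> :: complex assume "\<zeta> \<in> sphere 0 1"
  then have \<zeta>: "norm \<zeta> = 1" by simp
  obtain z where z: "bij_betw z {..<m} {x. poly (P \<zeta>) x = 0}" "\<And>i. i < m \<Longrightarrow> norm (z i) = 1"
    "\<And>i. i < m \<Longrightarrow> poly (P \<zeta>) (z i) = 0" using roots_on_circle[OF \<zeta>] by blast
  have inj: "inj_on z {..<m}" using z(1) by (simp add: bij_betw_def)
  let ?c = "coeff (P \<zeta>) m" and ?G = "\<Prod>j<m. \<Prod>i<j. - G (z i) (z j)" and ?z = "\<Prod>i<m. z i"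
  have Nf: "poly (N u) \<zeta> = ?c ^ M * ?G"
    using z q_nonzero inj by (intro N_u_formula) auto
  have c0: "?c \<noteq> 0" using coeff_P_nonzero \<zeta> by simp
  have \<zeta>\<zeta>: "cnj \<zeta> * \<zeta> = 1" using \<zeta> by (metis complex_norm_square mult.commute of_real_1 one_power2)
  \<comment> \<open>Vieta's formula for the product of the roots. With c the leading coefficient,
    P(0) = pt(0) - \<zeta> = - \<zeta> conj(c), because |\<zeta>| = 1; the sign in the symmetry
    arises here.\<close>
  have cz: "?c * ?z = (- 1) ^ Suc m * \<zeta> * cnj ?c"
  proof -
    have deg: "degree (\<Prod>i<m. [:- z i, 1:]) = m" by (simp add: degree_prod_eq_sum_degree)
    have "lead_coeff (\<Prod>i<m. [:- z i, 1:]) = 1" by (simp add: lead_coeff_prod)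
    then have lc: "coeff (\<Prod>i<m. [:- z i, 1:]) m = 1" unfolding deg .
    have Pz: "P \<zeta> = smult ?c (\<Prod>i<m. [:- z i, 1:])"
    proof (rule poly_eqI_degree_lead_coeff[of _ m _ "z ` {..<m}"])
      show "card (z ` {..<m}) \<ge> m" using inj by (simp add: card_image)
      show "poly (P \<zeta>) x = poly (smult ?c (\<Prod>i<m. [:- z i, 1:])) x" if "x \<in> z ` {..<m}" for x
        using that z(3) by (auto simp: poly_prod)
    qed (use lc deg degree_P_le in auto)
    have "poly (P \<zeta>) 0 = ?c * (\<Prod>i<m. - z i)" using arg_cong[OF Pz, of "\<lambda>A. poly A 0"] by (simp add: poly_prod)
    also have "(\<Prod>i<m. - z i) = (- 1) ^ m * ?z" using prod.distrib[of "\<lambda>_. - 1" z "{..<m}"] by simp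
    finally have "(- 1) ^ m * poly (P \<zeta>) 0 = ((- 1) ^ m * (- 1) ^ m) * (?c * ?z)" by (simp add: mult_ac)
    also have "(- 1) ^ m * (- 1) ^ m = (1::complex)" by (simp flip: power_mult_distrib)
    finally have cz: "?c * ?z = (- 1) ^ m * poly (P \<zeta>) 0" by simp
    have "poly p 0 = 1" by (simp add: poly_blaschke(1)[OF \<alpha>])
    then have "poly (P \<zeta>) 0 = poly pt 0 - \<zeta>" by (simp add: poly_P)
    also have "\<dots> = - \<zeta> * cnj ?c"
      unfolding coeff_P coeff_blaschke_den_top using \<zeta>\<zeta> by (simp add: algebra_simps)
    finally show ?thesis unfolding cz by simp
  qed
  have GG: "?z ^ M * cnj ?G = ?G"
  proof (cases "n = 0")
    case True
    then have "m = 1" using n_pos by simp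
    then show ?thesis unfolding M_def by simp
  next
    case False
    have "?z ^ M = (\<Prod>j<m. \<Prod>i<j. z i * z j) ^ (n - 1)"
      unfolding prod_pairs_mult M_def by (simp add: power_mult)
    also have "\<dots> = (\<Prod>j<m. \<Prod>i<j. (z i * z j) ^ (n - 1))" by (simp add: prod_power_distrib)
    finally have "?z ^ M * cnj ?G = (\<Prod>j<m. \<Prod>i<j. (z i * z j) ^ (n - 1) * cnj (- G (z i) (z j)))"
      by (simp only: cnj_prod prod.distrib)
    also have "\<dots> = ?G"
    proof (intro prod.cong refl)
      fix j i assume "j \<in> {..<m}" "i \<in> {..<j}"
      then have ij: "i < m" "j < m" "i \<noteq> j" by auto
      then have "z i \<noteq> z j" using inj by (auto simp: inj_on_def)
      then show "(z i * z j) ^ (n - 1) * cnj (- G (z i) (z j)) = - G (z i) (z j)"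
        using cnj_G[of "z i" "z j"] z(2) ij False by simp
    qed
    finally show ?thesis .
  qed
  have "\<zeta> \<noteq> 0" using \<zeta> by auto
  moreover have "1 / cnj \<zeta> = \<zeta>"
    using \<zeta>\<zeta> \<open>\<zeta> \<noteq> 0\<close> by (simp add: divide_eq_eq mult.commute)
  ultimately have r: "poly (refl_poly M (N u)) \<zeta> = \<zeta> ^ M * (cnj ?c ^ M * cnj ?G)"
    using poly_refl_poly[OF degree_N[of u], of \<zeta>] Nf by simp
  have "((- 1) ^ Suc m) ^ M * poly (refl_poly M (N u)) \<zeta> = ((- 1) ^ Suc m * \<zeta> * cnj ?c) ^ M * cnj ?G"
    unfolding r by (simp only: power_mult_distrib mult_ac)
  also have "\<dots> = ?c ^ M * (?z ^ M * cnj ?G)" unfolding cz[symmetric] by (simp only: power_mult_distrib mult_ac)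
  also have "\<dots> = poly (N u) \<zeta>" unfolding GG Nf ..
  finally show "poly (N u) \<zeta> = poly (smult (((- 1) ^ Suc m) ^ M) (refl_poly M (N u))) \<zeta>" by simp
qed

lemma N_u_root_count:
  assumes "N u \<noteq> 0"
  shows "2 * size (disk_roots (N u)) + size (filter_mset (\<lambda>a. norm a = 1) (proots (N u))) = M"
  using assms degree_N N_u_reflection by (rule self_reciprocal_root_count)

end

section \<open>Roots of the determinant on the circle\<close>

lemma holomorphic_eval2:
  assumes "\<phi> holomorphic_on S" "\<psi> holomorphic_on S"
  shows "(\<lambda>x. eval2 H (\<phi> x) (\<psi> x)) holomorphic_on S"
proof (induction H)
  case (pCons a H)
  have "(\<lambda>x. poly a (\<phi> x)) holomorphic_on S" using assms(1) by (intro holomorphic_intros)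
  then show ?case using pCons assms(2) by (auto intro!: holomorphic_intros)
qed simp

lemma order_eqI:
  fixes A :: "complex poly"
  assumes A: "A \<noteq> 0" and lim: "((\<lambda>x. poly A x / (x - a) ^ k) \<longlongrightarrow> e) (at a)" "e \<noteq> 0"
  shows "order a A = k"
proof -
  obtain R where R: "A = [:- a, 1:] ^ order a A * R" "\<not> [:- a, 1:] dvd R" using order_decomp[OF A] by blast
  have "((\<lambda>x. poly R x) \<longlongrightarrow> poly R a) (at a)" by (intro tendsto_intros)
  moreover have "\<forall>\<^sub>F x in at a. poly R x = poly A x / (x - a) ^ order a A"
    unfolding eventually_at_filter by (subst R(1)) auto
  ultimately have lim': "((\<lambda>x. poly A x / (x - a) ^ order a A) \<longlongrightarrow> poly R a) (at a)"
    by (rule Lim_transform_eventually)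
  have "poly R a \<noteq> 0" using R(2) by (simp add: poly_eq_0_iff_dvd)
  then show ?thesis
    using tendsto_nonzero_power_unique[OF lim' lim(1)] tendsto_nonzero_power_unique[OF lim(1) lim' lim(2)] by simp
qed

lemma sum_enat: "(\<Sum>x\<in>I. enat (h x)) = enat (sum h I)"
  by (induction I rule: infinite_finite_induct) (auto simp: zero_enat_def)

lemma unseparated_pairsI:
  assumes "norm s = 1" "norm t = 1" "s \<noteq> t" "f s = f t" "g s = g t"
  shows "{s, t} \<in> unseparated_pairs f g"
  using assms unfolding unseparated_pairs_def by (intro CollectI exI[of _ s] exI[of _ t]) simp

lemma size_filter_proots:
  fixes A :: "complex poly"
  assumes "A \<noteq> 0" "finite V" "\<And>x. x \<in> V \<Longrightarrow> Q x" "\<And>x. poly A x = 0 \<Longrightarrow> Q x \<Longrightarrow> x \<in> V"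
  shows "size (filter_mset Q (proots A)) = (\<Sum>x\<in>V. order x A)"
proof -
  let ?M = "filter_mset Q (proots A)"
  have "size ?M = (\<Sum>x\<in>set_mset ?M. count ?M x)" by (rule size_multiset_overloaded_eq)
  also have "\<dots> = (\<Sum>x\<in>V. count ?M x)"
    using assms by (intro sum.mono_neutral_left) (auto simp: not_in_iff order_root)
  also have "\<dots> = (\<Sum>x\<in>V. order x A)" using assms by (intro sum.cong) auto
  finally show ?thesis .
qed

context blaschke_pair
begin

text \<open>The derivative of f at s is W / p^2, which is nonzero on the circle, so a local inverse
  of f is a branch of the fibre.\<close>

lemma local_branch:
  assumes s: "norm s = 1" and \<zeta>: "poly (P \<zeta>) s = 0"
  obtains \<phi> e where "e > 0" "\<phi> holomorphic_on ball \<zeta> e" "\<phi> \<zeta> = s" "deriv \<phi> \<zeta> \<noteq> 0"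
    "\<And>\<eta>. \<eta> \<in> ball \<zeta> e \<Longrightarrow> poly (P \<eta>) (\<phi> \<eta>) = 0"
proof -
  let ?S = "{z. poly p z \<noteq> 0}"
  have opS: "open ?S" using open_Collect_neq[of "poly p" "\<lambda>_. 0"] by (simp add: continuous_intros)
  have ps: "poly p s \<noteq> 0" using p_nonzero[of s] s by simp
  have fs: "fb s = \<zeta>" using fb_eq_iff[of s \<zeta>] s \<zeta> by simp
  have holo: "fb holomorphic_on ?S" unfolding fb_def by (intro holomorphic_intros) auto
  have "(fb has_field_derivative poly W s / (poly p s)\<^sup>2) (at s)"
    unfolding fb_def W_def using ps by (auto intro!: derivative_eq_intros simp: power2_eq_square)
  then have d: "deriv fb s \<noteq> 0" using W_circle[OF s] ps by (simp add: DERIV_imp_deriv)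
  obtain r where r: "r > 0" "ball s r \<subseteq> ?S" "open (fb ` ball s r)" "inj_on fb (ball s r)"
    using has_complex_derivative_locally_invertible[OF holo _ opS d] ps by blast
  obtain \<phi> where \<phi>: "\<phi> holomorphic_on fb ` ball s r"
    "\<And>z. z \<in> ball s r \<Longrightarrow> deriv fb z * deriv \<phi> (fb z) = 1" "\<And>z. z \<in> ball s r \<Longrightarrow> \<phi> (fb z) = z"
    using holomorphic_has_inverse[OF holomorphic_on_subset[OF holo r(2)] open_ball r(4)] by blast
  have sr: "s \<in> ball s r" using r(1) by simp
  then obtain e where e: "e > 0" "ball \<zeta> e \<subseteq> fb ` ball s r"
    using r(3) fs by (metis imageI open_contains_ball)
  show ?thesis
  proof (rule that[OF e(1)])
    show "\<phi> holomorphic_on ball \<zeta> e" using \<phi>(1) e(2) by (rule holomorphic_on_subset)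
    show "\<phi> \<zeta> = s" "deriv \<phi> \<zeta> \<noteq> 0" using \<phi>(2,3)[OF sr] fs by auto
    fix \<eta> assume "\<eta> \<in> ball \<zeta> e"
    then obtain z where z: "z \<in> ball s r" "\<eta> = fb z" using e(2) by auto
    then have "poly p z \<noteq> 0" using r(2) by auto
    then show "poly (P \<eta>) (\<phi> \<eta>) = 0" using z \<phi>(3)[OF z(1)] by (simp add: poly_P fb_def)
  qed
qed

text \<open>For z = s the curve equation reads p(s) P(w) = (s - w) (w - t) B(s, w). At w = t the
  derivative of the left side is nonzero because t is a simple root. So F = 0 is smooth at (s, t)
  and not tangent to the line z = s.\<close>

lemma F_decomposition:
  assumes s: "norm s = 1" and t: "norm t = 1" and st: "s \<noteq> t"
    and \<zeta>: "poly (P \<zeta>) s = 0" "poly (P \<zeta>) t = 0"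
  obtains A B where "curve m \<alpha> = [:[:- s, 1:]:] * A + [:[:- t:], 1:] * B" "eval2 B s t \<noteq> 0"
proof -
  have pt: "poly pt s = \<zeta> * poly p s" "poly pt t = \<zeta> * poly p t" using \<zeta> by (simp_all add: poly_P)
  have "(s - t) * eval2 (curve m \<alpha>) s t = 0" unfolding F_eq pt by simp
  then have F0: "eval2 (curve m \<alpha>) s t = 0" using st by simp
  obtain A B where AB: "curve m \<alpha> = [:[:eval2 (curve m \<alpha>) s t:]:] + [:[:- s, 1:]:] * A + [:[:- t:], 1:] * B"
    by (rule eval2_taylor)
  then have AB: "curve m \<alpha> = [:[:- s, 1:]:] * A + [:[:- t:], 1:] * B" unfolding F0 by simp
  have Fs: "eval2 (curve m \<alpha>) s w = (w - t) * eval2 B s w" for w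
    unfolding AB by (simp add: algebra_simps)
  have PsF: "poly p s * poly (P \<zeta>) w = (s - w) * ((w - t) * eval2 B s w)" for w
    using F_eq[of s w] unfolding Fs pt by (simp add: poly_P algebra_simps)
  have "(\<lambda>w. poly p s * poly (P \<zeta>) w) = (\<lambda>w. (w - t) * ((s - w) * eval2 B s w))"
    using PsF by (simp add: fun_eq_iff mult.left_commute)
  moreover have "((\<lambda>w. poly p s * poly (P \<zeta>) w) has_field_derivative poly p s * poly (pderiv (P \<zeta>)) t) (at t)"
    by (intro derivative_eq_intros poly_DERIV) auto
  moreover have "((\<lambda>w. (w - t) * ((s - w) * eval2 B s w)) has_field_derivative (s - t) * eval2 B s t) (at t)"
  proof -
    have "(\<lambda>w. (s - w) * eval2 B s w) holomorphic_on UNIV"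
      by (intro holomorphic_intros holomorphic_eval2)
    then have "(\<lambda>w. (s - w) * eval2 B s w) field_differentiable at t"
      by (rule holomorphic_on_imp_differentiable_at) auto
    then obtain D where "((\<lambda>w. (s - w) * eval2 B s w) has_field_derivative D) (at t)"
      by (auto simp: field_differentiable_def)
    moreover have "((\<lambda>w. w - t) has_field_derivative 1) (at t)" by (auto intro!: derivative_eq_intros)
    ultimately show ?thesis using DERIV_mult[of "\<lambda>w. w - t" 1 t UNIV] by fastforce
  qed
  ultimately have eq: "poly p s * poly (pderiv (P \<zeta>)) t = (s - t) * eval2 B s t"
    by (metis DERIV_unique)
  have "poly W t = poly p t * poly (pderiv (P \<zeta>)) t"
    unfolding W_def P_def by (simp add: pderiv_diff pderiv_smult pt algebra_simps)
  then have "poly (pderiv (P \<zeta>)) t \<noteq> 0" using W_circle[OF t] by auto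
  then have "eval2 B s t \<noteq> 0" using eq p_nonzero[of s] s by auto
  then show ?thesis using that AB by blast
qed

text \<open>Near \<zeta> the fibre consists of m holomorphic branches, and N is a nonvanishing
  factor times the product of G along pairs of branches. Each pair of branches parametrises F = 0
  near (z i, z j), so the order of its factor is an intersection multiplicity, and the orders add
  up.\<close>

lemma order_N_u_on_circle:
  assumes \<zeta>: "norm \<zeta> = 1" and N: "N u \<noteq> 0"
  obtains z k where "bij_betw z {..<m} {x. poly (P \<zeta>) x = 0}" "\<And>i. i < m \<Longrightarrow> norm (z i) = 1"
    "\<And>i j. i < j \<Longrightarrow> j < m \<Longrightarrow> intersection_multiplicity (curve m \<alpha>) (curve n \<beta>) (z i) (z j) = enat (k i j)"
    "\<And>i j. i < j \<Longrightarrow> j < m \<Longrightarrow> G (z i) (z j) \<noteq> 0 \<Longrightarrow> k i j = 0"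
    "order \<zeta> (N u) = (\<Sum>j<m. \<Sum>i<j. k i j)"
proof -
  obtain z where z: "bij_betw z {..<m} {x. poly (P \<zeta>) x = 0}" "\<And>i. i < m \<Longrightarrow> norm (z i) = 1"
    "\<And>i. i < m \<Longrightarrow> poly (P \<zeta>) (z i) = 0" using roots_on_circle[OF \<zeta>] by blast
  have inj: "inj_on z {..<m}" using z(1) by (simp add: bij_betw_def)
  have "\<forall>i. \<exists>\<phi> e. i < m \<longrightarrow> e > 0 \<and> \<phi> holomorphic_on ball \<zeta> e \<and> \<phi> \<zeta> = z i \<and> deriv \<phi> \<zeta> \<noteq> 0 \<and>
    (\<forall>\<eta>\<in>ball \<zeta> e. poly (P \<eta>) (\<phi> \<eta>) = 0)"
    using local_branch[of "z i" \<zeta> for i] z(2,3) by metis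
  then obtain \<phi> e where \<phi>: "\<And>i. i < m \<Longrightarrow> e i > 0" "\<And>i. i < m \<Longrightarrow> \<phi> i holomorphic_on ball \<zeta> (e i)"
    "\<And>i. i < m \<Longrightarrow> \<phi> i \<zeta> = z i" "\<And>i. i < m \<Longrightarrow> deriv (\<phi> i) \<zeta> \<noteq> 0"
    "\<And>i \<eta>. i < m \<Longrightarrow> \<eta> \<in> ball \<zeta> (e i) \<Longrightarrow> poly (P \<eta>) (\<phi> i \<eta>) = 0" by metis
  define E where "E = Min (e ` {..<m})"
  have "E \<in> e ` {..<m}" unfolding E_def using m_pos by (intro Min_in) auto
  then have E: "E > 0" "\<And>i. i < m \<Longrightarrow> E \<le> e i"
    using \<phi>(1) by (auto simp: E_def)
  have holo: "\<phi> i holomorphic_on ball \<zeta> E" if "i < m" for i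
    using \<phi>(2)[OF that] E(2)[OF that] by (rule_tac holomorphic_on_subset) auto
  have deriv: "(\<phi> i has_field_derivative deriv (\<phi> i) \<zeta>) (at \<zeta>)" if "i < m" for i
    using holo[OF that] E(1) by (intro holomorphic_derivI[of _ "ball \<zeta> E"]) auto
  have lim: "(\<phi> i \<longlongrightarrow> z i) (at \<zeta>)" if "i < m" for i
    using DERIV_isCont[OF deriv[OF that]] \<phi>(3)[OF that] by (simp add: isCont_def)
  have ball: "\<forall>\<^sub>F \<eta> in at \<zeta>. \<eta> \<in> ball \<zeta> E"
    using E(1) by (intro eventually_at_in_open') auto
  have root: "\<forall>\<^sub>F \<eta> in at \<zeta>. \<forall>i\<in>{..<m}. poly (P \<eta>) (\<phi> i \<eta>) = 0"
    using ball by (rule eventually_mono) (use \<phi>(5) E(2) in force)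
  have distinct: "\<forall>\<^sub>F \<eta> in at \<zeta>. \<forall>j\<in>{..<m}. \<forall>i\<in>{..<m}. i \<noteq> j \<longrightarrow> \<phi> i \<eta> - \<phi> j \<eta> \<noteq> 0"
  proof (intro eventually_ball_finite ballI finite_lessThan)
    fix i j assume "j \<in> {..<m}" "i \<in> {..<m}"
    then have ij: "i < m" "j < m" by auto
    show "\<forall>\<^sub>F \<eta> in at \<zeta>. i \<noteq> j \<longrightarrow> \<phi> i \<eta> - \<phi> j \<eta> \<noteq> 0"
    proof (cases "i = j")
      case False
      then have "z i - z j \<noteq> 0" using inj ij by (auto simp: inj_on_def)
      then have "\<forall>\<^sub>F \<eta> in at \<zeta>. \<phi> i \<eta> - \<phi> j \<eta> \<noteq> 0"
        using tendsto_imp_eventually_ne[OF tendsto_diff[OF lim[OF ij(1)] lim[OF ij(2)]]] by blast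
      then show ?thesis by (rule eventually_mono) simp
    qed simp
  qed
  have qn: "\<forall>\<^sub>F \<eta> in at \<zeta>. \<forall>i\<in>{..<m}. poly q (\<phi> i \<eta>) \<noteq> 0"
  proof (intro eventually_ball_finite ballI finite_lessThan)
    fix i assume "i \<in> {..<m}"
    then have i: "i < m" by simp
    have "((\<lambda>\<eta>. poly q (\<phi> i \<eta>)) \<longlongrightarrow> poly q (z i)) (at \<zeta>)"
      using lim[OF i] by (rule isCont_tendsto_compose[rotated]) (rule poly_isCont)
    then show "\<forall>\<^sub>F \<eta> in at \<zeta>. poly q (\<phi> i \<eta>) \<noteq> 0"
      using tendsto_imp_eventually_ne q_nonzero[of "z i"] z(2)[OF i] by auto
  qed
  have formula: "\<forall>\<^sub>F \<eta> in at \<zeta>. poly (N u) \<eta>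
      = coeff (P \<eta>) m ^ M * (\<Prod>j<m. \<Prod>i<j. - G (\<phi> i \<eta>) (\<phi> j \<eta>))"
    using root distinct qn
  proof eventually_elim
    case (elim \<eta>)
    then show ?case by (intro N_u_formula) (auto simp: inj_on_def)
  qed
  \<comment> \<open>This rules out that G vanishes identically along a pair of branches, so each
    factor has a finite order.\<close>
  have Nn: "\<forall>\<^sub>F \<eta> in at \<zeta>. poly (N u) \<eta> \<noteq> 0"
  proof -
    have "open (- ({x. poly (N u) x = 0} - {\<zeta>}))"
      using poly_roots_finite[OF N] by (intro open_Compl finite_imp_closed) auto
    then have "\<forall>\<^sub>F \<eta> in at \<zeta>. \<eta> \<in> - ({x. poly (N u) x = 0} - {\<zeta>}) - {\<zeta>}"
      by (intro eventually_at_in_open) auto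
    then show ?thesis by (rule eventually_mono) auto
  qed
  define R where "R i j k h \<longleftrightarrow> h \<noteq> 0 \<and> ((\<lambda>\<eta>. G (\<phi> i \<eta>) (\<phi> j \<eta>) / (\<eta> - \<zeta>) ^ k) \<longlongrightarrow> h) (at \<zeta>)
    \<and> (G (z i) (z j) \<noteq> 0 \<longrightarrow> k = 0)" for i j and k :: nat and h :: complex
  have "\<exists>k h. R i j k h"
    if ij: "i < j" "j < m" for i j
  proof -
    let ?g = "\<lambda>\<eta>. G (\<phi> i \<eta>) (\<phi> j \<eta>)"
    have gh: "?g holomorphic_on ball \<zeta> E" using holo ij by (intro holomorphic_eval2) auto
    have "\<forall>\<^sub>F \<eta> in at \<zeta>. \<eta> \<in> ball \<zeta> E \<and> ?g \<eta> \<noteq> 0"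
      using ball formula Nn
    proof eventually_elim
      case (elim \<eta>)
      then have "(\<Prod>j<m. \<Prod>i<j. - G (\<phi> i \<eta>) (\<phi> j \<eta>)) \<noteq> 0" by auto
      then show ?case using elim ij by auto
    qed
    then have nc: "\<exists>w\<in>ball \<zeta> E. ?g w \<noteq> 0" using eventually_happens'[OF at_neq_bot] by blast
    define k where "k = nat (zorder ?g \<zeta>)"
    define h where "h = zor_poly ?g \<zeta>"
    have "(if ?g \<zeta> = 0 then zorder ?g \<zeta> > 0 else zorder ?g \<zeta> = 0) \<and> (\<exists>r>0. cball \<zeta> r \<subseteq> ball \<zeta> E \<and> h holomorphic_on cball \<zeta> r
        \<and> (\<forall>w\<in>cball \<zeta> r. ?g w = h w * (w - \<zeta>) ^ k \<and> h w \<noteq> 0))"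
      unfolding k_def h_def using E(1) nc by (intro zorder_exist_zero[OF gh open_ball connected_ball]) auto
    then obtain r where r: "if ?g \<zeta> = 0 then zorder ?g \<zeta> > 0 else zorder ?g \<zeta> = 0" "r > 0"
      "h holomorphic_on cball \<zeta> r" "\<And>w. w \<in> cball \<zeta> r \<Longrightarrow> ?g w = h w * (w - \<zeta>) ^ k \<and> h w \<noteq> 0" by blast
    have "continuous_on (ball \<zeta> r) h"
      using holomorphic_on_subset[OF r(3) ball_subset_cball] by (rule holomorphic_on_imp_continuous_on)
    then have "isCont h \<zeta>" using r(2) by (simp add: continuous_on_eq_continuous_at)
    then have "(h \<longlongrightarrow> h \<zeta>) (at \<zeta>)" by (simp add: isCont_def)
    moreover have "\<forall>\<^sub>F \<eta> in at \<zeta>. h \<eta> = ?g \<eta> / (\<eta> - \<zeta>) ^ k"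
    proof -
      have "\<forall>\<^sub>F \<eta> in at \<zeta>. \<eta> \<in> ball \<zeta> r - {\<zeta>}" using r(2) by (intro eventually_at_in_open) auto
      then show ?thesis by (rule eventually_mono) (use r(4) in auto)
    qed
    ultimately have "((\<lambda>\<eta>. ?g \<eta> / (\<eta> - \<zeta>) ^ k) \<longlongrightarrow> h \<zeta>) (at \<zeta>)" by (rule Lim_transform_eventually)
    moreover have "h \<zeta> \<noteq> 0" using r(2,4) by simp
    moreover have "G (z i) (z j) \<noteq> 0 \<longrightarrow> k = 0" using r(1) \<phi>(3) ij by (auto simp: k_def)
    ultimately show ?thesis unfolding R_def by blast
  qed
  then have "\<forall>i j. \<exists>k h. i < j \<longrightarrow> j < m \<longrightarrow> R i j k h" by blast
  then obtain k h where "\<And>i j. i < j \<Longrightarrow> j < m \<Longrightarrow> R i j (k i j) (h i j)" by metis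
  then have k: "h i j \<noteq> 0" "((\<lambda>\<eta>. G (\<phi> i \<eta>) (\<phi> j \<eta>) / (\<eta> - \<zeta>) ^ k i j) \<longlongrightarrow> h i j) (at \<zeta>)"
    "G (z i) (z j) \<noteq> 0 \<Longrightarrow> k i j = 0" if "i < j" "j < m" for i j
    using that unfolding R_def by blast+
  show ?thesis
  proof (rule that[OF z(1,2) _ k(3)])
    fix i j assume ij: "i < j" "j < m"
    then have im: "i < m" by simp
    have "z i \<noteq> z j" using inj ij im by (auto simp: inj_on_def)
    then obtain A B where AB: "curve m \<alpha> = [:[:- z i, 1:]:] * A + [:[:- z j:], 1:] * B" "eval2 B (z i) (z j) \<noteq> 0"
      using F_decomposition[of "z i" "z j" \<zeta>] z(2,3) ij im by blast
    show "intersection_multiplicity (curve m \<alpha>) (curve n \<beta>) (z i) (z j) = enat (k i j)"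
    proof (rule intersection_multiplicity_branch[OF AB lim[OF im] lim[OF ij(2)] _ _ \<phi>(4)[OF im] k(2)[OF ij] k(1)[OF ij]])
      show "\<forall>\<^sub>F \<eta> in at \<zeta>. eval2 (curve m \<alpha>) (\<phi> i \<eta>) (\<phi> j \<eta>) = 0"
        using root distinct
      proof eventually_elim
        case (elim \<eta>)
        then have "poly pt (\<phi> i \<eta>) = \<eta> * poly p (\<phi> i \<eta>)" "poly pt (\<phi> j \<eta>) = \<eta> * poly p (\<phi> j \<eta>)"
          using ij im by (auto simp: poly_P)
        then have "(\<phi> i \<eta> - \<phi> j \<eta>) * eval2 (curve m \<alpha>) (\<phi> i \<eta>) (\<phi> j \<eta>) = 0"
          unfolding F_eq by simp
        moreover have "\<phi> i \<eta> - \<phi> j \<eta> \<noteq> 0" using elim(2) ij im by auto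
        ultimately show ?case by simp
      qed
      show "((\<lambda>\<eta>. (\<phi> i \<eta> - z i) / (\<eta> - \<zeta>)) \<longlongrightarrow> deriv (\<phi> i) \<zeta>) (at \<zeta>)"
        using deriv[OF im] \<phi>(3)[OF im] by (simp add: has_field_derivative_iff)
    qed
  next
    let ?K = "\<Sum>j<m. \<Sum>i<j. k i j"
    have "((\<lambda>\<eta>. coeff (P \<eta>) m ^ M * (\<Prod>j<m. \<Prod>i<j. - (G (\<phi> i \<eta>) (\<phi> j \<eta>) / (\<eta> - \<zeta>) ^ k i j)))
        \<longlongrightarrow> coeff (P \<zeta>) m ^ M * (\<Prod>j<m. \<Prod>i<j. - h i j)) (at \<zeta>)"
      unfolding coeff_P using k(2) by (intro tendsto_intros) auto
    moreover have "\<forall>\<^sub>F \<eta> in at \<zeta>. coeff (P \<eta>) m ^ M * (\<Prod>j<m. \<Prod>i<j. - (G (\<phi> i \<eta>) (\<phi> j \<eta>) / (\<eta> - \<zeta>) ^ k i j))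
        = poly (N u) \<eta> / (\<eta> - \<zeta>) ^ ?K"
      using formula
    proof eventually_elim
      case (elim \<eta>)
      have "(\<Prod>j<m. \<Prod>i<j. - (G (\<phi> i \<eta>) (\<phi> j \<eta>) / (\<eta> - \<zeta>) ^ k i j))
          = (\<Prod>j<m. \<Prod>i<j. - G (\<phi> i \<eta>) (\<phi> j \<eta>)) / (\<Prod>j<m. \<Prod>i<j. (\<eta> - \<zeta>) ^ k i j)"
        by (simp only: prod_dividef[symmetric] minus_divide_left)
      also have "(\<Prod>j<m. \<Prod>i<j. (\<eta> - \<zeta>) ^ k i j) = (\<eta> - \<zeta>) ^ ?K"
        by (simp only: power_sum)
      finally show ?case using elim by simp
    qed
    ultimately have "((\<lambda>\<eta>. poly (N u) \<eta> / (\<eta> - \<zeta>) ^ ?K) \<longlongrightarrow> coeff (P \<zeta>) m ^ M * (\<Prod>j<m. \<Prod>i<j. - h i j)) (at \<zeta>)"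
      by (rule Lim_transform_eventually)
    moreover have "coeff (P \<zeta>) m ^ M * (\<Prod>j<m. \<Prod>i<j. - h i j) \<noteq> 0"
      using coeff_P_nonzero[of \<zeta>] \<zeta> k(1) by auto
    ultimately show "order \<zeta> (N u) = ?K" by (rule order_eqI[OF N])
  qed auto
qed

section \<open>From roots on the circle to unseparated pairs\<close>

lemma G_eq_0_iff:
  assumes "norm s \<le> 1" "norm t \<le> 1" "s \<noteq> t"
  shows "G s t = 0 \<longleftrightarrow> gb s = gb t"
proof -
  have "(s - t) * G s t = poly q s * poly q t * (gb t - gb s)"
    unfolding G_eq using q_nonzero[of s] q_nonzero[of t] assms by (simp add: gb_def field_simps)
  then show ?thesis using q_nonzero[of s] q_nonzero[of t] assms by (metis eq_iff_diff_eq_0 mult_eq_0_iff)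
qed

lemma unseparated_fibre:
  assumes z: "bij_betw z {..<m} {x. poly (P \<zeta>) x = 0}" "\<And>i. i < m \<Longrightarrow> norm (z i) = 1" and \<zeta>: "norm \<zeta> = 1"
  shows "bij_betw (\<lambda>(i, j). {z i, z j}) {(i, j). i < j \<and> j < m \<and> gb (z i) = gb (z j)}
    {Q \<in> unseparated_pairs fb gb. fb ` Q = {\<zeta>}}"
proof -
  have inj: "z i = z j \<longleftrightarrow> i = j" if "i < m" "j < m" for i j using z(1) that by (auto simp: bij_betw_def inj_on_def)
  have fz: "fb (z i) = \<zeta>" if "i < m" for i
  proof -
    have "poly (P \<zeta>) (z i) = 0" using z(1) that by (auto simp: bij_betw_def)
    then show ?thesis using root_P(3) \<zeta> by simp
  qed
  have surj: "\<exists>i<m. z i = s" if "norm s = 1" "fb s = \<zeta>" for s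
  proof -
    have "poly (P \<zeta>) s = 0" using fb_eq_iff[of s \<zeta>] that by simp
    then have "s \<in> z ` {..<m}" using z(1) by (simp add: bij_betw_def)
    then show ?thesis by auto
  qed
  show ?thesis
  proof (rule bij_betw_imageI)
    show "inj_on (\<lambda>(i, j). {z i, z j}) {(i, j). i < j \<and> j < m \<and> gb (z i) = gb (z j)}"
      by (auto simp: inj_on_def doubleton_eq_iff inj)
    show "(\<lambda>(i, j). {z i, z j}) ` {(i, j). i < j \<and> j < m \<and> gb (z i) = gb (z j)}
        = {Q \<in> unseparated_pairs fb gb. fb ` Q = {\<zeta>}}" (is "?l = ?r")
    proof
      show "?l \<subseteq> ?r"
      proof clarify
        fix i j assume ij: "i < j" "j < m" "gb (z i) = gb (z j)"
        then have "z i \<noteq> z j" using inj[of i j] by auto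
        then show "{z i, z j} \<in> unseparated_pairs fb gb \<and> fb ` {z i, z j} = {\<zeta>}"
          using ij z(2) fz[of i] fz[of j] by (auto intro!: unseparated_pairsI)
      qed
      show "?r \<subseteq> ?l"
      proof clarify
        fix Q assume Q: "Q \<in> unseparated_pairs fb gb" "fb ` Q = {\<zeta>}"
        then obtain s t where st: "Q = {s, t}" "norm s = 1" "norm t = 1" "s \<noteq> t" "gb s = gb t"
          unfolding unseparated_pairs_def by auto
        then have "fb s = \<zeta>" "fb t = \<zeta>" using Q(2) by auto
        then obtain i j where ij: "i < m" "z i = s" "j < m" "z j = t" using surj st(2,3) by blast
        then have "i \<noteq> j" using st by auto
        then have "i < j \<or> j < i" by auto
        then show "Q \<in> ?l"
        proof
          assume "i < j"
          then show ?thesis using ij st by (intro image_eqI[of _ _ "(i, j)"]) auto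
        next
          assume "j < i"
          then show ?thesis using ij st by (intro image_eqI[of _ _ "(j, i)"]) auto
        qed
      qed
    qed
  qed
qed

text \<open>Finitely many pairs involve finitely many values of f, so some fibre over the circle is
  separated by g; there the product formula has no zero factor.\<close>

lemma N_u_nonzero:
  assumes "finite (unseparated_pairs fb gb)"
  shows "N u \<noteq> 0"
proof -
  have "finite ((\<lambda>Q. fb (SOME s. s \<in> Q)) ` unseparated_pairs fb gb)" using assms by simp
  then obtain \<zeta> where \<zeta>: "\<zeta> \<in> sphere 0 1" "\<zeta> \<notin> (\<lambda>Q. fb (SOME s. s \<in> Q)) ` unseparated_pairs fb gb"
    using infinite_unit_circle by (meson finite_subset subsetI)
  then have \<zeta>1: "norm \<zeta> = 1" by simp
  obtain z where z: "bij_betw z {..<m} {x. poly (P \<zeta>) x = 0}" "\<And>i. i < m \<Longrightarrow> norm (z i) = 1"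
    "\<And>i. i < m \<Longrightarrow> poly (P \<zeta>) (z i) = 0" using roots_on_circle[OF \<zeta>1] by blast
  have inj: "inj_on z {..<m}" using z(1) by (simp add: bij_betw_def)
  have f: "poly (N u) \<zeta> = coeff (P \<zeta>) m ^ M * (\<Prod>j<m. \<Prod>i<j. - G (z i) (z j))"
    using z q_nonzero inj by (intro N_u_formula) auto
  have "G (z i) (z j) \<noteq> 0" if ij: "i < j" "j < m" for i j
  proof
    assume G0: "G (z i) (z j) = 0"
    have ne: "z i \<noteq> z j" using inj ij by (auto simp: inj_on_def)
    then have "gb (z i) = gb (z j)" using G0 G_eq_0_iff[of "z i" "z j"] z(2) ij by simp
    moreover have fz: "fb (z i) = \<zeta>" "fb (z j) = \<zeta>" using root_P(3)[OF z(3)] \<zeta>1 ij by auto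
    ultimately have U: "{z i, z j} \<in> unseparated_pairs fb gb"
      using ne z(2) ij by (intro unseparated_pairsI) auto
    have "(SOME s. s \<in> {z i, z j}) \<in> {z i, z j}" by (rule someI[of _ "z i"]) simp
    then have "fb (SOME s. s \<in> {z i, z j}) = \<zeta>" using fz by auto
    then show False using \<zeta>(2) U by (metis image_eqI)
  qed
  then have "poly (N u) \<zeta> \<noteq> 0" unfolding f using coeff_P_nonzero[of \<zeta>] \<zeta>1 by auto
  then show ?thesis by auto
qed

lemma sum_pair_multiplicity_fibre:
  assumes N: "N u \<noteq> 0" and \<zeta>: "norm \<zeta> = 1"
  shows "(\<Sum>Q | Q \<in> unseparated_pairs fb gb \<and> fb ` Q = {\<zeta>}. pair_multiplicity m \<alpha> n \<beta> Q) = enat (order \<zeta> (N u))"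
proof -
  obtain z k where z: "bij_betw z {..<m} {x. poly (P \<zeta>) x = 0}" "\<And>i. i < m \<Longrightarrow> norm (z i) = 1"
    and k: "\<And>i j. i < j \<Longrightarrow> j < m \<Longrightarrow> intersection_multiplicity (curve m \<alpha>) (curve n \<beta>) (z i) (z j) = enat (k i j)"
    "\<And>i j. i < j \<Longrightarrow> j < m \<Longrightarrow> G (z i) (z j) \<noteq> 0 \<Longrightarrow> k i j = 0"
    "order \<zeta> (N u) = (\<Sum>j<m. \<Sum>i<j. k i j)" by (rule order_N_u_on_circle[OF \<zeta> N]) blast
  have inj: "inj_on z {..<m}" using z(1) by (simp add: bij_betw_def)
  let ?I = "{(i, j). i < j \<and> j < m \<and> gb (z i) = gb (z j)}" and ?J = "{(i, j). i < j \<and> j < m}"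
  have finJ: "finite ?J" by (rule finite_subset[of _ "{..<m} \<times> {..<m}"]) auto
  have "(\<Sum>Q | Q \<in> unseparated_pairs fb gb \<and> fb ` Q = {\<zeta>}. pair_multiplicity m \<alpha> n \<beta> Q)
      = (\<Sum>(i, j)\<in>?I. pair_multiplicity m \<alpha> n \<beta> {z i, z j})"
    using sum.reindex_bij_betw[OF unseparated_fibre[OF z \<zeta>], of "pair_multiplicity m \<alpha> n \<beta>"]
    by (simp add: case_prod_unfold)
  also have "\<dots> = (\<Sum>(i, j)\<in>?I. enat (k i j))"
    by (intro sum.cong) (auto simp: pair_multiplicity_eq k(1))
  also have "\<dots> = enat (\<Sum>(i, j)\<in>?I. k i j)" by (simp add: sum_enat case_prod_unfold)
  \<comment> \<open>Pairs separated by g lie off the curve G = 0 and contribute 0.\<close>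
  also have "(\<Sum>(i, j)\<in>?I. k i j) = (\<Sum>(i, j)\<in>?J. k i j)"
  proof (intro sum.mono_neutral_left finJ ballI)
    fix x assume x: "x \<in> ?J - ?I"
    then obtain i j where ij: "x = (i, j)" "i < j" "j < m" "gb (z i) \<noteq> gb (z j)" by auto
    then have "z i \<noteq> z j" by auto
    then have "G (z i) (z j) \<noteq> 0" using G_eq_0_iff[of "z i" "z j"] z(2) ij by simp
    then show "(case x of (i, j) \<Rightarrow> k i j) = 0" using k(2) ij by simp
  qed auto
  also have "(\<Sum>(i, j)\<in>?J. k i j) = (\<Sum>(j, i)\<in>Sigma {..<m} (\<lambda>j. {..<j}). k i j)"
    by (rule sum.reindex_bij_witness[of _ "\<lambda>(j, i). (i, j)" "\<lambda>(i, j). (j, i)"]) auto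
  also have "\<dots> = (\<Sum>j<m. \<Sum>i<j. k i j)" by (rule sum.Sigma[symmetric]) auto
  finally show ?thesis unfolding k(3) .
qed

lemma sum_pair_multiplicity:
  assumes fin: "finite (unseparated_pairs fb gb)"
  shows "(\<Sum>Q\<in>unseparated_pairs fb gb. pair_multiplicity m \<alpha> n \<beta> Q)
    = enat (size (filter_mset (\<lambda>a. norm a = 1) (proots (N u))))"
proof -
  let ?U = "unseparated_pairs fb gb"
  have N: "N u \<noteq> 0" using N_u_nonzero[OF fin] .
  define v where "v Q = (THE \<zeta>. fb ` Q = {\<zeta>})" for Q
  have v: "fb ` Q = {v Q} \<and> norm (v Q) = 1" if Q: "Q \<in> ?U" for Q
  proof -
    obtain s t where st: "Q = {s, t}" "norm s = 1" "fb s = fb t" using Q unfolding unseparated_pairs_def by auto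
    then have "fb ` Q = {fb s}" by auto
    moreover from this have "v Q = fb s" unfolding v_def by simp
    ultimately show ?thesis using norm_fb_eq[OF st(2)] by simp
  qed
  \<comment> \<open>All points over which either side can be nonzero; the two sides agree fibre by
    fibre.\<close>
  let ?V = "{\<zeta>. poly (N u) \<zeta> = 0 \<and> norm \<zeta> = 1} \<union> v ` ?U"
  have finV: "finite ?V" using poly_roots_finite[OF N] fin by simp
  have "(\<Sum>Q\<in>?U. pair_multiplicity m \<alpha> n \<beta> Q)
      = (\<Sum>\<zeta>\<in>?V. \<Sum>Q | Q \<in> ?U \<and> v Q = \<zeta>. pair_multiplicity m \<alpha> n \<beta> Q)"
    by (rule sum.group[symmetric]) (use fin finV in auto)
  also have "\<dots> = (\<Sum>\<zeta>\<in>?V. enat (order \<zeta> (N u)))"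
  proof (intro sum.cong refl)
    fix \<zeta> assume "\<zeta> \<in> ?V"
    then have \<zeta>: "norm \<zeta> = 1" using v by auto
    have "{Q. Q \<in> ?U \<and> v Q = \<zeta>} = {Q. Q \<in> ?U \<and> fb ` Q = {\<zeta>}}" using v by auto
    then show "(\<Sum>Q | Q \<in> ?U \<and> v Q = \<zeta>. pair_multiplicity m \<alpha> n \<beta> Q) = enat (order \<zeta> (N u))"
      using sum_pair_multiplicity_fibre[OF N \<zeta>] by simp
  qed
  also have "\<dots> = enat (\<Sum>\<zeta>\<in>?V. order \<zeta> (N u))" by (rule sum_enat)
  also have "(\<Sum>\<zeta>\<in>?V. order \<zeta> (N u)) = size (filter_mset (\<lambda>a. norm a = 1) (proots (N u)))"
    by (rule size_filter_proots[symmetric, OF N finV]) (use v in auto)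
  finally show ?thesis .
qed

lemma finite_blaschke_eq: "finite_blaschke c m \<alpha> = (\<lambda>z. c * fb z)" "finite_blaschke d n \<beta> = (\<lambda>z. d * gb z)"
  by (simp_all add: fun_eq_iff finite_blaschke_def fb_def gb_def)

lemma unseparated_pairs_scale:
  "c \<noteq> 0 \<Longrightarrow> d \<noteq> 0 \<Longrightarrow> unseparated_pairs (\<lambda>z. c * fb z) (\<lambda>z. d * gb z) = unseparated_pairs fb gb"
  by (simp add: unseparated_pairs_def)

lemma codim_Alg:
  assumes "c \<noteq> 0" "d \<noteq> 0" and fin: "finite (unseparated_pairs (finite_blaschke c m \<alpha>) (finite_blaschke d n \<beta>))"
  obtains k where "holo.codim holo_disk (Alg (finite_blaschke c m \<alpha>) (finite_blaschke d n \<beta>)) = enat k"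
    "2 * enat k + (\<Sum>Q\<in>unseparated_pairs (finite_blaschke c m \<alpha>) (finite_blaschke d n \<beta>). pair_multiplicity m \<alpha> n \<beta> Q) = enat M"
proof
  have fin': "finite (unseparated_pairs fb gb)"
    using fin unfolding finite_blaschke_eq unseparated_pairs_scale[OF assms(1,2)] .
  note N = N_u_nonzero[OF fin']
  show "holo.codim holo_disk (Alg (finite_blaschke c m \<alpha>) (finite_blaschke d n \<beta>)) = enat (size (disk_roots (N u)))"
    unfolding finite_blaschke_eq Alg_eq_fmod[OF N assms(1,2)] by (rule codim_fmod[OF degree_u N])
  show "2 * enat (size (disk_roots (N u))) + (\<Sum>Q\<in>unseparated_pairs (finite_blaschke c m \<alpha>) (finite_blaschke d n \<beta>).
      pair_multiplicity m \<alpha> n \<beta> Q) = enat M"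
    unfolding finite_blaschke_eq unseparated_pairs_scale[OF assms(1,2)] sum_pair_multiplicity[OF fin']
    using N_u_root_count[OF N] by (simp flip: N_u_root_count[OF N] add: numeral_eq_enat)
qed

end

section \<open>Constant Blaschke products, and the interchange of f and g\<close>

lemma infinite_unseparated_pairs:
  assumes \<alpha>: "\<forall>i\<in>{1..m}. norm (\<alpha> i) < 1" and m: "2 \<le> m"
  shows "infinite (unseparated_pairs (finite_blaschke c m \<alpha>) (finite_blaschke d 0 \<beta>))"
proof
  \<comment> \<open>Only the facts about f are wanted; the Blaschke product z stands in for the
    constant g, as the context excludes n = 0 for m \<ge> 2.\<close>
  interpret blaschke_pair m 1 \<alpha> "\<lambda>_. 0" using \<alpha> m by unfold_locales auto
  let ?U = "unseparated_pairs (finite_blaschke c m \<alpha>) (finite_blaschke d 0 \<beta>)"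
  assume "finite ?U"
  then have "finite ((\<lambda>Q. fb ` Q) ` ?U)" by simp
  moreover have "(\<lambda>\<zeta>. {\<zeta>}) ` sphere 0 1 \<subseteq> (\<lambda>Q. fb ` Q) ` ?U"
  proof clarify
    fix \<zeta> :: complex assume "\<zeta> \<in> sphere 0 1"
    then have \<zeta>: "norm \<zeta> = 1" by simp
    obtain z where z: "bij_betw z {..<m} {x. poly (P \<zeta>) x = 0}" "\<And>i. i < m \<Longrightarrow> norm (z i) = 1"
      "\<And>i. i < m \<Longrightarrow> poly (P \<zeta>) (z i) = 0" using roots_on_circle[OF \<zeta>] by blast
    have "z 0 \<noteq> z 1" using inj_onD[OF bij_betw_imp_inj_on[OF z(1)], of 0 1] m by auto
    moreover have f: "fb (z 0) = \<zeta>" "fb (z 1) = \<zeta>" using root_P(3)[OF z(3)] \<zeta> m by auto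
    ultimately have "{z 0, z 1} \<in> ?U"
      using z(2)[of 0] z(2)[of 1] m unfolding finite_blaschke_eq(1)
      by (intro unseparated_pairsI) (simp_all add: finite_blaschke_def)
    then show "{\<zeta>} \<in> (\<lambda>Q. fb ` Q) ` ?U" using f by (intro image_eqI[of _ _ "{z 0, z 1}"]) auto
  qed
  ultimately have "finite ((\<lambda>\<zeta>. {\<zeta>}) ` sphere (0::complex) 1)" by (rule rev_finite_subset)
  then have "finite (sphere (0::complex) 1)" by (rule finite_imageD) simp
  then show False using infinite_unit_circle by blast
qed

lemma infinite_unseparated_pairs_0:
  "infinite (unseparated_pairs (finite_blaschke c 0 \<alpha>) (finite_blaschke d 0 \<beta>))"
proof
  assume fin: "finite (unseparated_pairs (finite_blaschke c 0 \<alpha>) (finite_blaschke d 0 \<beta>))"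
  have "(\<lambda>t. {1, t}) ` (sphere 0 1 - {1}) \<subseteq> unseparated_pairs (finite_blaschke c 0 \<alpha>) (finite_blaschke d 0 \<beta>)"
    by (auto intro!: unseparated_pairsI simp: finite_blaschke_def)
  then have "finite ((\<lambda>t. {1, t}) ` (sphere 0 1 - {1 :: complex}))" using fin finite_subset by blast
  then have "finite (sphere 0 1 - {1 :: complex})" by (rule finite_imageD) (auto simp: inj_on_def doubleton_eq_iff)
  then show False using infinite_unit_circle by simp
qed

lemma unseparated_pairs_commute: "unseparated_pairs f g = unseparated_pairs g f"
  by (auto simp: unseparated_pairs_def)

lemma Alg_commute: "Alg f g = Alg g f"
proof -
  have "Alg f g \<subseteq> Alg g f" for f g
    unfolding Alg_def by (auto, metis eval2_swap2)
  then show ?thesis by blast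
qed

theorem theorem5p12:
  fixes f g :: "complex \<Rightarrow> complex" and \<alpha> \<beta> :: "nat \<Rightarrow> complex" and c d :: complex
    and m n r :: nat
  assumes "norm c = 1" and "\<forall>i\<in>{1..m}. norm (\<alpha> i) < 1" and "f = finite_blaschke c m \<alpha>"
    and "norm d = 1" and "\<forall>i\<in>{1..n}. norm (\<beta> i) < 1" and "g = finite_blaschke d n \<beta>"
    and "finite (unseparated_pairs f g)"
    and "(\<Sum>P\<in>unseparated_pairs f g. pair_multiplicity m \<alpha> n \<beta> P) = enat r"
  shows "ereal_of_enat (holo.codim holo_disk (Alg f g))
           = ereal (((real m - 1) * (real n - 1) - real r) / 2)"
proof (cases "m = 0")
  case False
  have cd: "c \<noteq> 0" "d \<noteq> 0" using assms(1,4) by auto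
  have n: "0 < n \<or> m = 1"
  proof (rule ccontr)
    assume "\<not> (0 < n \<or> m = 1)"
    then have "n = 0" "2 \<le> m" using False by auto
    then show False using infinite_unseparated_pairs[OF assms(2), of c d \<beta>] assms(3,6,7) by simp
  qed
  interpret blaschke_pair m n \<alpha> \<beta> using False n assms(2,5) by unfold_locales auto
  obtain k where k: "holo.codim holo_disk (Alg f g) = enat k" "2 * enat k + enat r = enat M"
    using codim_Alg[OF cd assms(7)[unfolded assms(3,6)], folded assms(3,6)] unfolding assms(8) by blast
  have "2 * k + r = M" using k(2) by (simp add: numeral_eq_enat)
  then have "2 * real k + real r = real M" by (metis of_nat_add of_nat_mult of_nat_numeral)
  \<comment> \<open>For n = 0 the difference n - 1 is truncated on one side only, but then m = 1 and
    both sides are 0.\<close>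
  also have "\<dots> = (real m - 1) * (real n - 1)"
    unfolding M_def using False n by (cases n) (auto simp: of_nat_diff)
  finally have eq: "2 * real k + real r = (real m - 1) * (real n - 1)" .
  have "real k = ((real m - 1) * (real n - 1) - real r) / 2" unfolding eq[symmetric] by simp
  then show ?thesis unfolding k(1) by simp
next
  case True
  have cd: "c \<noteq> 0" "d \<noteq> 0" using assms(1,4) by auto
  have "n \<noteq> 0"
  proof
    assume "n = 0"
    then show False using infinite_unseparated_pairs_0[of c \<alpha> d \<beta>] assms(3,6,7) True by simp
  qed
  moreover have "\<not> 2 \<le> n"
    using infinite_unseparated_pairs[OF assms(5), of d c \<alpha>] assms(3,6,7) True unseparated_pairs_commute[of f g] by auto
  ultimately have n: "n = 1" by simp
  \<comment> \<open>With f constant, finiteness has forced degree 1 for g. The two functions change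
    roles, and both the count and the formula give 0.\<close>
  interpret blaschke_pair 1 0 \<beta> \<alpha> using assms(5) n by unfold_locales auto
  \<comment> \<open>A Blaschke product of degree 1 is injective on the circle: its fibres there have
    one point.\<close>
  have "unseparated_pairs f g = {}"
  proof (rule ccontr)
    assume "unseparated_pairs f g \<noteq> {}"
    then obtain s t where st: "norm s = 1" "norm t = 1" "s \<noteq> t" "g s = g t"
      unfolding unseparated_pairs_def by auto
    have "fb s = fb t" using st(4) cd unfolding assms(6) n finite_blaschke_eq(1) by simp
    moreover obtain z :: "nat \<Rightarrow> complex" where z: "bij_betw z {..<1} {x. poly (P (fb s)) x = 0}"
      by (rule roots_on_circle[OF norm_fb_eq[OF st(1)]]) blast
    ultimately have "s \<in> z ` {..<1}" "t \<in> z ` {..<1}"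
      using fb_eq_iff[of s "fb s"] fb_eq_iff[of t "fb s"] st by (auto simp: bij_betw_def)
    then show False using st(3) by auto
  qed
  moreover obtain k where k: "holo.codim holo_disk (Alg g f) = enat k"
    "2 * enat k + (\<Sum>Q\<in>unseparated_pairs g f. pair_multiplicity 1 \<beta> 0 \<alpha> Q) = enat M"
  proof -
    have "finite (unseparated_pairs (finite_blaschke d 1 \<beta>) (finite_blaschke c 0 \<alpha>))"
      using assms(3,6,7) True n unseparated_pairs_commute[of f g] by simp
    from codim_Alg[OF cd(2,1) this] show ?thesis using that unfolding assms(3,6) True n by blast
  qed
  ultimately have "k = 0" "r = 0"
    using assms(8) unfolding unseparated_pairs_commute[of g f] M_def by (auto simp: zero_enat_def numeral_eq_enat)
  then show ?thesis using k(1) n unfolding Alg_commute[of f g] by (simp add: zero_enat_def)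
qed

end
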